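(* Let $n \in \mathbb{N}_0$ and denote by $\mathcal{G}_n = \mathcal{G}\big(h_n, \tfrac{1}{\sqrt{n+1}}\,\mathbb{Z}^2\big)$ the Gabor system for the $n$-th Hermite function $h_n$ and the square lattice $\tfrac{1}{\sqrt{n+1}}\,\mathbb{Z}^2$ of density $n+1$. Then $\mathcal{G}_n$ is a Gabor frame for $L^2(\mathbb{R})$ if and only if $n \geq 4$.
   Context: For $n \in \mathbb{N}_0=\{0,1,2,\dots\}$, the $n$-th Hermite function (of unit $L^2(\mathbb{R})$-norm) is $h_n(t) = c_n (-1)^n e^{\pi t^2} \frac{d^n}{dt^n} e^{-2\pi t^2}$, $t\in\mathbb{R}$, with $c_n = 2^{1/4}/\sqrt{n!\,(2\pi)^n 2^n}$. For $z=(x,\omega)\in\mathbb{R}^2$ the time-frequency shift $\pi(z)$ acts on $g\in L^2(\mathbb{R})$ by $\pi(z)g(t) = e^{2\pi i \omega t} g(t-x)$. For a lattice $\Lambda\subset\mathbb{R}^2$ the Gabor system is $\mathcal{G}(g,\Lambda)=\{\pi(\lambda)g \mid \lambda\in\Lambda\}$. It is a (Gabor) frame for $L^2(\mathbb{R})$ if there exist constants $0<A\leq B<\infty$ such that $A\|f\|_{L^2(\mathbb{R})}^2 \leq \sum_{\lambda\in\Lambda} |\langle f,\pi(\lambda)g\rangle|^2 \leq B\|f\|_{L^2(\mathbb{R})}^2$ for all $f\in L^2(\mathbb{R})$, where $\langle f,g\rangle=\int_{\mathbb{R}} f(t)\overline{g(t)}\,dt$. The density of a lattice $\Lambda = M\mathbb{Z}^2$,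 $M\in GL(2,\mathbb{R})$, is $1/|\det M|$. *)

theory Defs
  imports "HOL-Analysis.Analysis"
begin

text \<open>
  \<open>L\<^sup>2(\<real>)\<close> is represented by Borel functions rather than by classes modulo null sets:
  every class of Lebesgue measurable functions has a Borel representative, and the norm and the
  inner product below do not depend on the representative.
\<close>

definition L2 :: "(real \<Rightarrow> complex) set" where
  "L2 = {f \<in> borel_measurable lborel. integrable lborel (\<lambda>t. (cmod (f t))\<^sup>2)}"

definition L2_norm :: "(real \<Rightarrow> complex) \<Rightarrow> real" where
  "L2_norm f = sqrt (LINT t|lborel. (cmod (f t))\<^sup>2)"

definition L2_inner :: "(real \<Rightarrow> complex) \<Rightarrow> (real \<Rightarrow> complex) \<Rightarrow> complex" where
  "L2_inner f g = (LINT t|lborel. f t * cnj (g t))"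

text \<open>
  Frames are families indexed by \<open>I\<close>, so repeated elements count with multiplicity.
  Summability is required explicitly because \<open>infsum\<close> is \<open>0\<close> on families that are not summable.
\<close>

definition L2_frame :: "'i set \<Rightarrow> ('i \<Rightarrow> real \<Rightarrow> complex) \<Rightarrow> bool" where
  "L2_frame I e \<longleftrightarrow>
     (\<forall>i\<in>I. e i \<in> L2) \<and>
     (\<exists>A B :: real. 0 < A \<and> A \<le> B \<and>
       (\<forall>f\<in>L2.
          (\<lambda>i. (cmod (L2_inner f (e i)))\<^sup>2) summable_on I \<and>
          A * (L2_norm f)\<^sup>2 \<le> (\<Sum>\<^sub>\<infinity>i\<in>I. (cmod (L2_inner f (e i)))\<^sup>2) \<and>
          (\<Sum>\<^sub>\<infinity>i\<in>I. (cmod (L2_inner f (e i)))\<^sup>2) \<le> B * (L2_norm f)\<^sup>2))"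

text \<open>A point \<open>z = (x, \<omega>)\<close> of the time-frequency plane has \<open>x = z $ 1\<close> and \<open>\<omega> = z $ 2\<close>.\<close>

definition tf_shift :: "real^2 \<Rightarrow> (real \<Rightarrow> complex) \<Rightarrow> real \<Rightarrow> complex" where
  "tf_shift z g = (\<lambda>t. exp (2 * complex_of_real pi * \<i> * complex_of_real (z $ 2 * t)) * g (t - z $ 1))"

definition gabor_system :: "(real \<Rightarrow> complex) \<Rightarrow> real^2 \<Rightarrow> real \<Rightarrow> complex" where
  "gabor_system g = (\<lambda>z. tf_shift z g)"

definition gabor_frame :: "(real \<Rightarrow> complex) \<Rightarrow> (real^2) set \<Rightarrow> bool" where
  "gabor_frame g \<Lambda> \<longleftrightarrow> L2_frame \<Lambda> (gabor_system g)"

definition int_lattice :: "(real^2) set" where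
  "int_lattice = {z. \<forall>i. z $ i \<in> \<int>}"

definition has_lattice_density :: "(real^2) set \<Rightarrow> real \<Rightarrow> bool" where
  "has_lattice_density \<Lambda> d \<longleftrightarrow>
     (\<exists>M :: real^2^2. invertible M \<and> \<Lambda> = (*v) M ` int_lattice \<and> d = 1 / \<bar>det M\<bar>)"

definition square_lattice :: "real \<Rightarrow> (real^2) set" where
  "square_lattice a = (*\<^sub>R) a ` int_lattice"

lemma square_lattice_density:
  "has_lattice_density (square_lattice (1 / sqrt (real n + 1))) (real n + 1)"
proof -
  define a where "a = 1 / sqrt (real n + 1)"
  have a: "a > 0" "a * a = 1 / (real n + 1)"
    by (auto simp: a_def)
  have det: "det (mat a :: real^2^2) = a * a"
    by (simp add: det_2 mat_def)
  have "invertible (mat a :: real^2^2)"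
    using a(1) det by (simp add: invertible_det_nz)
  moreover have "(*v) (mat a :: real^2^2) = (*\<^sub>R) a"
    by (rule ext) (simp add: vec_eq_iff matrix_vector_mult_def mat_def sum_2 forall_2)
  moreover have "real n + 1 = 1 / \<bar>det (mat a :: real^2^2)\<bar>"
    using a det by simp
  ultimately show ?thesis
    unfolding has_lattice_density_def square_lattice_def a_def[symmetric] by metis
qed

definition hermite_const :: "nat \<Rightarrow> real" where
  "hermite_const n = 2 powr (1/4) / sqrt (fact n * (2 * pi) ^ n * 2 ^ n)"

definition hermite_fun :: "nat \<Rightarrow> real \<Rightarrow> real" where
  "hermite_fun n t =
     hermite_const n * (-1) ^ n * exp (pi * t\<^sup>2) * (deriv ^^ n) (\<lambda>s. exp (- 2 * pi * s\<^sup>2)) t"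

end

(*
  Rescaling time by sqrt (n + 1) turns the lattice into (1/(n+1)) Z x Z. A Parseval argument in both
  variables then shows that the system is a frame iff the n + 1 Zak transforms of the rescaled Hermite
  function, at the times y + j/(n+1), have no common zero. By the generating function of the
  Hermite functions these Zak transforms are, up to a constant, the n-th derivatives at 0 of a basis of
  the (n + 1)-dimensional space V of theta functions of degree n + 1 with a character determined by
  the time and the frequency (all weighted with the Gaussian exp (pi (n+1) z^2 / 2)). So the
  frame property means that for no character the functional F |-> F^(n)(0) vanishes on V.

  An element of V can be prescribed by its n + 1 zeros, subject to a condition on their sum. If that
  condition allows n zeros at 0 and one elsewhere, F^(n)(0) is nonzero. One character remains, for which
  V contains sigma^(n+1) and F = sigma^(n+1) E with E elliptic for the Gaussian integers with its only
  pole at 0. Since sigma (i z) = i sigma z, sigma^(n+1) = z^(n+1) (c + d z^4 + O(z^5)), with d nonzero. As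
  the residue of E vanishes, F^(n)(0) is determined by d and the part of E with poles of order at least 5.
  There is none if n + 1 <= 4, and for n >= 4 there is an E with a pole of order exactly 5.
*)

theory Submission
  imports Defs "HOL-Complex_Analysis.Complex_Analysis"
begin

section \<open>Theta series\<close>

text \<open>Membership in the theta space is obtained constructively. \<open>theta_span\<close> is
  the set of combinations of the \<open>n + 1\<close> theta series, and \<open>theta_mult\<close>
  expands a product of two theta series explicitly, so every product of \<open>n + 1\<close>
  degree-one thetas lies in the span of the right character. If the derivative functional killed all
  the series, it would kill these products; prescribing zeros means choosing the factors. The
  Gaussian weight is the \<open>(n + 1)\<close>-st power of the factor between \<open>theta1\<close>
  and sigma. Hence the functional is \<open>n!\<close> times the residue of
  \<open>sigma_quot ^ (n + 1)\<close> times the quotient of \<open>F\<close> by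
  \<open>theta1 ^ (n + 1)\<close>. Two facts are quantitative: \<open>theta1\<close> vanishes only
  at Gaussian integers, to first order at 0, and the coefficient of \<open>z^5\<close> in sigma, a
  multiple of the invariant \<open>g_2\<close>, is not zero. Both rest on the rapid decay of the
  series, through \<open>exp (- pi) \<le> 1/8\<close>. On the analytic side, sums over translates
  are finite for bounded functions with bounded support; the general case follows by truncation, at
  the price of a factor 2 in the lower frame bound.\<close>

definition unit_char :: "real \<Rightarrow> complex" where
  "unit_char x = cis (2 * pi * x)"

lemma unit_char_add: "unit_char (x + y) = unit_char x * unit_char y"
  by (simp add: unit_char_def cis_mult ring_distribs)

lemma unit_char_diff: "unit_char (x - y) = unit_char x / unit_char y"
  by (simp add: unit_char_def cis_divide right_diff_distrib)

lemma unit_char_minus: "unit_char (- x) = inverse (unit_char x)"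
  by (simp add: unit_char_def)

lemma unit_char_0 [simp]: "unit_char 0 = 1"
  by (simp add: unit_char_def)

lemma norm_unit_char [simp]: "norm (unit_char x) = 1"
  by (simp add: unit_char_def)

lemma unit_char_nonzero [simp]: "unit_char x \<noteq> 0"
  by (simp add: unit_char_def)

lemma cnj_unit_char: "cnj (unit_char x) = unit_char (- x)"
  by (simp add: unit_char_def cis_cnj)

lemma unit_char_of_int [simp]: "unit_char (of_int k) = 1"
  by (simp add: unit_char_def cis_multiple_2pi)

lemma unit_char_of_nat [simp]: "unit_char (of_nat k) = 1"
  using unit_char_of_int[of "int k"] by simp

lemma unit_char_exp: "unit_char x = exp (2 * of_real pi * \<i> * of_real x)"
  by (simp add: unit_char_def cis_conv_exp mult_ac)

lemma unit_char_power: "unit_char x ^ n = unit_char (of_nat n * x)"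
  by (simp add: unit_char_def Complex.DeMoivre mult_ac)

lemma summable_exp_abs_int:
  fixes c :: real
  assumes "c > 0"
  shows "(\<lambda>m::int. exp (- c * \<bar>of_int m\<bar>)) summable_on UNIV"
proof -
  have "summable (\<lambda>n. exp (-c) ^ n)"
    using assms by (intro summable_geometric) auto
  then have nat: "(\<lambda>n::nat. exp (- c * of_nat n)) summable_on UNIV"
    by (intro norm_summable_imp_summable_on) (simp add: exp_of_nat_mult[symmetric] mult.commute)
  have "(\<lambda>m::int. exp (- c * \<bar>of_int m\<bar>)) summable_on (range int)"
    using nat by (subst summable_on_reindex) (auto simp: o_def)
  moreover have "(\<lambda>m::int. exp (- c * \<bar>of_int m\<bar>)) summable_on (range (\<lambda>n. - int n))"
    using nat by (subst summable_on_reindex) (auto simp: o_def inj_on_def)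
  ultimately have "(\<lambda>m::int. exp (- c * \<bar>of_int m\<bar>)) summable_on (range int \<union> range (\<lambda>n. - int n))"
    by (rule summable_on_union)
  also have "range int \<union> range (\<lambda>n. - int n) = UNIV"
  proof -
    have "x \<in> range int \<union> range (\<lambda>n. - int n)" for x :: int
      by (cases x rule: int_cases2) auto
    then show ?thesis by auto
  qed
  finally show ?thesis .
qed

text \<open>The Gaussian is centred at the real point \<open>v + m\<close> and translated by the
  complex \<open>z\<close>. Multiplied by \<open>exp (pi * N / 2 * z^2)\<close> it is, up to a
  scaling of \<open>z\<close>, the generating function of the Hermite functions, so derivatives in
  \<open>z\<close> at 0 produce Hermite values at multiples of \<open>v + m\<close>.\<close>

definition theta_term :: "nat \<Rightarrow> real \<Rightarrow> real \<Rightarrow> int \<Rightarrow> complex \<Rightarrow> complex" where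
  "theta_term N v \<xi> m z =
     unit_char (of_int m * \<xi>) * exp (- of_real pi * of_nat N * (of_real (v + of_int m) - z)\<^sup>2)"

definition theta :: "nat \<Rightarrow> real \<Rightarrow> real \<Rightarrow> complex \<Rightarrow> complex" where
  "theta N v \<xi> z = (\<Sum>\<^sub>\<infinity>m. theta_term N v \<xi> m z)"

text \<open>With \<open>x = v + m - Re z\<close>, the Gaussian decay in \<open>m\<close> is weakened
  to exponential decay by \<open>x^2 - \<bar>x\<bar> + 1 \<ge> 0\<close>. The bound is uniform on
  discs, as the Weierstrass test requires.\<close>

lemma norm_theta_term_le:
  assumes "N \<ge> 1" "norm z \<le> r"
  shows "norm (theta_term N v \<xi> m z) \<le> exp (4 * real N * r\<^sup>2 + 1 + \<bar>v\<bar> + r) * exp (- 1 * \<bar>of_int m\<bar>)"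
proof -
  define x where "x = v + of_int m - Re z"
  have "norm (theta_term N v \<xi> m z)
      = exp (Re (- of_real pi * of_nat N * (of_real (v + of_int m) - z)\<^sup>2))"
    by (simp add: theta_term_def norm_mult)
  also have "Re (- of_real pi * of_nat N * (of_real (v + of_int m) - z)\<^sup>2) =
      - pi * N * x\<^sup>2 + pi * N * (Im z)\<^sup>2"
    by (simp add: x_def power2_eq_square algebra_simps)
  also have "\<dots> \<le> - x\<^sup>2 + 4 * N * r\<^sup>2"
  proof -
    have 1: "1 * x\<^sup>2 \<le> (pi * N) * x\<^sup>2"
      using assms pi_ge_two mult_mono[of 1 pi 1 "real N"] by (intro mult_right_mono) auto
    have "(Im z)\<^sup>2 \<le> r\<^sup>2"
      using abs_Im_le_cmod[of z] assms(2) by (intro power2_le_iff_abs_le[THEN iffD2]) auto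
    then have 2: "(4 * real N) * (Im z)\<^sup>2 \<le> (4 * real N) * r\<^sup>2"
      by (intro mult_left_mono) auto
    have 3: "(pi * real N) * (Im z)\<^sup>2 \<le> (4 * real N) * (Im z)\<^sup>2"
      using pi_less_4 by (intro mult_right_mono) auto
    show ?thesis using 1 2 3 by (simp add: mult_ac)
  qed
  also have "- x\<^sup>2 \<le> 1 - \<bar>x\<bar>"
  proof -
    have "0 \<le> (\<bar>x\<bar> - 1)\<^sup>2 + \<bar>x\<bar>" by simp
    also have "\<dots> = x\<^sup>2 - \<bar>x\<bar> + 1" by (simp add: power2_eq_square algebra_simps)
    finally show ?thesis by simp
  qed
  also have "1 - \<bar>x\<bar> + 4 * N * r\<^sup>2 \<le> (4 * real N * r\<^sup>2 + 1 + \<bar>v\<bar> + r) + (- 1 * \<bar>of_int m\<bar>)"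
    using abs_Re_le_cmod[of z] assms(2) unfolding x_def by linarith
  finally show ?thesis by (simp add: mult_exp_exp)
qed

lemma theta_term_abs_summable:
  assumes "N \<ge> 1"
  shows "(\<lambda>m. norm (theta_term N v \<xi> m z)) summable_on UNIV"
  by (rule summable_on_comparison_test[OF summable_on_cmult_right[OF summable_exp_abs_int[of 1]]])
     (use norm_theta_term_le[OF assms order_refl] in auto)

lemma theta_has_sum:
  assumes "N \<ge> 1"
  shows "((\<lambda>m. theta_term N v \<xi> m z) has_sum theta N v \<xi> z) UNIV"
  unfolding theta_def
  by (rule has_sum_infsum[OF abs_summable_summable[OF theta_term_abs_summable[OF assms]]])

lemma theta_uniform_limit:
  assumes "N \<ge> 1"
  shows "uniform_limit (ball 0 r) (\<lambda>X z. \<Sum>m\<in>X. theta_term N v \<xi> m z) (theta N v \<xi>)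
           (finite_subsets_at_top UNIV)"
  unfolding theta_def
  by (rule Weierstrass_m_test_general[where M = "\<lambda>m. exp (4 * real N * r\<^sup>2 + 1 + \<bar>v\<bar> + r) * exp (- 1 * \<bar>of_int m\<bar>)"])
     (use assms in \<open>auto intro!: norm_theta_term_le[OF assms, of _ r, simplified] summable_on_cmult_right
        summable_exp_abs_int[of 1, simplified]\<close>)

lemma theta_term_holomorphic [holomorphic_intros]:
  "f holomorphic_on A \<Longrightarrow> (\<lambda>z. theta_term N v \<xi> m (f z)) holomorphic_on A"
  unfolding theta_term_def by (intro holomorphic_intros)

lemma theta_holomorphic_UNIV:
  assumes "N \<ge> 1"
  shows "theta N v \<xi> holomorphic_on UNIV"
proof -
  have "theta N v \<xi> holomorphic_on ball 0 r" for r
  proof (rule holomorphic_uniform_limit)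
    show "uniform_limit (cball 0 r) (\<lambda>X z. \<Sum>m\<in>X. theta_term N v \<xi> m z) (theta N v \<xi>)
           (finite_subsets_at_top UNIV)"
      by (rule uniform_limit_on_subset[OF theta_uniform_limit[where r = "r + 1"]]) (use assms in auto)
    show "\<forall>\<^sub>F X in finite_subsets_at_top UNIV.
       continuous_on (cball 0 r) (\<lambda>z. \<Sum>m\<in>X. theta_term N v \<xi> m z) \<and>
       (\<lambda>z. \<Sum>m\<in>X. theta_term N v \<xi> m z) holomorphic_on ball 0 r"
      by (intro always_eventually allI conjI holomorphic_on_imp_continuous_on holomorphic_intros)
  qed auto
  then have "theta N v \<xi> holomorphic_on (\<Union>r. ball 0 r)"
    by (intro holomorphic_on_UN_open) auto
  also have "(\<Union>r::real. ball (0::complex) r) = UNIV"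
    by (auto intro: gt_ex)
  finally show ?thesis .
qed

lemma theta_holomorphic [holomorphic_intros]:
  assumes "N \<ge> 1" "f holomorphic_on A"
  shows "(\<lambda>z. theta N v \<xi> (f z)) holomorphic_on A"
  using holomorphic_on_compose[OF assms(2), of "theta N v \<xi>"] theta_holomorphic_UNIV[OF assms(1)]
  by (auto simp: o_def intro: holomorphic_on_subset)

lemma higher_deriv_sum:
  assumes "finite X" "\<And>x. x \<in> X \<Longrightarrow> f x holomorphic_on UNIV"
  shows "(deriv ^^ n) (\<lambda>z. \<Sum>x\<in>X. f x z) z = (\<Sum>x\<in>X. (deriv ^^ n) (f x) z)"
  using assms
proof (induction X rule: finite_induct)
  case (insert x X)
  have "(deriv ^^ n) (\<lambda>z. f x z + (\<Sum>x\<in>X. f x z)) z = (deriv ^^ n) (f x) z + (deriv ^^ n) (\<lambda>z. \<Sum>x\<in>X. f x z) z"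
    using insert.prems by (intro higher_deriv_add[of _ UNIV] holomorphic_intros) auto
  then show ?case
    using insert by simp
qed simp

text \<open>Locally uniform convergence allows differentiation term by term. The weight
  \<open>g\<close> will be a Gaussian, that of \<open>gauss_sigma\<close> or that of
  \<open>theta_deriv\<close>.\<close>

lemma higher_deriv_theta_has_sum:
  assumes N: "N \<ge> 1" and g: "g holomorphic_on UNIV"
  shows "((\<lambda>m. (deriv ^^ n) (\<lambda>z. g z * theta_term N v \<xi> m z) 0) has_sum
           (deriv ^^ n) (\<lambda>z. g z * theta N v \<xi> z) 0) UNIV"
proof -
  have gA: "g holomorphic_on A" for A
    using g by (rule holomorphic_on_subset) auto
  have "uniform_limit (ball 0 1) (\<lambda>X z. g z * (\<Sum>m\<in>X. theta_term N v \<xi> m z))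
      (\<lambda>z. g z * theta N v \<xi> z) (finite_subsets_at_top UNIV)"
  proof (rule uniform_lim_mult)
    show "uniform_limit (ball 0 1) (\<lambda>X z. g z) g (finite_subsets_at_top UNIV)"
      by (rule uniform_limit_const)
    show "uniform_limit (ball 0 1) (\<lambda>X z. \<Sum>m\<in>X. theta_term N v \<xi> m z) (theta N v \<xi>)
           (finite_subsets_at_top UNIV)"
      by (rule theta_uniform_limit[OF N])
    have "bounded (h ` ball 0 1)" if h: "h holomorphic_on UNIV" for h :: "complex \<Rightarrow> complex"
    proof -
      have "h holomorphic_on cball 0 1"
        using h by (rule holomorphic_on_subset) simp
      then have "compact (h ` cball 0 1)"
        by (intro compact_continuous_image holomorphic_on_imp_continuous_on) auto
      then show ?thesis
        by (rule bounded_subset[OF compact_imp_bounded image_mono[OF ball_subset_cball]])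
    qed
    then show "bounded (g ` ball 0 1)" "bounded (theta N v \<xi> ` ball 0 1)"
      using g theta_holomorphic_UNIV[OF N] by blast+
  qed
  then have "((\<lambda>X. (deriv ^^ n) (\<lambda>z. g z * (\<Sum>m\<in>X. theta_term N v \<xi> m z)) 0) \<longlongrightarrow>
      (deriv ^^ n) (\<lambda>z. g z * theta N v \<xi> z) 0) (finite_subsets_at_top UNIV)"
    by (rule higher_deriv_complex_uniform_limit)
       (auto intro!: always_eventually holomorphic_intros gA)
  moreover have "(deriv ^^ n) (\<lambda>z. g z * (\<Sum>m\<in>X. theta_term N v \<xi> m z)) 0 =
      (\<Sum>m\<in>X. (deriv ^^ n) (\<lambda>z. g z * theta_term N v \<xi> m z) 0)" if "finite X" for X
  proof -
    have "(deriv ^^ n) (\<lambda>z. \<Sum>m\<in>X. g z * theta_term N v \<xi> m z) 0 =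
      (\<Sum>m\<in>X. (deriv ^^ n) (\<lambda>z. g z * theta_term N v \<xi> m z) 0)"
      using that by (intro higher_deriv_sum) (auto intro!: holomorphic_intros gA)
    then show ?thesis by (simp add: sum_distrib_left)
  qed
  ultimately show ?thesis
    unfolding has_sum_def
    by (rule Lim_transform_eventually[OF _ eventually_mono[OF eventually_finite_subsets_at_top_weakI]]) auto
qed

lemma theta_add_of_int:
  "theta N v \<xi> (z + of_int k) = unit_char (of_int k * \<xi>) * theta N v \<xi> z"
proof -
  have "theta N v \<xi> (z + of_int k) = (\<Sum>\<^sub>\<infinity>m. theta_term N v \<xi> m (z + of_int k))"
    by (simp add: theta_def)
  also have "\<dots> = (\<Sum>\<^sub>\<infinity>m. unit_char (of_int k * \<xi>) * theta_term N v \<xi> m z)"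
    by (rule infsum_reindex_bij_witness[of _ "\<lambda>m. m + k" "\<lambda>m. m - k"])
       (auto simp: theta_term_def algebra_simps unit_char_diff)
  finally show ?thesis
    by (simp add: infsum_cmult_right' theta_def)
qed

lemma theta_add_1: "theta N v \<xi> (z + 1) = unit_char \<xi> * theta N v \<xi> z"
  using theta_add_of_int[of N v \<xi> z 1] by simp

text \<open>The shift by \<open>\<i>\<close> multiplies the \<open>m\<close>-th term by the
  exponential of an expression that depends on \<open>m\<close> only through
  \<open>2 * pi * \<i> * N * m\<close>. As \<open>N * m\<close> is an integer, the same factor comes
  out of every term.\<close>

lemma theta_add_ii:
  "theta N v \<xi> (z + \<i>) =
     unit_char (of_nat N * v) * exp (of_real pi * of_nat N - 2 * of_real pi * \<i> * of_nat N * z) * theta N v \<xi> z"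
proof -
  have "theta_term N v \<xi> m (z + \<i>) = unit_char (of_nat N * v) *
      exp (of_real pi * of_nat N - 2 * of_real pi * \<i> * of_nat N * z) * theta_term N v \<xi> m z" for m
  proof -
    define w where "w = of_real (v + of_int m) - z"
    have "- of_real pi * of_nat N * (of_real (v + of_int m) - (z + \<i>))\<^sup>2
       = - of_real pi * of_nat N * w\<^sup>2 + (of_real pi * of_nat N - 2 * of_real pi * \<i> * of_nat N * z)
         + 2 * of_real pi * \<i> * of_real (real N * v) + 2 * of_real pi * \<i> * of_real (real_of_int (int N * m))"
      by (simp add: w_def power2_eq_square algebra_simps)
    then have "exp (- of_real pi * of_nat N * (of_real (v + of_int m) - (z + \<i>))\<^sup>2) =
       exp (- of_real pi * of_nat N * w\<^sup>2) * exp (of_real pi * of_nat N - 2 * of_real pi * \<i> * of_nat N * z)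
         * unit_char (real N * v) * unit_char (of_int (int N * m))"
      by (simp only: exp_add unit_char_exp)
    also have "unit_char (of_int (int N * m)) = 1"
      by (rule unit_char_of_int)
    finally show ?thesis
      by (simp add: theta_term_def w_def mult_ac)
  qed
  then show ?thesis
    by (simp only: theta_def infsum_cmult_right')
qed

section \<open>Products of theta series\<close>

lemma has_sum_product_abs:
  fixes f :: "'a \<Rightarrow> complex" and g :: "'b \<Rightarrow> complex"
  assumes "(f has_sum a) A" "(g has_sum b) B"
    and "(\<lambda>x. norm (f x)) summable_on A" "(\<lambda>y. norm (g y)) summable_on B"
  shows "((\<lambda>(x, y). f x * g y) has_sum a * b) (A \<times> B)"
proof (rule has_sum_SigmaI)
  show "((\<lambda>y. case (x, y) of (x, y) \<Rightarrow> f x * g y) has_sum f x * b) B" for x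
    using has_sum_cmult_right[OF assms(2), of "f x"] by simp
  show "((\<lambda>x. f x * b) has_sum a * b) A"
    by (rule has_sum_cmult_left[OF assms(1)])
  have "(\<lambda>z. norm (f (fst z)) * norm (g (snd z))) summable_on A \<times> B"
  proof (rule summable_on_SigmaI)
    show "((\<lambda>y. norm (f (fst (x, y))) * norm (g (snd (x, y)))) has_sum norm (f x) * infsum (\<lambda>y. norm (g y)) B) B" for x
      using has_sum_cmult_right[OF has_sum_infsum[OF assms(4)], of "norm (f x)"] by simp
    show "(\<lambda>x. norm (f x) * infsum (\<lambda>y. norm (g y)) B) summable_on A"
      using assms(3) by (rule summable_on_cmult_left)
  qed auto
  then show "(\<lambda>(x, y). f x * g y) summable_on A \<times> B"
    by - (rule abs_summable_summable[where f = "\<lambda>(x, y). f x * g y"], simp add: case_prod_unfold norm_mult)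
qed

text \<open>The product of two Gaussians is, up to a factor independent of \<open>z\<close>, a Gaussian around the
  weighted mean of the centres. Writing the two summation indices as \<open>l + q - N p\<close> and \<open>q + p\<close>
  with \<open>0 \<le> l \<le> N\<close> makes this factor depend only on \<open>l\<close> and \<open>p\<close>.\<close>
lemma theta_mult:
  assumes N: "N \<ge> 1"
  obtains b where "\<And>z. theta 1 a \<eta> z * theta N v \<xi> z =
     (\<Sum>l\<le>N. b l * theta (N + 1) ((a + real N * v + real l) / (real N + 1)) (\<xi> + \<eta>) z)"
proof -
  define c where "c = (\<lambda>(l::nat) (p::int). unit_char (real l * \<eta> + of_int p * (\<xi> - real N * \<eta>)) *
    of_real (exp (- pi * real N / (real N + 1) * (a - v + real l - (real N + 1) * of_int p)\<^sup>2)))"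
  define V where "V = (\<lambda>l::nat. (a + real N * v + real l) / (real N + 1))"
  define b where "b = (\<lambda>l. \<Sum>\<^sub>\<infinity>p. c l p)"
  have key: "theta_term 1 a \<eta> (int l + q - int N * p) z * theta_term N v \<xi> (q + p) z =
      c l p * theta_term (N + 1) (V l) (\<xi> + \<eta>) q z" for l q p z
  proof -
    have chr: "unit_char (of_int (int l + q - int N * p) * \<eta>) * unit_char (of_int (q + p) * \<xi>) =
        unit_char (real l * \<eta> + of_int p * (\<xi> - real N * \<eta>)) * unit_char (of_int q * (\<xi> + \<eta>))"
      unfolding unit_char_add[symmetric] by (simp add: algebra_simps)
    define A B where "A = complex_of_real (a + of_int (int l + q - int N * p))"
      and "B = complex_of_real (v + of_int (q + p))"
    have "(of_nat (N + 1)) * (- of_real pi * of_nat 1 * (A - z)\<^sup>2 + - of_real pi * of_nat N * (B - z)\<^sup>2) =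
      (of_nat (N + 1)) * (- of_real pi * of_nat (N + 1) * ((A + of_nat N * B) / of_nat (N + 1) - z)\<^sup>2
        - of_real pi * of_nat N / of_nat (N + 1) * (A - B)\<^sup>2)"
    proof -
      define M where "M = (A + of_nat N * B) / of_nat (N + 1)"
      have nz: "of_nat (N + 1) \<noteq> (0::complex)" by (simp only: of_nat_eq_0_iff)
      have M: "of_nat (N + 1) * M = A + of_nat N * B"
        using nz by (simp add: M_def del: of_nat_add of_nat_Suc)
      have "(of_nat (N + 1)) * (- of_real pi * of_nat (N + 1) * (M - z)\<^sup>2
          - of_real pi * of_nat N / of_nat (N + 1) * (A - B)\<^sup>2)
        = - of_real pi * (of_nat (N + 1) * M - of_nat (N + 1) * z)\<^sup>2 - of_real pi * of_nat N * (A - B)\<^sup>2"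
        using nz by (simp add: field_simps power2_eq_square del: of_nat_add of_nat_Suc)
      then show ?thesis
        unfolding M_def[symmetric] M by (simp add: algebra_simps power2_eq_square)
    qed
    moreover have "of_nat (N + 1) \<noteq> (0::complex)" by (simp only: of_nat_eq_0_iff)
    ultimately have "- of_real pi * of_nat 1 * (A - z)\<^sup>2 + - of_real pi * of_nat N * (B - z)\<^sup>2 =
      - of_real pi * of_nat (N + 1) * ((A + of_nat N * B) / of_nat (N + 1) - z)\<^sup>2
        - of_real pi * of_nat N / of_nat (N + 1) * (A - B)\<^sup>2"
      by (metis mult_left_cancel)
    moreover have "(A + of_nat N * B) / of_nat (N + 1) = of_real (V l + of_int q)"
      by (simp add: A_def B_def V_def field_simps)
    moreover have "- of_real pi * of_nat N / of_nat (N + 1) * (A - B)\<^sup>2 = 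
        complex_of_real (- pi * real N / (real N + 1) * (a - v + real l - (real N + 1) * of_int p)\<^sup>2)"
      by (simp add: A_def B_def algebra_simps)
    ultimately have ex: "exp (- of_real pi * of_nat 1 * (A - z)\<^sup>2) * exp (- of_real pi * of_nat N * (B - z)\<^sup>2) =
      exp (- of_real pi * of_nat (N + 1) * (of_real (V l + of_int q) - z)\<^sup>2) *
        of_real (exp (- pi * real N / (real N + 1) * (a - v + real l - (real N + 1) * of_int p)\<^sup>2))"
      by (simp only: mult_exp_exp exp_of_real[symmetric]) simp
    have mix: "(w * x) * (y * u) = (w * y) * (x * u)" for w x y u :: complex
      by (simp add: mult_ac)
    show ?thesis
      unfolding theta_term_def c_def A_def[symmetric] B_def[symmetric]
      by (subst mix, unfold chr ex) (simp only: mult_ac)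
  qed
  have c_summable: "(\<lambda>p. norm (c l p)) summable_on UNIV" for l
  proof -
    \<comment> \<open>With this centre \<open>c l p\<close> has the modulus of the
      \<open>p\<close>-th term of a theta series of degree \<open>N * (N + 1)\<close> at 0, whose
      summability is known.\<close>
    define w where "w = - (a - v + real l) / (real N + 1)"
    have "norm (c l p) = norm (theta_term (N * (N + 1)) w 0 p 0)" for p
    proof -
      have "- pi * real N / (real N + 1) * (a - v + real l - (real N + 1) * of_int p)\<^sup>2 =
          - pi * real (N * (N + 1)) * (w + of_int p)\<^sup>2"
      proof -
        have eq: "a - v + real l - (real N + 1) * of_int p = - (real N + 1) * (w + of_int p)"
          by (simp add: w_def field_simps)
        show ?thesis unfolding eq by (simp add: power2_eq_square field_simps)
      qed
      moreover have "norm (theta_term (N * (N + 1)) w 0 p 0) = exp (- pi * real (N * (N + 1)) * (w + of_int p)\<^sup>2)"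
        by (simp add: theta_term_def norm_mult power2_eq_square)
      ultimately show ?thesis by (simp add: c_def norm_mult)
    qed
    then show ?thesis
      using theta_term_abs_summable[of "N * (N + 1)" w 0 0] N by simp
  qed
  have "theta 1 a \<eta> z * theta N v \<xi> z = (\<Sum>l\<le>N. b l * theta (N + 1) (V l) (\<xi> + \<eta>) z)" for z
  proof -
    define f where "f = (\<lambda>(m, k). theta_term 1 a \<eta> m z * theta_term N v \<xi> k z)"
    have "(f has_sum theta 1 a \<eta> z * theta N v \<xi> z) (UNIV \<times> UNIV)"
      unfolding f_def using N
      by (intro has_sum_product_abs theta_has_sum theta_term_abs_summable) auto
    also have "?this \<longleftrightarrow> ((\<lambda>(l, p, q). c l p * theta_term (N + 1) (V l) (\<xi> + \<eta>) q z) has_sum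
        theta 1 a \<eta> z * theta N v \<xi> z) ({..N} \<times> (UNIV \<times> UNIV))"
    \<comment> \<open>Since \<open>m - k = l - (N + 1) * p\<close>, the numbers \<open>l\<close> and
      \<open>- p\<close> are the remainder and the quotient of \<open>m - k\<close> on division by
      \<open>N + 1\<close>.\<close>
    proof (rule has_sum_reindex_bij_witness[of _ "\<lambda>(l, p, q). (int l + q - int N * p, q + p)"
       "\<lambda>(m, k). (nat ((m - k) mod (int N + 1)), - ((m - k) div (int N + 1)), k + ((m - k) div (int N + 1)))"])
      fix x :: "int \<times> int"
      obtain m k where x: "x = (m, k)" by force
      have "(m - k) mod (int N + 1) = (m - k) - (int N + 1) * ((m - k) div (int N + 1))"
        by (simp add: minus_mult_div_eq_mod)
      then show "(\<lambda>(l, p, q). (int l + q - int N * p, q + p)) ((\<lambda>(m, k). (nat ((m - k) mod (int N + 1)), - ((m - k) div (int N + 1)), k + ((m - k) div (int N + 1)))) x) = x"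
        by (simp add: x algebra_simps)
      have "(m - k) mod (int N + 1) < int N + 1"
        by (rule pos_mod_bound) simp
      then show "(\<lambda>(m, k). (nat ((m - k) mod (int N + 1)), - ((m - k) div (int N + 1)), k + ((m - k) div (int N + 1)))) x \<in> {..N} \<times> UNIV \<times> UNIV"
        by (simp add: x nat_le_iff)
    next
      fix y :: "nat \<times> int \<times> int"
      assume y: "y \<in> {..N} \<times> UNIV \<times> UNIV"
      then obtain l p q where y': "y = (l, p, q)" "l \<le> N" by auto
      have e: "int l + q - int N * p - (q + p) = int l + (- p) * (int N + 1)"
        by (simp add: algebra_simps)
      have "(int l + q - int N * p - (q + p)) mod (int N + 1) = int l"
        unfolding e mod_mult_self1 using y'(2) by (simp add: mod_pos_pos_trivial)
      moreover have "(int l + q - int N * p - (q + p)) div (int N + 1) = - p"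
        unfolding e using y'(2) by (subst div_mult_self1) auto
      ultimately show "(\<lambda>(m, k). (nat ((m - k) mod (int N + 1)), - ((m - k) div (int N + 1)), k + ((m - k) div (int N + 1)))) ((\<lambda>(l, p, q). (int l + q - int N * p, q + p)) y) = y"
        by (simp add: y')
    next
      fix x :: "int \<times> int"
      obtain m k where x: "x = (m, k)" by force
      define p where "p = - ((m - k) div (int N + 1))"
      have "(m - k) mod (int N + 1) = (m - k) + (int N + 1) * p"
        by (simp add: p_def minus_mult_div_eq_mod[symmetric])
      then have "m = int (nat ((m - k) mod (int N + 1))) + (k - p) - int N * p"
        by (simp add: algebra_simps)
      then show "(case (\<lambda>(m, k). (nat ((m - k) mod (int N + 1)), - ((m - k) div (int N + 1)), k + ((m - k) div (int N + 1)))) x of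
          (l, p, q) \<Rightarrow> c l p * theta_term (N + 1) (V l) (\<xi> + \<eta>) q z) = f x"
        using key[of "nat ((m - k) mod (int N + 1))" "k - p" p z] by (simp add: x f_def p_def)
    qed auto
    finally have S: "((\<lambda>(l, p, q). c l p * theta_term (N + 1) (V l) (\<xi> + \<eta>) q z) has_sum
        theta 1 a \<eta> z * theta N v \<xi> z) ({..N} \<times> (UNIV \<times> UNIV))" .
    have "((\<lambda>l. b l * theta (N + 1) (V l) (\<xi> + \<eta>) z) has_sum theta 1 a \<eta> z * theta N v \<xi> z) {..N}"
    proof (rule has_sum_SigmaD[OF S])
      fix l
      have "((\<lambda>(p, q). c l p * theta_term (N + 1) (V l) (\<xi> + \<eta>) q z) has_sum
              b l * theta (N + 1) (V l) (\<xi> + \<eta>) z) (UNIV \<times> UNIV)"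
        unfolding b_def
        by (intro has_sum_product_abs has_sum_infsum[OF abs_summable_summable[OF c_summable]] c_summable
             theta_has_sum theta_term_abs_summable) auto
      then show "((\<lambda>y. case (l, y) of (l, p, q) \<Rightarrow> c l p * theta_term (N + 1) (V l) (\<xi> + \<eta>) q z) has_sum
              b l * theta (N + 1) (V l) (\<xi> + \<eta>) z) (UNIV \<times> UNIV)"
        by simp
    qed
    then show ?thesis
      using has_sum_unique has_sum_finite by blast
  qed
  then show thesis
    unfolding V_def by (rule that)
qed

section \<open>The zeros of the odd theta function\<close>

text \<open>The pairing of \<open>m\<close> with \<open>- 1 - m\<close> exchanges the centres
  \<open>m + 1/2\<close> and \<open>- (m + 1/2)\<close> of \<open>theta1\<close>, so that each pair
  of its terms becomes a difference that is odd in \<open>z\<close>, times an even Gaussian.\<close>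

lemma has_sum_int_imp_sums_pairs:
  fixes f :: "int \<Rightarrow> complex"
  assumes "(f has_sum S) UNIV"
  shows "(\<lambda>m::nat. f (int m) + f (- 1 - int m)) sums S"
proof -
  have "(f has_sum S) UNIV \<longleftrightarrow>
     ((\<lambda>(m, b). f (if b then int m else - 1 - int m)) has_sum S) (UNIV \<times> (UNIV::bool set))"
    by (rule has_sum_reindex_bij_witness[of _ "\<lambda>(m, b). if b then int m else - 1 - int m"
         "\<lambda>k. (nat (if k \<ge> 0 then k else - 1 - k), k \<ge> 0)"])
       (auto split: if_splits)
  with assms have "((\<lambda>(m, b). f (if b then int m else - 1 - int m)) has_sum S) (UNIV \<times> (UNIV::bool set))"
    by simp
  then have "((\<lambda>m. f (int m) + f (- 1 - int m)) has_sum S) UNIV"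
  proof (rule has_sum_SigmaD)
    show "((\<lambda>b. case (m, b) of (m, b) \<Rightarrow> f (if b then int m else - 1 - int m)) has_sum
        f (int m) + f (- 1 - int m)) (UNIV::bool set)" for m
      by (rule has_sum_finiteI) (auto simp: UNIV_bool)
  qed
  then show ?thesis by (rule has_sum_imp_sums)
qed

text \<open>Jacobi's odd theta function with nome \<open>exp (- pi)\<close>, taken at an imaginary
  multiple of \<open>z\<close>, times \<open>exp (- pi * z^2)\<close> and a constant.\<close>

definition theta1 :: "complex \<Rightarrow> complex" where
  "theta1 = theta 1 (1/2) (1/2)"

lemma unit_char_half_int: "unit_char (of_int m * (1/2)) = (if even m then 1 else - 1)"
proof (cases "even m")
  case True
  then obtain k where "m = 2 * k" by blast
  then show ?thesis by simp
next
  case False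
  then obtain k where k: "m = 2 * k + 1" by (elim oddE)
  have "unit_char (1/2) = -1" by (simp add: unit_char_def)
  then show ?thesis using unit_char_add[of "of_int k" "1/2"] k by (simp add: add_divide_distrib)
qed

lemma theta1_pair:
  "theta_term 1 (1/2) (1/2) (int m) z + theta_term 1 (1/2) (1/2) (- 1 - int m) z =
    (-1) ^ m * exp (- of_real pi * z\<^sup>2) * of_real (exp (- pi * (real m + 1/2)\<^sup>2)) *
    (exp (of_real pi * z) ^ (2 * m + 1) - exp (- of_real pi * z) ^ (2 * m + 1))"
proof -
  have 1: "exp (- of_real pi * of_nat 1 * (of_real (1/2 + of_int (int m)) - z)\<^sup>2) =
     exp (- of_real pi * z\<^sup>2) * of_real (exp (- pi * (real m + 1/2)\<^sup>2)) * exp (of_real pi * z) ^ (2 * m + 1)"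
    unfolding exp_of_nat_mult[symmetric] exp_of_real[symmetric] mult_exp_exp
    by (rule arg_cong[of _ _ exp]) (simp add: power2_eq_square algebra_simps)
  have 2: "exp (- of_real pi * of_nat 1 * (of_real (1/2 + of_int (- 1 - int m)) - z)\<^sup>2) =
     exp (- of_real pi * z\<^sup>2) * of_real (exp (- pi * (real m + 1/2)\<^sup>2)) * exp (- of_real pi * z) ^ (2 * m + 1)"
    unfolding exp_of_nat_mult[symmetric] exp_of_real[symmetric] mult_exp_exp
    by (rule arg_cong[of _ _ exp]) (simp add: power2_eq_square algebra_simps)
  have "unit_char (of_int (int m) * (1/2)) = (-1) ^ m"
    unfolding unit_char_half_int by simp
  moreover have "unit_char (of_int (- 1 - int m) * (1/2)) = - ((-1) ^ m)"
    unfolding unit_char_half_int by simp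
  ultimately show ?thesis
    unfolding theta_term_def 1 2 by (simp add: algebra_simps)
qed

text \<open>An odd power difference is divisible by the difference of the bases, and each of the
  \<open>2 * m + 1\<close> terms of the cofactor has modulus at most \<open>exp (2 * m * c)\<close>.
  The factor \<open>exp w - exp (- w)\<close> must be kept: it carries the zeros of
  \<open>theta1\<close>.\<close>

lemma norm_exp_odd_power_diff_le:
  assumes "\<bar>Re w\<bar> \<le> c"
  shows "norm (exp w ^ (2 * m + 1) - exp (- w) ^ (2 * m + 1)) \<le>
     norm (exp w - exp (- w)) * ((2 * real m + 1) * exp (2 * real m * c))"
proof -
  have 1: "exp w ^ (2 * m + 1) - exp (- w) ^ (2 * m + 1) =
      (exp w - exp (- w)) * (\<Sum>i<Suc (2 * m). exp w ^ i * exp (- w) ^ (2 * m - i))"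
    using power_diff_sumr2[of "exp w" "Suc (2 * m)" "exp (- w)"] by (simp add: mult.commute)
  have "norm (\<Sum>i<Suc (2 * m). exp w ^ i * exp (- w) ^ (2 * m - i)) \<le>
      (\<Sum>i<Suc (2 * m). exp (2 * real m * c))"
  proof (rule sum_norm_le)
    fix i assume i: "i \<in> {..<Suc (2 * m)}"
    have "norm (exp w ^ i * exp (- w) ^ (2 * m - i)) = exp (real i * Re w + real (2 * m - i) * - Re w)"
      by (simp only: norm_mult norm_power norm_exp_eq_Re uminus_complex.sel exp_add exp_of_nat_mult)
    also have "real i * Re w + real (2 * m - i) * - Re w \<le> real i * c + real (2 * m - i) * c"
      using assms by (intro add_mono mult_left_mono) auto
    also have "\<dots> = 2 * real m * c"
      using i by (simp add: of_nat_diff algebra_simps)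
    finally show "norm (exp w ^ i * exp (- w) ^ (2 * m - i)) \<le> exp (2 * real m * c)"
      by simp
  qed
  then have "norm (\<Sum>i<Suc (2 * m). exp w ^ i * exp (- w) ^ (2 * m - i)) \<le> (2 * real m + 1) * exp (2 * real m * c)"
    by (simp only: sum_constant card_lessThan) (simp add: algebra_simps)
  then show ?thesis
    unfolding 1 norm_mult by (intro mult_left_mono) auto
qed

lemma exp_minus_pi_le: "exp (- pi) \<le> 1/8"
proof -
  have "(2::real) ^ 3 \<le> exp 1 ^ 3"
    using exp_ge_add_one_self[of 1] by (intro power_mono) auto
  also have "\<dots> = exp 3" by (simp add: exp_of_nat_mult[symmetric])
  also have "\<dots> \<le> exp pi" using pi_gt3 by simp
  finally show ?thesis by (simp add: exp_minus field_simps)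
qed

text \<open>In the strip the first pair of terms of the series dominates all others.\<close>
lemma norm_theta1_ge:
  assumes "\<bar>Re z\<bar> \<le> 1/2"
  shows "norm (theta1 z) \<ge> 2/5 * (norm (exp (- of_real pi * z\<^sup>2)) * exp (- pi / 4) *
    norm (exp (of_real pi * z) - exp (- of_real pi * z)))"
proof -
  define t where "t = (\<lambda>m::nat. theta_term 1 (1/2) (1/2) (int m) z + theta_term 1 (1/2) (1/2) (- 1 - int m) z)"
  have sums: "t sums theta1 z"
    unfolding t_def theta1_def by (rule has_sum_int_imp_sums_pairs[OF theta_has_sum]) simp
  have t0: "norm (t 0) = norm (exp (- of_real pi * z\<^sup>2)) * exp (- pi / 4) *
    norm (exp (of_real pi * z) - exp (- of_real pi * z))"
    unfolding t_def theta1_pair by (simp add: norm_mult power2_eq_square)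
  have tm: "norm (t m) \<le> norm (t 0) * (3/8) ^ m" for m
  proof -
    have "norm (t m) = norm (exp (- of_real pi * z\<^sup>2)) * exp (- pi * (real m + 1/2)\<^sup>2) *
       norm (exp (of_real pi * z) ^ (2 * m + 1) - exp (- (of_real pi * z)) ^ (2 * m + 1))"
      unfolding t_def theta1_pair by (simp add: norm_mult norm_power)
    also have "\<dots> \<le> norm (exp (- of_real pi * z\<^sup>2)) * exp (- pi * (real m + 1/2)\<^sup>2) *
       (norm (exp (of_real pi * z) - exp (- (of_real pi * z))) * ((2 * real m + 1) * exp (2 * real m * (pi / 2))))"
      using assms by (intro mult_left_mono norm_exp_odd_power_diff_le) (auto simp: abs_mult)
    also have "\<dots> = norm (t 0) * ((2 * real m + 1) * (exp (pi / 4) * exp (- pi * (real m + 1/2)\<^sup>2) * exp (2 * real m * (pi / 2))))"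
      unfolding t0 by (simp add: exp_minus field_simps)
    also have "exp (pi / 4) * exp (- pi * (real m + 1/2)\<^sup>2) * exp (2 * real m * (pi / 2)) = exp (- pi * real m * real m)"
      unfolding mult_exp_exp by (simp add: power2_eq_square algebra_simps)
    also have "(2 * real m + 1) * exp (- pi * real m * real m) \<le> 3 ^ m * (1/8) ^ m"
    proof (rule mult_mono)
      show "2 * real m + 1 \<le> 3 ^ m"
        using Bernoulli_inequality[of "2::real" m] by (simp add: mult.commute)
      have "- pi * real m * real m \<le> - pi * real m"
        by (cases m) (auto simp: algebra_simps)
      then have "exp (- pi * real m * real m) \<le> exp (- pi * real m)"
        by simp
      also have "\<dots> = exp (- pi) ^ m"
        by (simp add: exp_of_nat_mult[symmetric] mult.commute)
      also have "\<dots> \<le> (1/8) ^ m"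
        using exp_minus_pi_le by (intro power_mono) auto
      finally show "exp (- pi * real m * real m) \<le> (1/8) ^ m" .
    qed auto
    finally show ?thesis
      by (simp add: mult_left_mono power_mult_distrib[symmetric])
  qed
  have "(\<lambda>m. t (Suc m)) sums (theta1 z - t 0)"
    using sums_Suc_iff[of t "theta1 z - t 0"] sums by simp
  \<comment> \<open>The ratio \<open>3/8\<close> is \<open>3 * exp (- pi)\<close> rounded up. The
    later pairs sum to at most \<open>(3/8) / (1 - 3/8) = 3/5\<close> of the first one, which leaves
    the constant \<open>2/5\<close>.\<close>
  moreover have geo: "(\<lambda>m. norm (t 0) * (3/8) ^ Suc m) sums (norm (t 0) * (3/5))"
    using sums_mult[OF geometric_sums[of "3/8::real"], of "norm (t 0) * (3/8)"] by (simp add: mult_ac)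
  ultimately have "norm (theta1 z - t 0) \<le> norm (t 0) * (3/5)"
    using norm_suminf_le[of "\<lambda>m. t (Suc m)" "\<lambda>m. norm (t 0) * (3/8) ^ Suc m"] tm
    by (simp add: sums_iff del: power_Suc)
  moreover have "norm (t 0) \<le> norm (theta1 z) + norm (theta1 z - t 0)"
    by (metis norm_minus_commute norm_triangle_sub)
  ultimately show ?thesis
    unfolding t0[symmetric] by simp
qed

lemma theta1_0 [simp]: "theta1 0 = 0"
proof -
  have "(\<lambda>m::nat. theta_term 1 (1/2) (1/2) (int m) 0 + theta_term 1 (1/2) (1/2) (- 1 - int m) 0) sums theta1 0"
    unfolding theta1_def by (rule has_sum_int_imp_sums_pairs[OF theta_has_sum]) simp
  then show ?thesis
    unfolding theta1_pair by (simp add: sums_iff)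
qed

text \<open>An integer translation moves \<open>z\<close> into the strip of
  \<open>norm_theta1_ge\<close>. There a zero of \<open>theta1\<close> is a zero of its first pair,
  that is, \<open>exp (2 * pi * w) = 1\<close>.\<close>

lemma theta1_eq_0_imp:
  assumes "theta1 z = 0"
  shows "Re z \<in> \<int> \<and> Im z \<in> \<int>"
proof -
  define k where "k = round (Re z)"
  define w where "w = z - of_int k"
  have z: "z = w + of_int k" by (simp add: w_def)
  have "theta1 w = 0"
    using assms unfolding z theta1_def theta_add_of_int by simp
  moreover have "\<bar>Re w\<bar> \<le> 1/2"
    using of_int_round_abs_le[of "Re z"] by (simp add: w_def k_def abs_minus_commute)
  ultimately have "exp (of_real pi * w) - exp (- of_real pi * w) = 0"
    using norm_theta1_ge[of w] by (simp add: mult_le_0_iff)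
  then have "exp (2 * of_real pi * w) = 1"
    using mult_exp_exp[of "of_real pi * w" "of_real pi * w"] mult_exp_exp[of "of_real pi * w" "- of_real pi * w"]
    by (simp add: mult_ac)
  then obtain n where n: "Re (2 * of_real pi * w) = 0" "Im (2 * of_real pi * w) = of_int (2 * n) * pi"
    by (auto simp: exp_eq_1)
  then have "Re w = 0" "Im w = of_int n" by auto
  then show ?thesis unfolding z by simp
qed

lemma theta1_eq_0_in_unit_ball:
  assumes "theta1 z = 0" "norm z < 1"
  shows "z = 0"
proof -
  have "\<bar>Re z\<bar> < 1" "\<bar>Im z\<bar> < 1"
    using assms(2) abs_Re_le_cmod[of z] abs_Im_le_cmod[of z] by linarith+
  with theta1_eq_0_imp[OF assms(1)] have "Re z = 0" "Im z = 0"
    by (auto elim!: Ints_cases)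
  then show ?thesis by (simp add: complex_eq_iff)
qed

text \<open>Completing the square turns the frequency \<open>\<zeta>\<close> into an imaginary
  translation. Up to a factor without zeros every degree-one theta is thus a translate of
  \<open>theta1\<close>, and it vanishes only on the Gaussian integers translated by
  \<open>\<alpha> - \<i> * \<zeta>\<close>.\<close>

lemma theta_shift_eq_theta1:
  "theta 1 (1/2 + \<alpha>) (1/2 + \<zeta>) z =
     exp (- (2 * of_real pi * \<i> * of_real \<zeta> * (of_real (1/2 + \<alpha>) - z) + of_real (pi * \<zeta>\<^sup>2))) *
     theta1 (z - of_real \<alpha> + \<i> * of_real \<zeta>)"
proof -
  have "theta_term 1 (1/2 + \<alpha>) (1/2 + \<zeta>) m z =
     exp (- (2 * of_real pi * \<i> * of_real \<zeta> * (of_real (1/2 + \<alpha>) - z) + of_real (pi * \<zeta>\<^sup>2))) *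
     theta_term 1 (1/2) (1/2) m (z - of_real \<alpha> + \<i> * of_real \<zeta>)" for m
    unfolding theta_term_def unit_char_exp mult_exp_exp
    by (rule arg_cong[of _ _ exp]) (simp add: power2_eq_square algebra_simps)
  then show ?thesis
    by (simp only: theta_def theta1_def infsum_cmult_right')
qed

lemma theta_0_nonzero:
  assumes "\<alpha> \<notin> \<int> \<or> \<zeta> \<notin> \<int>"
  shows "theta 1 (1/2 + \<alpha>) (1/2 + \<zeta>) 0 \<noteq> 0"
  using theta1_eq_0_imp[of "- of_real \<alpha> + \<i> * of_real \<zeta>"] assms
  by (auto simp: theta_shift_eq_theta1 simp del: One_nat_def)

section \<open>The sigma function of the Gaussian integers\<close>

text \<open>Up to a constant factor this is the Weierstrass sigma function of the lattice of Gaussian integers.\<close>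
definition gauss_sigma :: "complex \<Rightarrow> complex" where
  "gauss_sigma z = exp (of_real pi / 2 * z\<^sup>2) * theta1 z"

text \<open>The quotient of \<open>gauss_sigma z\<close> by \<open>z\<close> with its removable
  singularity filled in. The unsimplified difference quotient is the shape in which
  \<open>pole_lemma_open\<close> states holomorphy.\<close>

definition sigma_quot :: "complex \<Rightarrow> complex" where
  "sigma_quot z = (if z = 0 then deriv gauss_sigma 0 else (gauss_sigma z - gauss_sigma 0) / (z - 0))"

lemma theta1_holomorphic [holomorphic_intros]:
  "f holomorphic_on A \<Longrightarrow> (\<lambda>z. theta1 (f z)) holomorphic_on A"
  unfolding theta1_def by (intro holomorphic_intros) auto

lemma sigma_holomorphic [holomorphic_intros]:
  "f holomorphic_on A \<Longrightarrow> (\<lambda>z. gauss_sigma (f z)) holomorphic_on A"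
  unfolding gauss_sigma_def by (intro holomorphic_intros)

lemma sigma_0 [simp]: "gauss_sigma 0 = 0"
  by (simp add: gauss_sigma_def)

lemma sigma_eq: "gauss_sigma z = z * sigma_quot z"
  by (simp add: sigma_quot_def)

lemma sigma_quot_holomorphic_UNIV: "sigma_quot holomorphic_on UNIV"
  unfolding sigma_quot_def[abs_def]
  by (rule pole_lemma_open) (auto intro!: holomorphic_intros)

lemma sigma_quot_holomorphic [holomorphic_intros]:
  "f holomorphic_on A \<Longrightarrow> (\<lambda>z. sigma_quot (f z)) holomorphic_on A"
  using holomorphic_on_compose[of f A sigma_quot] sigma_quot_holomorphic_UNIV
  by (auto simp: o_def intro: holomorphic_on_subset)

text \<open>The shift by 2 keeps the whole sequence in \<open>(0, 1/2]\<close>, inside the unit disc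
  and inside the strip where \<open>norm_theta1_ge\<close> applies.\<close>

lemma inverse_shift_tendsto_0: "(\<lambda>n. complex_of_real (1 / real (n + 2))) \<longlonglongrightarrow> 0"
proof -
  have "(\<lambda>n. 1 / real (n + 2)) \<longlonglongrightarrow> 0"
    using LIMSEQ_ignore_initial_segment[OF lim_1_over_n[where 'a = real], of 2] by simp
  from tendsto_of_real[OF this, where 'a = complex] show ?thesis by simp
qed

text \<open>The zero of sigma at 0 is simple: for small real \<open>x > 0\<close> the lower bound of
  \<open>norm_theta1_ge\<close> is linear in \<open>x\<close>, because
  \<open>exp (pi * x) - exp (- pi * x) \<ge> pi * x\<close>, and this survives division by
  \<open>x\<close> and the limit.\<close>

lemma sigma_quot_0_nonzero: "sigma_quot 0 \<noteq> 0"
proof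
  assume z: "sigma_quot 0 = 0"
  have cont: "isCont sigma_quot 0"
    using holomorphic_on_imp_continuous_on[OF sigma_quot_holomorphic_UNIV]
    by (simp add: continuous_on_eq_continuous_at)
  have lim: "(\<lambda>n. norm (sigma_quot (of_real (1 / real (n + 2))))) \<longlonglongrightarrow> norm (sigma_quot 0)"
    by (rule tendsto_norm[OF isCont_tendsto_compose[OF cont inverse_shift_tendsto_0]])
  have "2/5 * (exp (- pi / 2) * pi) \<le> norm (sigma_quot (of_real (1 / real (n + 2))))" for n
  proof -
    define x where "x = 1 / real (n + 2)"
    have x: "0 < x" "x \<le> 1/2" by (auto simp: x_def field_simps)
    have "pi * x \<le> exp (pi * x) - exp (- pi * x)"
    proof -
      have "exp (- pi * x) \<le> 1" using x by simp
      then show ?thesis using exp_ge_add_one_self[of "pi * x"] by linarith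
    qed
    also have "\<dots> \<le> norm (exp (of_real pi * of_real x :: complex) - exp (- of_real pi * of_real x))"
      using abs_Re_le_cmod[of "exp (of_real pi * of_real x :: complex) - exp (- of_real pi * of_real x)"]
      by (simp add: Re_exp)
    finally have 1: "pi * x \<le> norm (exp (of_real pi * of_real x :: complex) - exp (- of_real pi * of_real x))" .
    have "norm (exp (- of_real pi * (of_real x :: complex)\<^sup>2)) * exp (- pi / 4) = exp (- pi * x\<^sup>2 - pi / 4)"
      by (simp add: power2_eq_square mult_exp_exp)
    moreover have "exp (- pi / 2) \<le> exp (- pi * x\<^sup>2 - pi / 4)"
    proof -
      have "x\<^sup>2 \<le> (1/2)\<^sup>2" using x by (intro power_mono) auto
      then have "pi * x\<^sup>2 \<le> pi * (1/4)" by (intro mult_left_mono) (auto simp: power2_eq_square)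
      then have "- pi / 2 \<le> - pi * x\<^sup>2 - pi / 4" by linarith
      then show ?thesis by (simp only: exp_le_cancel_iff)
    qed
    ultimately have 2: "exp (- pi / 2) \<le> norm (exp (- of_real pi * (of_real x :: complex)\<^sup>2)) * exp (- pi / 4)"
      by simp
    have "2/5 * (exp (- pi / 2) * (pi * x)) \<le> 2/5 * (norm (exp (- of_real pi * (of_real x :: complex)\<^sup>2)) * exp (- pi / 4) *
       norm (exp (of_real pi * of_real x :: complex) - exp (- of_real pi * of_real x)))"
      using 1 2 x by (intro mult_left_mono mult_mono) auto
    also have "\<dots> \<le> norm (theta1 (of_real x))"
      using x by (intro norm_theta1_ge) auto
    also have "\<dots> = 1 * norm (theta1 (of_real x))" by simp
    also have "\<dots> \<le> norm (gauss_sigma (of_real x))"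
      unfolding gauss_sigma_def norm_mult by (intro mult_right_mono) (auto simp: power2_eq_square)
    also have "\<dots> = x * norm (sigma_quot (of_real x))"
      using x by (simp add: sigma_eq norm_mult)
    finally have "x * (2/5 * (exp (- pi / 2) * pi)) \<le> x * norm (sigma_quot (of_real x))"
      by (simp add: mult_ac)
    then show ?thesis using x unfolding x_def[symmetric] by (simp only: mult_le_cancel_left_pos)
  qed
  then have "2/5 * (exp (- pi / 2) * pi) \<le> norm (sigma_quot 0)"
    by (intro LIMSEQ_le_const[OF lim]) auto
  moreover have "0 < 2/5 * (exp (- pi / 2) * pi)" by simp
  ultimately have "0 < norm (sigma_quot 0)" by linarith
  then show False using z by simp
qed

lemma sigma_quot_nonzero:
  assumes "norm z < 1"
  shows "sigma_quot z \<noteq> 0"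
proof (cases "z = 0")
  case False
  then have "theta1 z \<noteq> 0" using theta1_eq_0_in_unit_ball assms by blast
  then have "gauss_sigma z \<noteq> 0" by (simp add: gauss_sigma_def)
  then show ?thesis unfolding sigma_eq by simp
qed (use sigma_quot_0_nonzero in simp)

lemma theta1_add_1: "theta1 (z + 1) = - theta1 z"
  using unit_char_half_int[of 1] by (simp add: theta1_def theta_add_1)

lemma theta1_add_ii: "theta1 (z + \<i>) = - exp (of_real pi - 2 * of_real pi * \<i> * z) * theta1 z"
  using unit_char_half_int[of 1] theta_add_ii[of 1 "1/2" "1/2" z] by (simp add: theta1_def)

text \<open>The factor \<open>exp (pi / 2 * z^2)\<close> shares the quasi-periodicity of
  \<open>theta1\<close> evenly between the two periods: the multiplier for \<open>\<i>\<close> at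
  \<open>\<i> * z\<close> is the multiplier for 1 at \<open>z\<close>. The rotational symmetry of
  sigma rests on this.\<close>

lemma sigma_add_1: "gauss_sigma (z + 1) = - exp (of_real pi * z + of_real pi / 2) * gauss_sigma z"
proof -
  have "of_real pi / 2 * (z + 1)\<^sup>2 = (of_real pi * z + of_real pi / 2) + of_real pi / 2 * z\<^sup>2"
    by (simp add: power2_eq_square field_simps)
  then have "exp (of_real pi / 2 * (z + 1)\<^sup>2) = exp (of_real pi * z + of_real pi / 2) * exp (of_real pi / 2 * z\<^sup>2)"
    by (simp only: exp_add)
  then show ?thesis unfolding gauss_sigma_def theta1_add_1 by simp
qed

lemma sigma_add_ii: "gauss_sigma (z + \<i>) = - exp (of_real pi / 2 - of_real pi * \<i> * z) * gauss_sigma z"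
proof -
  have "of_real pi / 2 * (z + \<i>)\<^sup>2 + (of_real pi - 2 * of_real pi * \<i> * z) =
      (of_real pi / 2 - of_real pi * \<i> * z) + of_real pi / 2 * z\<^sup>2"
    by (simp add: power2_eq_square field_simps)
  then have "exp (of_real pi / 2 * (z + \<i>)\<^sup>2) * exp (of_real pi - 2 * of_real pi * \<i> * z) =
      exp (of_real pi / 2 - of_real pi * \<i> * z) * exp (of_real pi / 2 * z\<^sup>2)"
    by (simp only: mult_exp_exp)
  then show ?thesis unfolding gauss_sigma_def theta1_add_ii by simp
qed

section \<open>Rotation by \<open>\<i>\<close> and the Taylor expansion of sigma\<close>

lemma norm_less_1_of_unit_square:
  assumes "\<bar>Re z\<bar> \<le> 1/2" "\<bar>Im z\<bar> \<le> 1/2"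
  shows "norm z < 1"
proof -
  have "(Re z)\<^sup>2 \<le> (1/2)\<^sup>2" "(Im z)\<^sup>2 \<le> (1/2)\<^sup>2"
    using assms by (auto simp: power2_le_iff_abs_le simp del: power_divide)
  then have "(norm z)\<^sup>2 \<le> 1/2" unfolding cmod_power2 by (simp add: power2_eq_square)
  then show ?thesis by (intro power2_less_imp_less[of "norm z" 1]) auto
qed

lemma periodic_of_int:
  fixes f :: "complex \<Rightarrow> 'a"
  assumes "\<And>z. f (z + p) = f z"
  shows "f (z + of_int k * p) = f z"
proof (induction k arbitrary: z rule: int_induct[where k = 0])
  case (step1 i)
  then show ?case using assms[of "z + of_int i * p"] by (simp add: algebra_simps)
next
  case (step2 i)
  then show ?case using assms[of "z + of_int (i - 1) * p"] by (simp add: algebra_simps)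
qed simp

text \<open>The quotient of \<open>gauss_sigma (\<i> z)\<close> and \<open>gauss_sigma z\<close> is doubly periodic, hence attains its maximum
  modulus in the interior of the unit disc.\<close>
lemma sigma_quot_mult_ii:
  assumes "norm z < 1"
  shows "sigma_quot (\<i> * z) = sigma_quot z"
proof -
  define K where "K = (\<lambda>z. gauss_sigma (\<i> * z) / gauss_sigma z)"
  \<comment> \<open>\<open>k\<close> is \<open>K\<close> with the common zero at the origin
    cancelled; \<open>K 0 = 0\<close> holds only by the convention for division by 0.\<close>
  define k where "k = (\<lambda>z. \<i> * sigma_quot (\<i> * z) / sigma_quot z)"
  have Kk: "K z = k z" if "z \<noteq> 0" for z
    using that by (simp add: K_def k_def sigma_eq)
  have K1: "K (z + 1) = K z" for z
  proof -
    have "gauss_sigma (\<i> * (z + 1)) = gauss_sigma (\<i> * z + \<i>)" by (simp add: algebra_simps)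
    also have "\<dots> = - exp (of_real pi / 2 - of_real pi * \<i> * (\<i> * z)) * gauss_sigma (\<i> * z)"
      by (rule sigma_add_ii)
    also have "of_real pi / 2 - of_real pi * \<i> * (\<i> * z) = of_real pi * z + of_real pi / 2"
      by (simp add: algebra_simps)
    finally show ?thesis unfolding K_def sigma_add_1 by simp
  qed
  have Ki: "K (z + \<i>) = K z" for z
  proof -
    have "gauss_sigma (\<i> * z) = gauss_sigma (\<i> * (z + \<i>) + 1)" by (simp add: algebra_simps)
    also have "\<dots> = - exp (of_real pi * (\<i> * (z + \<i>)) + of_real pi / 2) * gauss_sigma (\<i> * (z + \<i>))"
      unfolding sigma_add_1 by simp
    also have "of_real pi * (\<i> * (z + \<i>)) + of_real pi / 2 = - (of_real pi / 2 - of_real pi * \<i> * z)"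
      by (simp add: algebra_simps)
    finally have "gauss_sigma (\<i> * (z + \<i>)) = - exp (of_real pi / 2 - of_real pi * \<i> * z) * gauss_sigma (\<i> * z)"
      using mult_exp_exp[of "of_real pi / 2 - of_real pi * \<i> * z" "- (of_real pi / 2 - of_real pi * \<i> * z)"]
      by simp
    then show ?thesis unfolding K_def sigma_add_ii by simp
  qed
  define Sq where "Sq = cbox (Complex (-1/2) (-1/2)) (Complex (1/2) (1/2))"
  have Sq: "z \<in> Sq \<longleftrightarrow> \<bar>Re z\<bar> \<le> 1/2 \<and> \<bar>Im z\<bar> \<le> 1/2" for z
    by (auto simp: Sq_def in_cbox_complex_iff abs_le_iff)
  have Sq_ball: "Sq \<subseteq> ball 0 1"
    using norm_less_1_of_unit_square by (auto simp: Sq)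
  have khol: "k holomorphic_on ball 0 1"
    unfolding k_def by (intro holomorphic_intros) (auto simp: sigma_quot_nonzero)
  have "continuous_on Sq (\<lambda>z. norm (k z))"
    by (intro continuous_on_norm continuous_on_subset[OF holomorphic_on_imp_continuous_on[OF khol] Sq_ball])
  moreover have "compact Sq" "Sq \<noteq> {}" using Sq[of 0] by (auto simp: Sq_def)
  ultimately obtain x where x: "x \<in> Sq" "\<And>z. z \<in> Sq \<Longrightarrow> norm (k z) \<le> norm (k x)"
    using continuous_attains_sup by metis
  have "norm (k z) \<le> norm (k x)" if z: "z \<in> ball 0 1" for z
  proof (cases "z = 0")
    case True
    then show ?thesis using x(2)[of 0] by (simp add: Sq)
  next
    case False
    define w where "w = z + of_int (- round (Re z)) * 1 + of_int (- round (Im z)) * \<i>"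
    have "K w = K z"
      unfolding w_def periodic_of_int[of K, OF Ki] periodic_of_int[of K, OF K1] ..
    moreover have "w \<in> Sq"
      using of_int_round_abs_le[of "Re z"] of_int_round_abs_le[of "Im z"]
      by (simp add: Sq w_def abs_minus_commute)
    \<comment> \<open>This case matters because \<open>K\<close> and \<open>k\<close> differ at 0.
      If \<open>w\<close> were 0, then \<open>z\<close> would be a nonzero Gaussian integer in the
      open unit disc.\<close>
    moreover have "w \<noteq> 0"
    proof
      assume "w = 0"
      then have "Re z = of_int (round (Re z))" "Im z = of_int (round (Im z))"
        by (auto simp: w_def complex_eq_iff)
      then have "Re z \<in> \<int>" "Im z \<in> \<int>"
        by (metis Ints_of_int)+
      moreover have "\<bar>Re z\<bar> < 1" "\<bar>Im z\<bar> < 1"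
        using z abs_Re_le_cmod[of z] abs_Im_le_cmod[of z] by auto
      ultimately have "Re z = 0" "Im z = 0" by (auto elim!: Ints_cases)
      then show False using False by (simp add: complex_eq_iff)
    qed
    ultimately show ?thesis using Kk False x(2) by metis
  qed
  then have "k constant_on ball 0 1"
    using x(1) Sq_ball khol by (intro maximum_modulus_principle[of k _ "ball 0 1" x]) auto
  \<comment> \<open>The value \<open>k 0 = \<i>\<close> identifies the constant.\<close>
  then have "k z = k 0"
    using assms by (auto simp: constant_on_def)
  then show ?thesis
    using sigma_quot_nonzero[of 0] sigma_quot_nonzero[OF assms] by (simp add: k_def field_simps)
qed

text \<open>Dividing out a zero at the origin divides the eigenvalue under rotation by
  \<open>\<i>\<close>: \<open>c\<close> becomes \<open>c / \<i>\<close>. At 0 itself the relation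
  follows by continuity.\<close>

lemma factor_z_on_unit_disc:
  assumes "f holomorphic_on ball 0 1" "f 0 = 0" "\<And>z. norm z < 1 \<Longrightarrow> f (\<i> * z) = c * f z"
  obtains g where "g holomorphic_on ball 0 1" "\<And>z. norm z < 1 \<Longrightarrow> f z = z * g z"
    "\<And>z. norm z < 1 \<Longrightarrow> g (\<i> * z) = - \<i> * c * g z"
proof -
  define g where "g = (\<lambda>z. if z = 0 then deriv f 0 else (f z - f 0) / (z - 0))"
  have hol: "g holomorphic_on ball 0 1"
    unfolding g_def by (rule pole_lemma_open) (use assms in auto)
  have fg: "f z = z * g z" for z by (simp add: g_def assms(2))
  have eq: "g (\<i> * z) = - \<i> * c * g z" if "norm z < 1" "z \<noteq> 0" for z
  proof -
    have "\<i> * g (\<i> * z) = c * g z"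
      using assms(3)[OF that(1)] that unfolding fg by (simp add: field_simps)
    then have "- \<i> * (\<i> * g (\<i> * z)) = - \<i> * (c * g z)" by (simp only:)
    then show ?thesis by (simp add: mult.assoc[symmetric])
  qed
  have "g (\<i> * 0) = - \<i> * c * g 0"
  proof -
    have lim: "(\<lambda>n. u * complex_of_real (1 / real (n + 2))) \<longlonglongrightarrow> 0" for u :: complex
      using tendsto_mult[OF tendsto_const inverse_shift_tendsto_0, of u] by simp
    have cont: "isCont g 0"
      using holomorphic_on_imp_continuous_on[OF hol] by (simp add: continuous_on_eq_continuous_at)
    have "(\<lambda>n. g (\<i> * complex_of_real (1 / real (n + 2)))) \<longlonglongrightarrow> g 0"
      by (rule isCont_tendsto_compose[OF cont lim])
    moreover have "(\<lambda>n. - \<i> * c * g (1 * complex_of_real (1 / real (n + 2)))) \<longlonglongrightarrow> - \<i> * c * g 0"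
      by (rule tendsto_mult[OF tendsto_const isCont_tendsto_compose[OF cont lim]])
    moreover have "g (\<i> * complex_of_real (1 / real (n + 2))) = - \<i> * c * g (1 * complex_of_real (1 / real (n + 2)))" for n
    proof -
      have "norm (complex_of_real (1 / real (n + 2))) < 1" unfolding norm_of_real by simp
      moreover have "complex_of_real (1 / real (n + 2)) \<noteq> 0" by (simp only: of_real_eq_0_iff) simp
      ultimately show ?thesis unfolding mult_1_left by (rule eq)
    qed
    ultimately show ?thesis using LIMSEQ_unique by simp
  qed
  with eq have "g (\<i> * z) = - \<i> * c * g z" if "norm z < 1" for z
    using that by (cases "z = 0") auto
  then show thesis using that hol fg by blast
qed

text \<open>The successive eigenvalues of \<open>f0\<close> to \<open>f3\<close> are
  \<open>1\<close>, \<open>- \<i>\<close>, \<open>-1\<close> and \<open>\<i>\<close>. The first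
  function vanishes at 0 by construction, the others because their eigenvalue is not 1, so four
  factors \<open>z\<close> can be extracted.\<close>

lemma sigma_quot_expansion:
  obtains t where "t holomorphic_on ball 0 1"
    "\<And>z. norm z < 1 \<Longrightarrow> sigma_quot z = sigma_quot 0 + z ^ 4 * t z"
proof -
  define f0 where "f0 = (\<lambda>z. sigma_quot z - sigma_quot 0)"
  have hol0: "f0 holomorphic_on ball 0 1" unfolding f0_def by (intro holomorphic_intros)
  have zero: "f 0 = 0" if "\<And>z. norm z < 1 \<Longrightarrow> f (\<i> * z) = c * f z" "c \<noteq> 1" for f :: "complex \<Rightarrow> complex" and c
    using that(1)[of 0] that(2) by (simp add: mult_cancel_right1)
  obtain f1 where f1: "f1 holomorphic_on ball 0 1" "\<And>z. norm z < 1 \<Longrightarrow> f0 z = z * f1 z"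
    "\<And>z. norm z < 1 \<Longrightarrow> f1 (\<i> * z) = - \<i> * 1 * f1 z"
    by (rule factor_z_on_unit_disc[OF hol0, of 1]) (auto simp: f0_def sigma_quot_mult_ii)
  obtain f2 where f2: "f2 holomorphic_on ball 0 1" "\<And>z. norm z < 1 \<Longrightarrow> f1 z = z * f2 z"
    "\<And>z. norm z < 1 \<Longrightarrow> f2 (\<i> * z) = - \<i> * (- \<i> * 1) * f2 z"
    by (rule factor_z_on_unit_disc[OF f1(1) zero[of f1, OF f1(3)] f1(3)]) (auto simp: complex_eq_iff)
  obtain f3 where f3: "f3 holomorphic_on ball 0 1" "\<And>z. norm z < 1 \<Longrightarrow> f2 z = z * f3 z"
    "\<And>z. norm z < 1 \<Longrightarrow> f3 (\<i> * z) = - \<i> * (- \<i> * (- \<i> * 1)) * f3 z"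
    by (rule factor_z_on_unit_disc[OF f2(1) zero[of f2, OF f2(3)] f2(3)]) (auto simp: complex_eq_iff)
  obtain f4 where f4: "f4 holomorphic_on ball 0 1" "\<And>z. norm z < 1 \<Longrightarrow> f3 z = z * f4 z"
    by (rule factor_z_on_unit_disc[OF f3(1) zero[of f3, OF f3(3)] f3(3)]) (auto simp: complex_eq_iff)
  have "sigma_quot z = sigma_quot 0 + z ^ 4 * f4 z" if "norm z < 1" for z
    using f1(2)[OF that] f2(2)[OF that] f3(2)[OF that] f4(2)[OF that]
    by (simp add: f0_def numeral_eq_Suc algebra_simps)
  then show thesis using that f4(1) by blast
qed

text \<open>Differentiation acts on the polynomial cofactor by
  \<open>p \<mapsto> (y - c * z) * p + p'\<close>. Iterating this operator on polynomials reduces a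
  fixed derivative at 0 to simplification.\<close>

lemma higher_deriv_exp_quadratic:
  fixes y c :: complex
  shows "(deriv ^^ k) (\<lambda>z. exp (y * z - c / 2 * z\<^sup>2)) =
    (\<lambda>z. poly (((\<lambda>p. [:y, - c:] * p + pderiv p) ^^ k) 1) z * exp (y * z - c / 2 * z\<^sup>2))"
proof (induction k)
  case (Suc k)
  define p where "p = ((\<lambda>p. [:y, - c:] * p + pderiv p) ^^ k) 1"
  have "deriv (\<lambda>z. poly p z * exp (y * z - c / 2 * z\<^sup>2)) z =
      poly ([:y, - c:] * p + pderiv p) z * exp (y * z - c / 2 * z\<^sup>2)" for z
    by (rule DERIV_imp_deriv) (auto intro!: derivative_eq_intros simp: field_simps power2_eq_square)
  then show ?case unfolding funpow.simps(2) o_apply Suc.IH p_def[symmetric] by (rule ext)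
qed auto

lemma fifth_deriv_exp_quadratic:
  fixes y c :: complex
  shows "(deriv ^^ 5) (\<lambda>z. exp (y * z - c / 2 * z\<^sup>2)) 0 = y ^ 5 - 10 * c * y ^ 3 + 15 * c\<^sup>2 * y"
  unfolding higher_deriv_exp_quadratic
  by (simp add: numeral_eq_Suc pderiv_pCons algebra_simps)

text \<open>Up to a positive factor the fifth derivative of sigma at \<open>0\<close> is an alternating series whose
  first two terms are negative.\<close>
lemma fifth_deriv_sigma_nonzero: "(deriv ^^ 5) gauss_sigma 0 \<noteq> 0"
proof -
  \<comment> \<open>\<open>pi^3 * H k\<close> is the polynomial of
    \<open>fifth_deriv_exp_quadratic\<close> at \<open>c = pi\<close> and \<open>y = pi * k\<close>;
    the \<open>m\<close>-th term of the series has \<open>k = 2 * m + 1\<close>.\<close>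
  define H where "H = (\<lambda>k::real. pi\<^sup>2 * k ^ 5 - 10 * pi * k ^ 3 + 15 * k)"
  define a where "a = (\<lambda>m::nat. exp (- pi * (real m + 1/2)\<^sup>2) * H (2 * real m + 1))"
  define T where "T = (\<lambda>m::int. (deriv ^^ 5) (\<lambda>z. exp (of_real pi / 2 * z\<^sup>2) * theta_term 1 (1/2) (1/2) m z) 0)"
  have T_eq: "T m = unit_char (of_int m * (1/2)) * of_real (exp (- pi * (of_int m + 1/2)\<^sup>2)) *
      of_real (pi ^ 3 * H (2 * of_int m + 1))" for m
  proof -
    define y where "y = complex_of_real pi * (2 * of_int m + 1)"
    define C where "C = unit_char (of_int m * (1/2)) * of_real (exp (- pi * (of_int m + 1/2)\<^sup>2))"
    have "exp (of_real pi / 2 * z\<^sup>2) * theta_term 1 (1/2) (1/2) m z = C * exp (y * z - of_real pi / 2 * z\<^sup>2)" for z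
    proof -
      have "of_real pi / 2 * z\<^sup>2 + - of_real pi * of_nat 1 * (of_real (1/2 + of_int m) - z)\<^sup>2 =
          of_real (- pi * (of_int m + 1/2)\<^sup>2) + (y * z - of_real pi / 2 * z\<^sup>2)"
        by (simp add: y_def power2_eq_square field_simps)
      then have "exp (of_real pi / 2 * z\<^sup>2) * exp (- of_real pi * of_nat 1 * (of_real (1/2 + of_int m) - z)\<^sup>2) =
          of_real (exp (- pi * (of_int m + 1/2)\<^sup>2)) * exp (y * z - of_real pi / 2 * z\<^sup>2)"
        by (simp only: mult_exp_exp exp_of_real[symmetric])
      then show ?thesis by (simp only: theta_term_def C_def mult.assoc mult.left_commute)
    qed
    then have "T m = (deriv ^^ 5) (\<lambda>z. C * exp (y * z - of_real pi / 2 * z\<^sup>2)) 0"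
      by (simp add: T_def)
    also have "\<dots> = C * (deriv ^^ 5) (\<lambda>z. exp (y * z - of_real pi / 2 * z\<^sup>2)) 0"
      by (intro higher_deriv_cmult[of _ UNIV] holomorphic_intros) auto
    also have "\<dots> = C * (y ^ 5 - 10 * of_real pi * y ^ 3 + 15 * (of_real pi)\<^sup>2 * y)"
      unfolding fifth_deriv_exp_quadratic ..
    also have "y ^ 5 - 10 * of_real pi * y ^ 3 + 15 * (of_real pi)\<^sup>2 * y = of_real (pi ^ 3 * H (2 * of_int m + 1))"
      by (simp add: y_def H_def power_mult_distrib algebra_simps power_numeral_reduce)
    finally show ?thesis by (simp add: C_def)
  qed
  have pair: "T (int m) + T (- 1 - int m) = of_real (2 * pi ^ 3 * ((-1) ^ m * a m))" for m
  proof -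
    have "H (2 * of_int (- 1 - int m) + 1) = - H (2 * real m + 1)"
      by (simp add: H_def algebra_simps power_numeral_reduce)
    moreover have "(of_int (- 1 - int m) + 1/2)\<^sup>2 = (real m + 1/2)\<^sup>2"
      by (simp add: power2_eq_square field_simps)
    ultimately show ?thesis
      unfolding T_eq unit_char_half_int by (simp add: a_def)
  qed
  have "(T has_sum (deriv ^^ 5) gauss_sigma 0) UNIV"
    unfolding T_def gauss_sigma_def[abs_def] theta1_def
    by (rule higher_deriv_theta_has_sum) (auto intro!: holomorphic_intros)
  then have "(\<lambda>m. complex_of_real (2 * pi ^ 3 * ((-1) ^ m * a m))) sums (deriv ^^ 5) gauss_sigma 0"
    using has_sum_int_imp_sums_pairs[of T] unfolding pair by blast
  then have "(\<lambda>m. Re (complex_of_real (2 * pi ^ 3 * ((-1) ^ m * a m)))) sums Re ((deriv ^^ 5) gauss_sigma 0)"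
    by (rule sums_Re)
  then have "(\<lambda>m. 2 * pi ^ 3 * ((-1) ^ m * a m)) sums Re ((deriv ^^ 5) gauss_sigma 0)"
    by simp
  then have sums: "(\<lambda>m. (-1) ^ m * a m) sums (Re ((deriv ^^ 5) gauss_sigma 0) / (2 * pi ^ 3))"
    using sums_divide[of _ _ "2 * pi ^ 3"] by fastforce
  define R where "R = Re ((deriv ^^ 5) gauss_sigma 0) / (2 * pi ^ 3)"
  have pi: "3.1 \<le> pi" "pi \<le> 3.2"
    using pi_approx by auto
  \<comment> \<open>\<open>H 1 = pi^2 - 10 * pi + 15\<close> is about -6.5; rounded to -5 it still
    outweighs the tail estimated below.\<close>
  have a0: "a 0 \<le> - 5 * exp (- pi / 4)"
  proof -
    have "pi * pi \<le> 3.2 * 3.2" using pi by (intro mult_mono) auto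
    then have "H 1 \<le> - 5" using pi by (simp add: H_def power2_eq_square)
    then have "H 1 * exp (- pi / 4) \<le> - 5 * exp (- pi / 4)" by (intro mult_right_mono) auto
    then show ?thesis by (simp add: a_def power2_eq_square mult_ac)
  qed
  have H_nonneg: "0 \<le> H k" and H_le: "H k \<le> 10 * k ^ 5" if "k \<ge> 3" for k
  proof -
    have k2: "3 * 3 \<le> k * k" using that by (intro mult_mono) auto
    have "3.1 * 9 \<le> pi * (k * k)" using pi k2 by (intro mult_mono) auto
    then have k3: "10 \<le> pi * k\<^sup>2" by (simp add: power2_eq_square)
    have eq: "H k = k * (pi * k\<^sup>2 * (pi * k\<^sup>2 - 10) + 15)"
      by (simp add: H_def power2_eq_square power_numeral_reduce algebra_simps)
    show "0 \<le> H k" unfolding eq using that k3 by (intro mult_nonneg_nonneg add_nonneg_nonneg) auto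
    have "10 * pi * k ^ 3 - 15 * k = k * (10 * (pi * k\<^sup>2) - 15)"
      by (simp add: power2_eq_square power_numeral_reduce algebra_simps)
    moreover have "0 \<le> k * (10 * (pi * k\<^sup>2) - 15)" using that k3 by (intro mult_nonneg_nonneg) auto
    ultimately have "H k \<le> pi\<^sup>2 * k ^ 5" by (simp add: H_def)
    also have "pi * pi \<le> 3.15 * 3.15" using pi_approx by (intro mult_mono) auto
    then have "pi\<^sup>2 * k ^ 5 \<le> 10 * k ^ 5"
      using that by (intro mult_right_mono) (auto simp: power2_eq_square)
    finally show "H k \<le> 10 * k ^ 5" .
  qed
  \<comment> \<open>Three rough bounds combine: \<open>H k \<le> 10 * k^5\<close>,
    \<open>2 * m + 1 \<le> 3^m\<close>, and \<open>(m + 1/2)^2 \<ge> 1/4 + 3 * m\<close> for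
    \<open>m \<ge> 2\<close>. The ratio is therefore \<open>3^5 / 8^3 = 243/512\<close>.\<close>
  have am: "\<bar>a m\<bar> \<le> exp (- pi / 4) * (10 * (243/512) ^ m)" if "m \<ge> 2" for m
  proof -
    have k: "3 \<le> 2 * real m + 1" using that by simp
    have "\<bar>a m\<bar> = exp (- pi * (real m + 1/2)\<^sup>2) * H (2 * real m + 1)"
      using H_nonneg[OF k] by (simp add: a_def)
    also have "\<dots> \<le> exp (- pi * (real m + 1/2)\<^sup>2) * (10 * (2 * real m + 1) ^ 5)"
      by (intro mult_left_mono H_le k) auto
    also have "(2 * real m + 1) ^ 5 \<le> (3 ^ m) ^ 5"
      using Bernoulli_inequality[of "2::real" m] by (intro power_mono) (auto simp: mult.commute)
    also have "exp (- pi * (real m + 1/2)\<^sup>2) \<le> exp (- pi / 4) * (1/8) ^ (3 * m)"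
    proof -
      have "3 * real m \<le> real m * (real m + 1)" using that by (subst mult.commute) (intro mult_right_mono, auto)
      then have "pi * (3 * real m) \<le> pi * (real m * (real m + 1))" by (intro mult_left_mono) auto
      then have "- pi * (real m + 1/2)\<^sup>2 \<le> - pi / 4 + real (3 * m) * (- pi)"
        by (simp add: power2_eq_square field_simps)
      then have "exp (- pi * (real m + 1/2)\<^sup>2) \<le> exp (- pi / 4) * exp (- pi) ^ (3 * m)"
        unfolding exp_of_nat_mult[symmetric] mult_exp_exp by simp
      also have "exp (- pi) ^ (3 * m) \<le> (1/8) ^ (3 * m)"
        using exp_minus_pi_le by (intro power_mono) auto
      finally show ?thesis by (simp add: mult_left_mono)
    qed
    finally have "\<bar>a m\<bar> \<le> exp (- pi / 4) * (1/8) ^ (3 * m) * (10 * (3 ^ m) ^ 5)"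
      by (simp add: mult_right_mono)
    also have "\<dots> = exp (- pi / 4) * (10 * (((1/8) ^ 3) ^ m * (3 ^ 5) ^ m))"
    proof -
      have "(1/8::real) ^ (3 * m) = ((1/8) ^ 3) ^ m" by (rule power_mult)
      moreover have "((3::real) ^ m) ^ 5 = (3 ^ 5) ^ m" by (metis power_mult mult.commute)
      ultimately show ?thesis by (simp only: mult_ac)
    qed
    also have "((1/8) ^ 3) ^ m * (3 ^ 5) ^ m = (243/512 :: real) ^ m"
      unfolding power_mult_distrib[symmetric] by (simp add: power_divide)
    finally show ?thesis .
  qed
  have "(\<lambda>m. (-1) ^ (m + 2) * a (m + 2)) sums (R - (\<Sum>i<2. (-1) ^ i * a i))"
    using sums_split_initial_segment[OF sums[folded R_def], of 2] by simp
  then have tail: "(\<lambda>m. (-1) ^ (m + 2) * a (m + 2)) sums (R - (a 0 - a 1))"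
    by (simp add: numeral_2_eq_2)
  \<comment> \<open>The sum from \<open>m = 2\<close> on is
    \<open>10 * (243/512)^2 / (1 - 243/512) = 590490/137728\<close>, about 4.29 and hence less than
    5.\<close>
  have geo: "(\<lambda>m. exp (- pi / 4) * (10 * (243/512) ^ (m + 2))) sums (exp (- pi / 4) * (590490 / 137728))"
    using sums_mult[OF geometric_sums[of "243/512::real"], of "exp (- pi / 4) * (10 * (243/512) ^ 2)"]
    by (simp add: power_add power2_eq_square mult_ac)
  have "R - (a 0 - a 1) \<le> exp (- pi / 4) * (590490 / 137728)"
  proof (rule sums_le[OF _ tail geo])
    fix m
    have "(-1) ^ (m + 2) * a (m + 2) \<le> \<bar>(-1) ^ (m + 2) * a (m + 2)\<bar>" by (rule abs_ge_self)
    also have "\<dots> = \<bar>a (m + 2)\<bar>" by (simp add: abs_mult power_abs)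
    also have "\<dots> \<le> exp (- pi / 4) * (10 * (243/512) ^ (m + 2))" by (rule am) simp
    finally show "(-1) ^ (m + 2) * a (m + 2) \<le> exp (- pi / 4) * (10 * (243/512) ^ (m + 2))" .
  qed
  also have "\<dots> < 5 * exp (- pi / 4)" by simp
  finally have "R - (a 0 - a 1) < 5 * exp (- pi / 4)" .
  moreover have "0 \<le> a 1" using H_nonneg[of 3] by (simp add: a_def)
  ultimately have "R < 0" using a0 by linarith
  then show ?thesis by (auto simp: R_def)
qed

text \<open>In \<open>gauss_sigma z = sigma_quot 0 * z + z^5 * t z\<close> the coefficient of
  \<open>z^5\<close> is \<open>t 0\<close>. Computing the residue of the quotient by
  \<open>z^6\<close> on both sides identifies it with the fifth derivative divided by
  \<open>5!\<close>.\<close>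

lemma sigma_quot_expansion_nonzero:
  obtains t where "t holomorphic_on ball 0 1" "t 0 \<noteq> 0"
    "\<And>z. norm z < 1 \<Longrightarrow> sigma_quot z = sigma_quot 0 + z ^ 4 * t z"
proof -
  obtain t where t: "t holomorphic_on ball 0 1"
    "\<And>z. norm z < 1 \<Longrightarrow> sigma_quot z = sigma_quot 0 + z ^ 4 * t z"
    by (rule sigma_quot_expansion) blast
  have "(deriv ^^ 5) gauss_sigma 0 / fact 5 = residue (\<lambda>z. gauss_sigma z / z ^ Suc 5) 0"
    by (rule residue_holomorphic_over_power'[symmetric, of UNIV]) (auto intro!: holomorphic_intros)
  also have "\<dots> = residue (\<lambda>z. sigma_quot 0 / z ^ Suc 4 + t z / z ^ Suc 0) 0"
  proof (rule residue_cong)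
    have "eventually (\<lambda>z. z \<in> ball 0 1 - {0}) (at (0::complex))"
      by (rule eventually_at_in_open) auto
    then show "eventually (\<lambda>z. gauss_sigma z / z ^ Suc 5 = sigma_quot 0 / z ^ Suc 4 + t z / z ^ Suc 0) (at 0)"
    proof eventually_elim
      case (elim z)
      then have "z \<noteq> 0" "gauss_sigma z = z * sigma_quot 0 + z ^ 5 * t z"
        using t(2)[of z] by (auto simp: sigma_eq power_numeral_reduce algebra_simps)
      then show ?case by (simp add: add_divide_distrib power_numeral_reduce)
    qed
  qed auto
  also have "\<dots> = residue (\<lambda>z. sigma_quot 0 / z ^ Suc 4) 0 + residue (\<lambda>z. t z / z ^ Suc 0) 0"
    by (intro residue_add[of "ball 0 1"] holomorphic_intros holomorphic_on_subset[OF t(1)]) auto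
  also have "residue (\<lambda>z. sigma_quot 0 / z ^ Suc 4) 0 = (deriv ^^ 4) (\<lambda>_. sigma_quot 0) 0 / fact 4"
    by (rule residue_holomorphic_over_power'[of UNIV]) auto
  also have "residue (\<lambda>z. t z / z ^ Suc 0) 0 = (deriv ^^ 0) t 0 / fact 0"
    by (rule residue_holomorphic_over_power'[of "ball 0 1"]) (use t(1) in auto)
  finally have "(deriv ^^ 5) gauss_sigma 0 / fact 5 = t 0"
    by (simp add: higher_deriv_const)
  then have "t 0 \<noteq> 0" using fifth_deriv_sigma_nonzero by auto
  with t that show thesis by blast
qed

section \<open>Spans of theta series and elliptic residues\<close>

text \<open>The centres are the \<open>N\<close> points \<open>v\<close> modulo 1 for which
  \<open>N * v\<close> is \<open>c\<close> modulo 1, so all the series share their multipliers: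
  \<open>unit_char \<xi>\<close> under the period 1 and, up to a fixed exponential,
  \<open>unit_char c\<close> under \<open>\<i>\<close>.\<close>

definition theta_span :: "nat \<Rightarrow> real \<Rightarrow> real \<Rightarrow> (complex \<Rightarrow> complex) set" where
  "theta_span N c \<xi> = {F. \<exists>b. \<forall>z. F z = (\<Sum>l<N. b l * theta N ((c + real l) / real N) \<xi> z)}"

lemma theta_span_0: "(\<lambda>_. 0) \<in> theta_span N c \<xi>"
  unfolding theta_span_def by (auto intro!: exI[of _ "\<lambda>_. 0"])

lemma theta_span_add:
  assumes "F \<in> theta_span N c \<xi>" "G \<in> theta_span N c \<xi>"
  shows "(\<lambda>z. F z + G z) \<in> theta_span N c \<xi>"
proof -
  from assms obtain b d where
    "\<forall>z. F z = (\<Sum>l<N. b l * theta N ((c + real l) / real N) \<xi> z)"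
    "\<forall>z. G z = (\<Sum>l<N. d l * theta N ((c + real l) / real N) \<xi> z)"
    unfolding theta_span_def by blast
  then have "\<forall>z. F z + G z = (\<Sum>l<N. (b l + d l) * theta N ((c + real l) / real N) \<xi> z)"
    by (simp add: sum.distrib distrib_right)
  then show ?thesis unfolding theta_span_def by (intro CollectI exI[of _ "\<lambda>l. b l + d l"])
qed

lemma theta_span_cmult:
  assumes "F \<in> theta_span N c \<xi>"
  shows "(\<lambda>z. a * F z) \<in> theta_span N c \<xi>"
proof -
  from assms obtain b where
    "\<forall>z. F z = (\<Sum>l<N. b l * theta N ((c + real l) / real N) \<xi> z)"
    unfolding theta_span_def by blast
  then have "\<forall>z. a * F z = (\<Sum>l<N. (a * b l) * theta N ((c + real l) / real N) \<xi> z)"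
    by (simp add: sum_distrib_left mult.assoc)
  then show ?thesis unfolding theta_span_def by (intro CollectI exI[of _ "\<lambda>l. a * b l"])
qed

lemma theta_span_sum:
  assumes "\<And>x. x \<in> X \<Longrightarrow> F x \<in> theta_span N c \<xi>"
  shows "(\<lambda>z. \<Sum>x\<in>X. F x z) \<in> theta_span N c \<xi>"
  using assms by (induction X rule: infinite_finite_induct) (auto intro: theta_span_0 theta_span_add)

lemma theta_add_of_int_centre:
  "theta N (v + of_int k) \<xi> z = unit_char (- of_int k * \<xi>) * theta N v \<xi> z"
proof -
  have "theta N (v + of_int k) \<xi> z = (\<Sum>\<^sub>\<infinity>m. unit_char (- of_int k * \<xi>) * theta_term N v \<xi> m z)"
    unfolding theta_def
    by (rule infsum_reindex_bij_witness[of _ "\<lambda>m. m - k" "\<lambda>m. m + k"])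
       (auto simp: theta_term_def unit_char_add unit_char_minus field_simps)
  then show ?thesis
    by (simp only: infsum_cmult_right' theta_def)
qed

text \<open>Beyond \<open>N - 1\<close> the index wraps around modulo \<open>N\<close>: the centre
  then moves by an integer, which costs only a unimodular factor.\<close>

lemma theta_in_theta_span:
  assumes "N \<ge> 1"
  shows "theta N ((c + real k) / real N) \<xi> \<in> theta_span N c \<xi>"
proof -
  define r where "r = k mod N"
  have r: "r < N" using assms by (simp add: r_def)
  have "real k = real N * real (k div N) + real r"
    unfolding r_def of_nat_mult[symmetric] of_nat_add[symmetric] by simp
  then have "(c + real k) / real N = (c + real r) / real N + of_int (int (k div N))"
    using assms by (simp add: field_simps)
  then have "theta N ((c + real k) / real N) \<xi> z =
      unit_char (- of_int (int (k div N)) * \<xi>) * theta N ((c + real r) / real N) \<xi> z" for z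
    by (simp only: theta_add_of_int_centre)
  moreover have "theta N ((c + real r) / real N) \<xi> z =
      (\<Sum>l<N. (if l = r then 1 else 0) * theta N ((c + real l) / real N) \<xi> z)" for z
    using r by (simp add: if_distrib[of "\<lambda>x. x * _"] cong: if_cong)
  then have "theta N ((c + real r) / real N) \<xi> \<in> theta_span N c \<xi>"
    unfolding theta_span_def by (intro CollectI exI[of _ "\<lambda>l. if l = r then 1 else 0"]) blast
  from theta_span_cmult[OF this] have "(\<lambda>z. unit_char (- of_int (int (k div N)) * \<xi>) * theta N ((c + real r) / real N) \<xi> z) \<in> theta_span N c \<xi>" .
  ultimately show ?thesis by presburger
qed

text \<open>Characters add under multiplication. The centres delivered by \<open>theta_mult\<close>
  have the numerators \<open>c + a + (l + k)\<close>, where \<open>l + k\<close> may exceed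
  \<open>N\<close> and is wrapped around.\<close>

lemma theta_span_mult_theta:
  assumes N: "N \<ge> 1" and F: "F \<in> theta_span N c \<xi>"
  shows "(\<lambda>z. theta 1 a \<eta> z * F z) \<in> theta_span (N + 1) (c + a) (\<xi> + \<eta>)"
proof -
  obtain d where d: "\<And>z. F z = (\<Sum>l<N. d l * theta N ((c + real l) / real N) \<xi> z)"
    using F unfolding theta_span_def by blast
  have "(\<lambda>z. theta 1 a \<eta> z * theta N ((c + real l) / real N) \<xi> z) \<in> theta_span (N + 1) (c + a) (\<xi> + \<eta>)" for l
  proof -
    obtain b where b: "\<And>z. theta 1 a \<eta> z * theta N ((c + real l) / real N) \<xi> z =
      (\<Sum>k\<le>N. b k * theta (N + 1) ((a + real N * ((c + real l) / real N) + real k) / (real N + 1)) (\<xi> + \<eta>) z)"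
      using theta_mult[OF N, where a = a and \<eta> = \<eta> and v = "(c + real l) / real N" and \<xi> = \<xi>] by blast
    have "(a + real N * ((c + real l) / real N) + real k) / (real N + 1) = (c + a + real (l + k)) / real (N + 1)" for k
      using N by (simp add: add_ac)
    then show ?thesis
      unfolding b by (simp only:) (intro theta_span_sum theta_span_cmult theta_in_theta_span, simp)
  qed
  then have "(\<lambda>z. \<Sum>l<N. d l * (theta 1 a \<eta> z * theta N ((c + real l) / real N) \<xi> z)) \<in> theta_span (N + 1) (c + a) (\<xi> + \<eta>)"
    by (intro theta_span_sum theta_span_cmult)
  then show ?thesis
    by (simp add: d sum_distrib_left mult.left_commute)
qed

lemma theta_span_mult_theta_power:
  assumes "N \<ge> 1" "F \<in> theta_span N c \<xi>"
  shows "(\<lambda>z. theta 1 a \<eta> z ^ k * F z) \<in> theta_span (N + k) (c + real k * a) (\<xi> + real k * \<eta>)"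
proof (induction k)
  case 0
  then show ?case using assms by simp
next
  case (Suc k)
  have "(\<lambda>z. theta 1 a \<eta> z * (theta 1 a \<eta> z ^ k * F z)) \<in>
      theta_span (N + k + 1) (c + real k * a + a) (\<xi> + real k * \<eta> + \<eta>)"
    using assms(1) by (intro theta_span_mult_theta Suc.IH) auto
  then show ?case by (simp add: algebra_simps)
qed

lemma theta_span_1: "theta 1 a \<eta> \<in> theta_span 1 a \<eta>"
  using theta_in_theta_span[of 1 a 0 \<eta>] by simp

lemma theta_span_holomorphic:
  assumes "F \<in> theta_span N c \<xi>"
  shows "F holomorphic_on UNIV"
proof -
  obtain b where "F = (\<lambda>z. \<Sum>l<N. b l * theta N ((c + real l) / real N) \<xi> z)"
    using assms unfolding theta_span_def by auto
  then show ?thesis by (auto intro!: holomorphic_intros)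
qed

lemma theta_span_add_1:
  assumes "F \<in> theta_span N c \<xi>"
  shows "F (z + 1) = unit_char \<xi> * F z"
  using assms by (auto simp: theta_span_def theta_add_1 sum_distrib_left mult_ac)

lemma theta_span_add_ii:
  assumes "F \<in> theta_span N c \<xi>"
  shows "F (z + \<i>) = unit_char c * exp (of_real pi * of_nat N - 2 * of_real pi * \<i> * of_nat N * z) * F z"
proof -
  define X where "X = exp (of_real pi * of_nat N - 2 * of_real pi * \<i> * of_nat N * z)"
  obtain b where b: "\<And>z. F z = (\<Sum>l<N. b l * theta N ((c + real l) / real N) \<xi> z)"
    using assms unfolding theta_span_def by blast
  have "b l * theta N ((c + real l) / real N) \<xi> (z + \<i>) = unit_char c * X * (b l * theta N ((c + real l) / real N) \<xi> z)"
    if "l < N" for l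
  proof -
    have "unit_char (real N * ((c + real l) / real N)) = unit_char c"
      using that by (simp add: unit_char_add)
    then show ?thesis by (simp only: theta_add_ii X_def mult_ac)
  qed
  then show ?thesis
    unfolding b X_def[symmetric] sum_distrib_left by (intro sum.cong) auto
qed

section \<open>Residues of doubly periodic functions\<close>

lemma contour_integral_linepath_shift:
  "contour_integral (linepath (a + c) (b + c)) f = contour_integral (linepath a b) (\<lambda>z. f (z + c))"
proof -
  have "linepath (a + c) (b + c) x = linepath a b x + c" for x
    by (simp add: linepath_def algebra_simps flip: scaleR_add_left)
  then show ?thesis by (simp add: contour_integral_integral)
qed

text \<open>On the boundary of the unit square centred at 0 the integrals over opposite sides cancel
  by periodicity. The closed square lies in the open unit disc, where 0 is the only possible
  singularity.\<close>

lemma residue_doubly_periodic: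
  assumes hol: "E holomorphic_on ball 0 1 - {0}"
    and per: "\<And>z. E (z + 1) = E z" "\<And>z. E (z + \<i>) = E z"
  shows "residue E 0 = 0"
proof -
  define a1 a2 a3 a4 where "a1 = Complex (-1/2) (-1/2)" and "a2 = Complex (1/2) (-1/2)"
    and "a3 = Complex (1/2) (1/2)" and "a4 = Complex (-1/2) (1/2)"
  note a_defs = a1_def a2_def a3_def a4_def
  have cbox_ball: "cbox a1 a3 \<subseteq> ball 0 1"
    using norm_less_1_of_unit_square by (auto simp: a_defs in_cbox_complex_iff abs_le_iff)
  have box0: "0 \<in> box a1 a3" by (simp add: a_defs in_box_complex_iff)
  have path: "path_image (rectpath a1 a3) \<subseteq> ball 0 1 - {0}"
  proof -
    have "path_image (rectpath a1 a3) \<subseteq> cbox a1 a3"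
      by (intro path_image_rectpath_subset_cbox) (auto simp: a_defs)
    moreover have "0 \<notin> path_image (rectpath a1 a3)"
      using box0 by (subst path_image_rectpath_cbox_minus_box) (auto simp: a_defs)
    ultimately show ?thesis using cbox_ball by auto
  qed
  have wn: "winding_number (rectpath a1 a3) z = 0" if "z \<notin> ball 0 1" for z
    using that cbox_ball by (intro winding_number_rectpath_outside) (auto simp: a_defs)
  have "contour_integral (rectpath a1 a3) E =
      2 * pi * \<i> * (\<Sum>p\<in>{0}. winding_number (rectpath a1 a3) p * residue E p)"
    using wn by (intro Residue_theorem[of "ball 0 1"] hol path) auto
  then have res: "contour_integral (rectpath a1 a3) E = 2 * pi * \<i> * residue E 0"
    using winding_number_rectpath[OF box0] by simp
  have rect: "rectpath a1 a3 = linepath a1 a2 +++ linepath a2 a3 +++ linepath a3 a4 +++ linepath a4 a1"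
    by (simp add: rectpath_def a_defs Let_def)
  have "path_image (rectpath a1 a3) = closed_segment a1 a2 \<union> closed_segment a2 a3 \<union> closed_segment a3 a4 \<union> closed_segment a4 a1"
    unfolding rect by (simp add: path_image_join Un_assoc)
  with path have seg: "closed_segment a1 a2 \<subseteq> ball 0 1 - {0}" "closed_segment a2 a3 \<subseteq> ball 0 1 - {0}"
      "closed_segment a3 a4 \<subseteq> ball 0 1 - {0}" "closed_segment a4 a1 \<subseteq> ball 0 1 - {0}"
    by blast+
  have int: "E contour_integrable_on linepath a b" if "closed_segment a b \<subseteq> ball 0 1 - {0}" for a b
    using that by (intro contour_integrable_continuous_linepath
      continuous_on_subset[OF holomorphic_on_imp_continuous_on[OF hol]])
  have "contour_integral (rectpath a1 a3) E = contour_integral (linepath a1 a2) E +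
     (contour_integral (linepath a2 a3) E + (contour_integral (linepath a3 a4) E + contour_integral (linepath a4 a1) E))"
    unfolding rect using int seg by (simp add: contour_integrable_joinI)
  also have "contour_integral (linepath a3 a4) E = - contour_integral (linepath a4 a3) E"
    using contour_integral_reversepath[of "linepath a4 a3" E] by simp
  also have "contour_integral (linepath a4 a3) E = contour_integral (linepath (a1 + \<i>) (a2 + \<i>)) E"
    by (rule arg_cong2[of _ _ _ _ "\<lambda>a b. contour_integral (linepath a b) E"]) (auto simp: a_defs complex_eq_iff)
  also have "\<dots> = contour_integral (linepath a1 a2) E"
    unfolding contour_integral_linepath_shift per ..
  also have "contour_integral (linepath a4 a1) E = - contour_integral (linepath a1 a4) E"
    using contour_integral_reversepath[of "linepath a1 a4" E] by simp
  also have "contour_integral (linepath a2 a3) E = contour_integral (linepath (a1 + 1) (a4 + 1)) E"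
    by (rule arg_cong2[of _ _ _ _ "\<lambda>a b. contour_integral (linepath a b) E"]) (auto simp: a_defs complex_eq_iff)
  also have "\<dots> = contour_integral (linepath a1 a4) E"
    unfolding contour_integral_linepath_shift per ..
  finally show ?thesis using res by simp
qed

section \<open>Derivatives of theta series at the origin\<close>

text \<open>The weight is the \<open>(n + 1)\<close>-st power of the factor between
  \<open>theta1\<close> and \<open>gauss_sigma\<close>; it is also the factor that turns theta terms
  into the generating function of the Hermite functions.\<close>

definition theta_deriv :: "nat \<Rightarrow> (complex \<Rightarrow> complex) \<Rightarrow> complex" where
  "theta_deriv n F = (deriv ^^ n) (\<lambda>z. exp (of_real pi * of_nat (n + 1) / 2 * z\<^sup>2) * F z) 0"

lemma exp_gaussian_power: "exp (of_real pi * of_nat k / 2 * z\<^sup>2) = exp (of_real pi / 2 * z\<^sup>2) ^ k" for z :: complex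
  by (simp add: exp_of_nat_mult[symmetric] mult_ac)

lemma eventually_unit_disc: "eventually (\<lambda>z. z \<noteq> 0 \<and> norm z < 1) (at (0::complex))"
proof -
  have "eventually (\<lambda>z. z \<in> ball 0 1 - {0}) (at (0::complex))"
    by (rule eventually_at_in_open) auto
  then show ?thesis by eventually_elim auto
qed

lemma theta1_nonzero: "norm z < 1 \<Longrightarrow> z \<noteq> 0 \<Longrightarrow> theta1 z \<noteq> 0"
  using theta1_eq_0_in_unit_ball by blast

lemma exp_eq_sigma_quot_div_theta1:
  assumes "norm z < 1" "z \<noteq> 0"
  shows "exp (of_real pi / 2 * z\<^sup>2) = z * sigma_quot z / theta1 z"
  using theta1_nonzero[OF assms] sigma_eq[of z] by (simp add: gauss_sigma_def field_simps)

lemma inverse_theta1: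
  assumes "norm z < 1" "z \<noteq> 0"
  shows "1 / theta1 z = exp (of_real pi / 2 * z\<^sup>2) / (z * sigma_quot z)"
  unfolding exp_eq_sigma_quot_div_theta1[OF assms]
  using theta1_nonzero[OF assms] sigma_quot_nonzero[OF assms(1)] assms(2) by simp

lemma theta_deriv_sum:
  assumes "\<And>l. l \<in> X \<Longrightarrow> F l holomorphic_on UNIV" "finite X"
  shows "theta_deriv n (\<lambda>z. \<Sum>l\<in>X. b l * F l z) = (\<Sum>l\<in>X. b l * theta_deriv n (F l))"
proof -
  define g where "g = (\<lambda>z::complex. exp (of_real pi * of_nat (n + 1) / 2 * z\<^sup>2))"
  have g: "g holomorphic_on UNIV" unfolding g_def by (intro holomorphic_intros)
  have "theta_deriv n (\<lambda>z. \<Sum>l\<in>X. b l * F l z) = (deriv ^^ n) (\<lambda>z. \<Sum>l\<in>X. b l * (g z * F l z)) 0"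
    unfolding theta_deriv_def g_def by (simp only: sum_distrib_left mult.left_commute)
  also have "\<dots> = (\<Sum>l\<in>X. (deriv ^^ n) (\<lambda>z. b l * (g z * F l z)) 0)"
    using assms g by (intro higher_deriv_sum) (auto intro!: holomorphic_intros)
  also have "\<dots> = (\<Sum>l\<in>X. b l * (deriv ^^ n) (\<lambda>z. g z * F l z) 0)"
    using assms g by (intro sum.cong refl higher_deriv_cmult[of _ UNIV]) (auto intro!: holomorphic_intros)
  finally show ?thesis by (simp add: theta_deriv_def g_def)
qed

lemma theta_deriv_span_eq_0:
  assumes "\<And>l. l < n + 1 \<Longrightarrow> theta_deriv n (theta (n + 1) ((c + real l) / real (n + 1)) \<xi>) = 0"
    and "F \<in> theta_span (n + 1) c \<xi>"
  shows "theta_deriv n F = 0"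
proof -
  obtain b where F: "F = (\<lambda>z. \<Sum>l<n + 1. b l * theta (n + 1) ((c + real l) / real (n + 1)) \<xi> z)"
    using assms(2) unfolding theta_span_def by auto
  have "theta_deriv n F = (\<Sum>l<n + 1. b l * theta_deriv n (theta (n + 1) ((c + real l) / real (n + 1)) \<xi>))"
    unfolding F by (rule theta_deriv_sum) (auto intro: theta_holomorphic_UNIV)
  also have "\<dots> = 0"
    using assms(1) by (intro sum.neutral) auto
  finally show ?thesis .
qed

text \<open>On the punctured disc \<open>exp (pi / 2 * z^2) / z\<close> equals
  \<open>sigma_quot z / theta1 z\<close>. The Taylor coefficient thus becomes a residue in which the
  quotient of \<open>F\<close> by \<open>theta1 ^ (n + 1)\<close>, the candidate for an elliptic
  function, stands apart from a holomorphic factor.\<close>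

lemma theta_deriv_eq_residue:
  assumes "F holomorphic_on UNIV"
  shows "theta_deriv n F = fact n * residue (\<lambda>z. sigma_quot z ^ (n + 1) * (F z / theta1 z ^ (n + 1))) 0"
proof -
  have "theta_deriv n F / fact n = residue (\<lambda>z. exp (of_real pi * of_nat (n + 1) / 2 * z\<^sup>2) * F z / z ^ Suc n) 0"
    unfolding theta_deriv_def using assms
    by (intro residue_holomorphic_over_power'[symmetric, of UNIV]) (auto intro!: holomorphic_intros)
  also have "\<dots> = residue (\<lambda>z. sigma_quot z ^ (n + 1) * (F z / theta1 z ^ (n + 1))) 0"
  proof (rule residue_cong)
    show "eventually (\<lambda>z. exp (of_real pi * of_nat (n + 1) / 2 * z\<^sup>2) * F z / z ^ Suc n =
        sigma_quot z ^ (n + 1) * (F z / theta1 z ^ (n + 1))) (at 0)"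
      using eventually_unit_disc
    proof eventually_elim
      case (elim z)
      then show ?case
        unfolding exp_gaussian_power using exp_eq_sigma_quot_div_theta1[of z]
        by (simp add: power_divide power_mult_distrib)
    qed
  qed auto
  finally show ?thesis by (simp add: field_simps)
qed

text \<open>With \<open>n\<close> zeros at the origin only a simple pole remains in the residue,
  whose value is \<open>sigma_quot 0 ^ n * G 0\<close>.\<close>

lemma theta_deriv_theta1_power_mult_nonzero:
  assumes "G holomorphic_on UNIV" "G 0 \<noteq> 0"
  shows "theta_deriv n (\<lambda>z. theta1 z ^ n * G z) \<noteq> 0"
proof -
  define H where "H = (\<lambda>z. exp (of_real pi / 2 * z\<^sup>2) * sigma_quot z ^ n * G z)"
  have "residue (\<lambda>z. sigma_quot z ^ (n + 1) * (theta1 z ^ n * G z / theta1 z ^ (n + 1))) 0 =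
      residue (\<lambda>z. H z / z ^ Suc 0) 0"
  proof (rule residue_cong)
    show "eventually (\<lambda>z. sigma_quot z ^ (n + 1) * (theta1 z ^ n * G z / theta1 z ^ (n + 1)) = H z / z ^ Suc 0) (at 0)"
      using eventually_unit_disc
    proof eventually_elim
      case (elim z)
      then show ?case
        using inverse_theta1[of z] theta1_nonzero[of z] sigma_quot_nonzero[of z]
        by (simp add: H_def field_simps)
    qed
  qed auto
  also have "\<dots> = (deriv ^^ 0) H 0 / fact 0"
    unfolding H_def using assms(1)
    by (intro residue_holomorphic_over_power'[of UNIV]) (auto intro!: holomorphic_intros)
  finally have "theta_deriv n (\<lambda>z. theta1 z ^ n * G z) = fact n * H 0"
    using assms(1) by (subst theta_deriv_eq_residue) (auto intro!: holomorphic_intros)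
  then show ?thesis using assms(2) sigma_quot_0_nonzero by (simp add: H_def)
qed

text \<open>For the symmetric character, the quotient by the power of \<open>theta1\<close> is elliptic, so its residue
  vanishes and only the coefficient of \<open>z\<^sup>4\<close> in the power of \<open>sigma_quot\<close> matters.\<close>
lemma theta_deriv_symmetric:
  assumes F: "F \<in> theta_span (n + 1) c \<xi>" and c: "c - real (n + 1) / 2 \<in> \<int>" and \<xi>: "\<xi> - real (n + 1) / 2 \<in> \<int>"
  obtains r where "r holomorphic_on ball 0 1" "r 0 \<noteq> 0"
    "theta_deriv n F = fact n * residue (\<lambda>z. r z * (z ^ 4 * F z / theta1 z ^ (n + 1))) 0"
proof -
  obtain t where t: "t holomorphic_on ball 0 1" "t 0 \<noteq> 0"
    "\<And>z. norm z < 1 \<Longrightarrow> sigma_quot z = sigma_quot 0 + z ^ 4 * t z"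
    using sigma_quot_expansion_nonzero by blast
  \<comment> \<open>By the factorization of a difference of powers, \<open>z^4 * r z\<close> is
    \<open>sigma_quot z ^ (n + 1) - sigma_quot 0 ^ (n + 1)\<close>. At 0 the sum consists of
    \<open>n + 1\<close> equal terms, so \<open>r 0 \<noteq> 0\<close>.\<close>
  define r where "r = (\<lambda>z. t z * (\<Sum>i<n + 1. sigma_quot z ^ i * sigma_quot 0 ^ (n - i)))"
  have r_hol: "r holomorphic_on ball 0 1"
    unfolding r_def using t(1) by (intro holomorphic_intros)
  have "(\<Sum>i<n + 1. sigma_quot 0 ^ i * sigma_quot 0 ^ (n - i)) = (\<Sum>i<n + 1. sigma_quot 0 ^ n)"
    by (intro sum.cong refl) (simp add: power_add[symmetric])
  then have "r 0 = t 0 * (of_nat (n + 1) * sigma_quot 0 ^ n)"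
    by (simp add: r_def)
  then have r0: "r 0 \<noteq> 0"
    using t(2) sigma_quot_0_nonzero by (simp add: of_nat_neq_0 del: of_nat_Suc)
  have pw: "sigma_quot z ^ (n + 1) = sigma_quot 0 ^ (n + 1) + z ^ 4 * r z" if "norm z < 1" for z
  proof -
    have "sigma_quot z ^ (n + 1) - sigma_quot 0 ^ (n + 1) =
        (sigma_quot z - sigma_quot 0) * (\<Sum>i<n + 1. sigma_quot z ^ i * sigma_quot 0 ^ (n - i))"
      using power_diff_sumr2[of "sigma_quot z" "Suc n" "sigma_quot 0"] by (simp add: mult.commute)
    also have "sigma_quot z - sigma_quot 0 = z ^ 4 * t z" using t(3)[OF that] by simp
    finally show ?thesis by (simp add: r_def algebra_simps)
  qed
  have "theta_deriv n F = fact n * residue (\<lambda>z. r z * (z ^ 4 * F z / theta1 z ^ (n + 1))) 0"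
  proof -
    have Fhol: "F holomorphic_on A" for A
      using theta_span_holomorphic[OF F] by (rule holomorphic_on_subset) auto
    \<comment> \<open>Both characters of \<open>F\<close> are thus \<open>(-1) ^ (n + 1)\<close>,
      the signs that \<open>theta1 ^ (n + 1)\<close> acquires under the two periods; the exponential
      factors agree as well, so the quotient is doubly periodic.\<close>
    have char: "unit_char x = (-1) ^ (n + 1)" if x: "x - real (n + 1) / 2 \<in> \<int>" for x
    proof -
      obtain k where "x = real (n + 1) * (1/2) + of_int k" using x by (elim Ints_cases) (simp add: algebra_simps)
      then have "unit_char x = unit_char (1/2) ^ (n + 1)"
        by (simp only: unit_char_add unit_char_power unit_char_of_int mult_1_right)
      also have "unit_char (1/2) = -1" by (simp add: unit_char_def)
      finally show ?thesis .
    qed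
    define E where "E = (\<lambda>z. F z / theta1 z ^ (n + 1))"
    have E_hol: "E holomorphic_on ball 0 1 - {0}"
      unfolding E_def by (intro holomorphic_intros Fhol) (auto simp: theta1_nonzero)
    have "residue E 0 = 0"
    proof (rule residue_doubly_periodic[OF E_hol])
      show "E (z + 1) = E z" for z
        unfolding E_def theta1_add_1 theta_span_add_1[OF F] char[OF \<xi>]
        by (simp add: power_minus[of "theta1 z"])
      have pw_ii: "(- exp (of_real pi - 2 * of_real pi * \<i> * z) * theta1 z) ^ (n + 1) =
         (-1) ^ (n + 1) * exp (of_real pi * of_nat (n + 1) - 2 * of_real pi * \<i> * of_nat (n + 1) * z) * theta1 z ^ (n + 1)" for z
      proof -
        have "(- exp (of_real pi - 2 * of_real pi * \<i> * z) * theta1 z) ^ (n + 1) =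
           ((-1) * exp (of_real pi - 2 * of_real pi * \<i> * z) * theta1 z) ^ (n + 1)" by simp
        also have "\<dots> = (-1) ^ (n + 1) * exp (of_real pi - 2 * of_real pi * \<i> * z) ^ (n + 1) * theta1 z ^ (n + 1)"
          by (simp only: power_mult_distrib)
        also have "exp (of_real pi - 2 * of_real pi * \<i> * z) ^ (n + 1) = exp (of_real pi * of_nat (n + 1) - 2 * of_real pi * \<i> * of_nat (n + 1) * z)"
          unfolding exp_of_nat_mult[symmetric] by (rule arg_cong[of _ _ exp]) (simp add: algebra_simps)
        finally show ?thesis .
      qed
      show "E (z + \<i>) = E z" for z
        unfolding E_def theta1_add_ii theta_span_add_ii[OF F] char[OF c] pw_ii by simp
    qed
    have "residue (\<lambda>z. sigma_quot z ^ (n + 1) * (F z / theta1 z ^ (n + 1))) 0 =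
        residue (\<lambda>z. sigma_quot 0 ^ (n + 1) * E z + r z * (z ^ 4 * E z)) 0"
    proof (rule residue_cong)
      show "eventually (\<lambda>z. sigma_quot z ^ (n + 1) * (F z / theta1 z ^ (n + 1)) =
          sigma_quot 0 ^ (n + 1) * E z + r z * (z ^ 4 * E z)) (at 0)"
        using eventually_unit_disc
      proof eventually_elim
        case (elim z)
        then show ?case
          unfolding E_def by (subst pw) (auto simp only: distrib_right mult.assoc mult.left_commute)
      qed
    qed auto
    also have "\<dots> = residue (\<lambda>z. sigma_quot 0 ^ (n + 1) * E z) 0 + residue (\<lambda>z. r z * (z ^ 4 * E z)) 0"
      by (intro residue_add[of "ball 0 1"] holomorphic_intros E_hol holomorphic_on_subset[OF r_hol]) auto
    also have "residue (\<lambda>z. sigma_quot 0 ^ (n + 1) * E z) 0 = sigma_quot 0 ^ (n + 1) * residue E 0"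
      by (intro residue_lmul[of "ball 0 1"] E_hol) auto
    finally show ?thesis
      using \<open>residue E 0 = 0\<close> by (simp add: theta_deriv_eq_residue[OF Fhol] E_def)
  qed
  with that r_hol r0 show thesis by blast
qed

lemma theta_deriv_symmetric_eq_0:
  assumes "n \<le> 3" "F \<in> theta_span (n + 1) c \<xi>" "c - real (n + 1) / 2 \<in> \<int>" "\<xi> - real (n + 1) / 2 \<in> \<int>"
  shows "theta_deriv n F = 0"
proof -
  obtain r where r: "r holomorphic_on ball 0 1"
    "theta_deriv n F = fact n * residue (\<lambda>z. r z * (z ^ 4 * F z / theta1 z ^ (n + 1))) 0"
    by (rule theta_deriv_symmetric[OF assms(2-4)]) blast
  have Fhol: "F holomorphic_on A" for A
    using theta_span_holomorphic[OF assms(2)] by (rule holomorphic_on_subset) auto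
  \<comment> \<open>As \<open>n \<le> 3\<close>, the factor \<open>z^4\<close> absorbs the pole of
    order at most \<open>n + 1\<close>: \<open>G\<close> is the integrand with its singularity
    removed.\<close>
  define G where "G = (\<lambda>z. r z * (z ^ (3 - n) * F z * (exp (of_real pi / 2 * z\<^sup>2) / sigma_quot z) ^ (n + 1)))"
  have "residue (\<lambda>z. r z * (z ^ 4 * F z / theta1 z ^ (n + 1))) 0 = residue G 0"
  proof (rule residue_cong)
    show "eventually (\<lambda>z. r z * (z ^ 4 * F z / theta1 z ^ (n + 1)) = G z) (at 0)"
      using eventually_unit_disc
    proof eventually_elim
      case (elim z)
      have "z ^ 4 = z ^ (3 - n) * z ^ (n + 1)"
        unfolding power_add[symmetric] using assms(1) by simp
      then have "z ^ 4 * F z / theta1 z ^ (n + 1) = z ^ (3 - n) * F z * (z * (1 / theta1 z)) ^ (n + 1)"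
        by (simp only: power_mult_distrib power_divide power_one) (simp add: mult_ac)
      also have "z * (1 / theta1 z) = exp (of_real pi / 2 * z\<^sup>2) / sigma_quot z"
        using elim sigma_quot_nonzero[of z] by (simp add: inverse_theta1)
      finally show ?case by (simp add: G_def)
    qed
  qed auto
  also have "\<dots> = 0"
  proof (rule residue_holo[of "ball 0 1"])
    show "G holomorphic_on ball 0 1"
      unfolding G_def by (intro holomorphic_intros r(1) Fhol) (auto simp: sigma_quot_nonzero)
  qed auto
  finally show ?thesis using r(2) by simp
qed

text \<open>The \<open>n - 4\<close> zeros at the origin leave a pole of order exactly 5 in the
  elliptic quotient. After multiplication by \<open>z^4\<close> it is simple, with residue
  proportional to \<open>G 0\<close>.\<close>

lemma theta_deriv_symmetric_nonzero:
  assumes "n \<ge> 4" "(\<lambda>z. theta1 z ^ (n - 4) * G z) \<in> theta_span (n + 1) c \<xi>"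
    "c - real (n + 1) / 2 \<in> \<int>" "\<xi> - real (n + 1) / 2 \<in> \<int>" "G holomorphic_on UNIV" "G 0 \<noteq> 0"
  shows "theta_deriv n (\<lambda>z. theta1 z ^ (n - 4) * G z) \<noteq> 0"
proof -
  obtain r where r: "r holomorphic_on ball 0 1" "r 0 \<noteq> 0"
    "theta_deriv n (\<lambda>z. theta1 z ^ (n - 4) * G z) =
      fact n * residue (\<lambda>z. r z * (z ^ 4 * (theta1 z ^ (n - 4) * G z) / theta1 z ^ (n + 1))) 0"
    by (rule theta_deriv_symmetric[OF assms(2-4)]) blast
  have Ghol: "G holomorphic_on A" for A
    using assms(5) by (rule holomorphic_on_subset) auto
  define H where "H = (\<lambda>z. r z * G z * (exp (of_real pi / 2 * z\<^sup>2) / sigma_quot z) ^ 5)"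
  have "residue (\<lambda>z. r z * (z ^ 4 * (theta1 z ^ (n - 4) * G z) / theta1 z ^ (n + 1))) 0 = residue (\<lambda>z. H z / z ^ Suc 0) 0"
  proof (rule residue_cong)
    show "eventually (\<lambda>z. r z * (z ^ 4 * (theta1 z ^ (n - 4) * G z) / theta1 z ^ (n + 1)) = H z / z ^ Suc 0) (at 0)"
      using eventually_unit_disc
    proof eventually_elim
      case (elim z)
      have nz: "theta1 z \<noteq> 0" using elim theta1_nonzero by blast
      have "theta1 z ^ (n + 1) = theta1 z ^ (n - 4) * theta1 z ^ 5"
        unfolding power_add[symmetric] using assms(1) by simp
      then have "z ^ 4 * (theta1 z ^ (n - 4) * G z) / theta1 z ^ (n + 1) = G z * (z * (1 / theta1 z)) ^ 5 / z"
        using nz elim by (simp add: power_mult_distrib power_divide power_numeral_reduce)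
      also have "z * (1 / theta1 z) = exp (of_real pi / 2 * z\<^sup>2) / sigma_quot z"
        using elim sigma_quot_nonzero[of z] by (simp add: inverse_theta1)
      finally show ?case by (simp add: H_def)
    qed
  qed auto
  also have "\<dots> = (deriv ^^ 0) H 0 / fact 0"
  proof (rule residue_holomorphic_over_power'[of "ball 0 1"])
    show "H holomorphic_on ball 0 1"
      unfolding H_def by (intro holomorphic_intros r(1) Ghol) (auto simp: sigma_quot_nonzero)
  qed auto
  finally show ?thesis
    using r(2,3) assms(6) sigma_quot_0_nonzero by (simp add: H_def)
qed

theorem theta_deriv_nonzero:
  assumes "n \<ge> 4"
  obtains l where "l < n + 1" "theta_deriv n (theta (n + 1) ((c + real l) / real (n + 1)) \<xi>) \<noteq> 0"
proof -
  define \<alpha> \<zeta> where "\<alpha> = c - real (n + 1) / 2" and "\<zeta> = \<xi> - real (n + 1) / 2"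
  \<comment> \<open>One member of the span suffices: by linearity the functional cannot then vanish
    on all the series.\<close>
  have "\<exists>F \<in> theta_span (n + 1) c \<xi>. theta_deriv n F \<noteq> 0"
  proof (cases "\<alpha> \<in> \<int> \<and> \<zeta> \<in> \<int>")
    case False
    \<comment> \<open>This factor supplies the part of the character that \<open>n\<close> factors
      \<open>theta1\<close> leave open. Its zeros lie at \<open>\<alpha> - \<i> * \<zeta>\<close>
      modulo Gaussian integers, hence not at 0.\<close>
    define G where "G = theta 1 (1/2 + \<alpha>) (1/2 + \<zeta>)"
    have mem: "(\<lambda>z. theta1 z ^ n * G z) \<in> theta_span (1 + n) (1/2 + \<alpha> + real n * (1/2)) (1/2 + \<zeta> + real n * (1/2))"
      unfolding G_def theta1_def by (intro theta_span_mult_theta_power theta_span_1) auto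
    have eq: "1/2 + \<alpha> + real n * (1/2) = c" "1/2 + \<zeta> + real n * (1/2) = \<xi>"
      by (auto simp: \<alpha>_def \<zeta>_def field_simps)
    have "(\<lambda>z. theta1 z ^ n * G z) \<in> theta_span (n + 1) c \<xi>"
      using mem unfolding eq by simp
    moreover have "theta_deriv n (\<lambda>z. theta1 z ^ n * G z) \<noteq> 0"
      using False theta_0_nonzero
      by (intro theta_deriv_theta1_power_mult_nonzero) (auto simp: G_def intro!: holomorphic_intros)
    ultimately show ?thesis by blast
  next
    case True
    \<comment> \<open>Five zeros with the prescribed sum, none at a Gaussian integer: modulo
      Gaussian integers four of them are \<open>1/5\<close> and one is
      \<open>\<alpha> - 4/5\<close>. Any other splitting that avoids the lattice would
      serve.\<close>
    define G where "G = (\<lambda>z. theta 1 (1/2 + 1/5) (1/2 + 0) z ^ 4 * theta 1 (1/2 + (\<alpha> - 4/5)) (1/2 + \<zeta>) z)"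
    have mem': "(\<lambda>z. theta1 z ^ (n - 4) * G z) \<in> theta_span (1 + 4 + (n - 4))
        (1/2 + (\<alpha> - 4/5) + real 4 * (1/2 + 1/5) + real (n - 4) * (1/2)) (1/2 + \<zeta> + real 4 * (1/2 + 0) + real (n - 4) * (1/2))"
      unfolding G_def theta1_def by (intro theta_span_mult_theta_power theta_span_1) auto
    have eq: "1/2 + (\<alpha> - 4/5) + real 4 * (1/2 + 1/5) + real (n - 4) * (1/2) = c"
      "1/2 + \<zeta> + real 4 * (1/2 + 0) + real (n - 4) * (1/2) = \<xi>" "1 + 4 + (n - 4) = n + 1"
      using assms by (auto simp: \<alpha>_def \<zeta>_def field_simps of_nat_diff)
    have mem: "(\<lambda>z. theta1 z ^ (n - 4) * G z) \<in> theta_span (n + 1) c \<xi>"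
      using mem' unfolding eq .
    have fifth: "x / 5 \<notin> \<int>" if "x = 1 \<or> x = -4" for x :: real
    proof
      assume "x / 5 \<in> \<int>"
      then obtain k where "x / 5 = of_int k" by (elim Ints_cases)
      then have "x = of_int (5 * k)" by simp
      with that have "5 * k = 1 \<or> 5 * k = -4" by linarith
      then show False by presburger
    qed
    have "\<alpha> - 4/5 \<notin> \<int>"
    proof
      assume "\<alpha> - 4/5 \<in> \<int>"
      then have "(\<alpha> - 4/5) - \<alpha> \<in> \<int>" using True by (intro Ints_diff) auto
      then show False using fifth[of "-4"] by simp
    qed
    moreover have "1/5 \<notin> (\<int> :: real set)" using fifth[of 1] by simp
    ultimately have "G 0 \<noteq> 0"
      using theta_0_nonzero[of "1/5" 0] theta_0_nonzero[of "\<alpha> - 4/5" \<zeta>] unfolding G_def by simp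
    moreover have "G holomorphic_on UNIV" unfolding G_def by (auto intro!: holomorphic_intros)
    ultimately have "theta_deriv n (\<lambda>z. theta1 z ^ (n - 4) * G z) \<noteq> 0"
      using True mem assms by (intro theta_deriv_symmetric_nonzero[where c = c and \<xi> = \<xi>]) (auto simp: \<alpha>_def \<zeta>_def)
    with mem show ?thesis by blast
  qed
  with theta_deriv_span_eq_0 that show thesis by metis
qed

text \<open>This is the exceptional character: both parameters are \<open>(n + 1) / 2\<close>, and
  the centres are \<open>1/2 + l / (n + 1)\<close>. It locates the common zero of the Zak transforms
  at the time \<open>1/2\<close>.\<close>

theorem theta_deriv_eq_0:
  assumes "n \<le> 3"
  shows "theta_deriv n (theta (n + 1) ((real (n + 1) / 2 + real l) / real (n + 1)) (real (n + 1) / 2)) = 0"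
  using assms by (rule theta_deriv_symmetric_eq_0) (auto intro!: theta_in_theta_span simp del: of_nat_Suc of_nat_add)

section \<open>Fourier series of bounded functions\<close>

text \<open>The interval is half-open so that its integer translates tile the line and its points
  correspond to those of the circle.\<close>

abbreviation unit_measure :: "real measure" where
  "unit_measure \<equiv> restrict_space lborel {0..<1}"

lemma emeasure_unit_measure: "emeasure unit_measure {0..<1} = 1"
  by (simp add: emeasure_restrict_space)

interpretation unit_measure: finite_measure unit_measure
  by standard (simp add: emeasure_unit_measure)

lemma measure_unit_measure [simp]: "measure unit_measure {0..<1} = 1"
  by (simp add: measure_def emeasure_unit_measure)

lemma integrable_unit_measure:
  fixes f :: "real \<Rightarrow> 'b::{banach,second_countable_topology}"
  assumes "f \<in> borel_measurable borel" "\<And>x. x \<in> {0..<1} \<Longrightarrow> norm (f x) \<le> B"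
  shows "integrable unit_measure f"
proof (rule unit_measure.integrable_const_bound[where B = B])
  show "AE x in unit_measure. norm (f x) \<le> B"
    using assms(2) by (intro AE_I2) simp
  show "f \<in> borel_measurable unit_measure"
    using assms(1) by (intro measurable_restrict_space1) simp
qed

lemma integral_unit_measure_eq:
  fixes f :: "real \<Rightarrow> 'b::{banach,second_countable_topology}"
  assumes [measurable]: "f \<in> borel_measurable borel"
  shows "integral\<^sup>L unit_measure f = (LINT x|lborel. indicator {0..1} x *\<^sub>R f x)"
proof -
  have "integral\<^sup>L unit_measure f = (LINT x|lborel. indicator {0..<1} x *\<^sub>R f x)"
    by (rule integral_restrict_space) auto
  also have "\<dots> = (LINT x|lborel. indicator {0..1} x *\<^sub>R f x)"
  proof (rule integral_cong_AE)
    show "AE x in lborel. indicator {0..<1} x *\<^sub>R f x = indicator {0..1} x *\<^sub>R f x"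
      using AE_lborel_singleton[of 1] by eventually_elim (auto simp: indicator_def)
  qed measurable
  finally show ?thesis .
qed

lemma integral_unit_char:
  "integral\<^sup>L unit_measure (\<lambda>x. unit_char (of_int k * x)) = (if k = 0 then 1 else 0)"
proof (cases "k = 0")
  case False
  define c where "c = 2 * complex_of_real pi * \<i> * of_int k"
  have c: "c \<noteq> 0" using False by (simp add: c_def)
  have "unit_char (of_int k * x) = exp (c * of_real x)" for x
    by (simp add: unit_char_exp c_def mult_ac)
  then have "integral\<^sup>L unit_measure (\<lambda>x. unit_char (of_int k * x)) =
      (LINT x|lborel. indicator {0..1} x *\<^sub>R exp (c * of_real x))"
    by (subst integral_unit_measure_eq) auto
  also have "\<dots> = exp (c * of_real 1) / c - exp (c * of_real 0) / c"
  proof (rule integral_FTC_Icc)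
    fix x :: real
    have "((\<lambda>z. exp (c * z) / c) has_field_derivative exp (c * of_real x)) (at (of_real x))"
      using c by (auto intro!: derivative_eq_intros)
    then have "((\<lambda>x. exp (c * of_real x) / c) has_vector_derivative exp (c * of_real x)) (at x)"
      by (rule has_vector_derivative_real_field)
    then show "((\<lambda>x. exp (c * of_real x) / c) has_vector_derivative exp (c * of_real x)) (at x within {0..1})"
      by (rule has_vector_derivative_at_within)
  qed (auto intro!: continuous_intros)
  also have "exp (c * of_real 1) = unit_char (of_int k)"
    by (simp add: unit_char_exp c_def mult_ac)
  finally show ?thesis using False by simp
qed simp

lemma borel_measurable_unit_char [measurable (raw)]:
  "f \<in> borel_measurable M \<Longrightarrow> (\<lambda>x. unit_char (f x)) \<in> borel_measurable M"
  unfolding unit_char_exp by measurable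

lemma continuous_on_unit_char [continuous_intros]:
  "continuous_on A f \<Longrightarrow> continuous_on A (\<lambda>x. unit_char (f x))"
  unfolding unit_char_exp by (intro continuous_intros)

definition trig_poly :: "(int \<Rightarrow> complex) \<Rightarrow> int set \<Rightarrow> real \<Rightarrow> complex" where
  "trig_poly c S x = (\<Sum>m\<in>S. c m * unit_char (of_int m * x))"

definition fourier_coeff :: "(real \<Rightarrow> complex) \<Rightarrow> int \<Rightarrow> complex" where
  "fourier_coeff g l = integral\<^sup>L unit_measure (\<lambda>x. g x * unit_char (- of_int l * x))"

text \<open>Products and polynomials in \<open>unit_char\<close> are handled by induction over this
  set; \<open>trig_polys_imp_trig_poly\<close> then recovers the coefficients that orthogonality
  requires.\<close>

inductive_set trig_polys :: "(real \<Rightarrow> complex) set" where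
  monomial: "(\<lambda>x. c * unit_char (of_int l * x)) \<in> trig_polys"
| add: "f \<in> trig_polys \<Longrightarrow> g \<in> trig_polys \<Longrightarrow> (\<lambda>x. f x + g x) \<in> trig_polys"

lemma trig_polys_const: "(\<lambda>x. c) \<in> trig_polys"
  using trig_polys.monomial[of c 0] by simp

lemma trig_polys_monomial_mult:
  "f \<in> trig_polys \<Longrightarrow> (\<lambda>x. c * unit_char (of_int l * x) * f x) \<in> trig_polys"
proof (induction rule: trig_polys.induct)
  case (monomial d k)
  have "(\<lambda>x. c * unit_char (of_int l * x) * (d * unit_char (of_int k * x))) =
      (\<lambda>x. (c * d) * unit_char (of_int (l + k) * x))"
    by (simp only: of_int_add distrib_right unit_char_add) (simp only: mult_ac)
  then show ?case by (simp only: trig_polys.monomial)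
next
  case (add f g)
  then show ?case by (simp only: distrib_left trig_polys.add)
qed

lemma trig_polys_mult: "f \<in> trig_polys \<Longrightarrow> g \<in> trig_polys \<Longrightarrow> (\<lambda>x. f x * g x) \<in> trig_polys"
proof (induction f rule: trig_polys.induct)
  case (monomial c l)
  then show ?case by (rule trig_polys_monomial_mult)
next
  case (add f h)
  then show ?case by (simp only: distrib_right trig_polys.add)
qed

lemma trig_polys_imp_trig_poly:
  assumes "f \<in> trig_polys"
  obtains c S where "finite S" "f = trig_poly c S"
proof -
  \<comment> \<open>The induction hypothesis also asks for coefficients 0 outside \<open>S\<close>,
    so that two polynomials can be added over the union of their index sets.\<close>
  have "\<exists>c S. finite S \<and> (\<forall>m. m \<notin> S \<longrightarrow> c m = 0) \<and> f = trig_poly c S"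
    using assms
  proof (induction rule: trig_polys.induct)
    case (monomial c l)
    then show ?case
      by (intro exI[of _ "\<lambda>m. if m = l then c else 0"] exI[of _ "{l}"]) (auto simp: trig_poly_def)
  next
    case (add f g)
    then obtain c S d T where
      f: "finite S" "\<And>m. m \<notin> S \<Longrightarrow> c m = 0" "f = trig_poly c S" and
      g: "finite T" "\<And>m. m \<notin> T \<Longrightarrow> d m = 0" "g = trig_poly d T" by blast
    have "trig_poly c (S \<union> T) = trig_poly c S"
      unfolding trig_poly_def using f g by (intro ext sum.mono_neutral_right) auto
    moreover have "trig_poly d (S \<union> T) = trig_poly d T"
      unfolding trig_poly_def using f g by (intro ext sum.mono_neutral_right) auto
    ultimately have "(\<lambda>x. f x + g x) = trig_poly (\<lambda>m. c m + d m) (S \<union> T)"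
      unfolding f g by (auto simp: fun_eq_iff trig_poly_def sum.distrib distrib_right)
    then show ?case using f g by (intro exI[of _ "\<lambda>m. c m + d m"] exI[of _ "S \<union> T"]) auto
  qed
  then show thesis using that by blast
qed

section \<open>Density of the trigonometric polynomials\<close>

lemma real_polynomial_unit_char_in_trig_polys:
  fixes r :: "complex \<Rightarrow> real"
  assumes "real_polynomial_function r"
  shows "(\<lambda>x. of_real (r (unit_char x))) \<in> trig_polys"
  using assms
proof (induction rule: real_polynomial_function.induct)
  case (linear f)
  interpret bounded_linear f by fact
  \<comment> \<open>A real linear functional is determined by its values at \<open>1\<close> and
    \<open>\<i>\<close>, and the real and imaginary parts of \<open>unit_char x\<close> are
    combinations of \<open>unit_char x\<close> and its inverse.\<close>
  have "of_real (f (unit_char x)) =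
      (of_real (f 1) / 2 - \<i> * of_real (f \<i>) / 2) * unit_char (of_int 1 * x) +
      (of_real (f 1) / 2 + \<i> * of_real (f \<i>) / 2) * unit_char (of_int (- 1) * x)" for x
  proof -
    have "unit_char x = Re (unit_char x) *\<^sub>R 1 + Im (unit_char x) *\<^sub>R \<i>"
      by (simp add: complex_eq_iff)
    then have "f (unit_char x) = Re (unit_char x) * f 1 + Im (unit_char x) * f \<i>"
      by (metis add scale real_scaleR_def)
    then show ?thesis
      by (simp add: complex_eq_iff unit_char_def field_simps)
  qed
  then show ?case by (simp only: trig_polys.intros)
qed (auto intro: trig_polys_const trig_polys.add trig_polys_mult)

lemma polynomial_unit_char_in_trig_polys:
  fixes p :: "complex \<Rightarrow> complex"
  assumes "polynomial_function p"
  shows "(\<lambda>x. p (unit_char x)) \<in> trig_polys"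
proof -
  have "real_polynomial_function (\<lambda>z. Re (p z))" "real_polynomial_function (\<lambda>z. Im (p z))"
    using assms bounded_linear_Re bounded_linear_Im unfolding polynomial_function_def o_def by blast+
  then have "(\<lambda>x. of_real (Re (p (unit_char x))) + \<i> * of_real (Im (p (unit_char x)))) \<in> trig_polys"
    by (intro trig_polys.add trig_polys_mult trig_polys_const real_polynomial_unit_char_in_trig_polys)
  then show ?thesis by (simp only: complex_eq[symmetric])
qed

lemma trig_poly_uniform_approx:
  fixes q :: "real \<Rightarrow> complex"
  assumes "continuous_on {0..1} q" "q 0 = q 1" "\<epsilon> > 0"
  obtains p where "p \<in> trig_polys" "\<And>x. x \<in> {0..<1} \<Longrightarrow> norm (q x - p x) < \<epsilon>"
proof -
  define Q where "Q = q \<circ> (\<lambda>z. Arg2pi z / (2 * pi))"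
  \<comment> \<open>Continuity of \<open>Q\<close> across the cut of \<open>Arg2pi\<close> is
    extracted from the passage from loops to circle maps, applied to the trivial homotopy.\<close>
  have "homotopic_loops UNIV q q"
    using assms(1,2) by (simp add: homotopic_loops_refl path_def pathfinish_def pathstart_def)
  then have "homotopic_with_canon (\<lambda>h. True) (sphere 0 1) UNIV Q Q"
    unfolding Q_def by (rule homotopic_loops_imp_homotopic_circlemaps)
  then have cont: "continuous_on (sphere 0 1) Q"
    using homotopic_with_imp_continuous by blast
  obtain p where p': "polynomial_function p \<and> (\<forall>z\<in>sphere 0 1. norm (Q z - p z) < \<epsilon>)"
    using Stone_Weierstrass_polynomial_function[OF compact_sphere cont assms(3)] ..
  then have p: "polynomial_function p" "\<And>z. z \<in> sphere 0 1 \<Longrightarrow> norm (Q z - p z) < \<epsilon>"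
    by auto
  have "norm (q x - p (unit_char x)) < \<epsilon>" if "x \<in> {0..<1}" for x
  proof -
    have "Arg2pi (unit_char x) = 2 * pi * x"
      using that by (intro Arg2pi_unique[of 1]) (auto simp: unit_char_def cis_conv_exp)
    then have "Q (unit_char x) = q x" by (simp add: Q_def)
    then show ?thesis using p(2)[of "unit_char x"] by simp
  qed
  then show thesis
    using that[of "\<lambda>x. p (unit_char x)"] polynomial_unit_char_in_trig_polys[OF p(1)] by blast
qed

lemma trig_polys_borel: "p \<in> trig_polys \<Longrightarrow> p \<in> borel_measurable borel"
proof (induction rule: trig_polys.induct)
  case (monomial c l)
  show ?case by measurable
next
  case (add f g)
  then show ?case by (intro borel_measurable_add)
qed

lemma trig_polys_bounded:
  assumes "p \<in> trig_polys"
  obtains B where "\<And>x. norm (p x) \<le> B"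
proof -
  have "\<exists>B. \<forall>x. norm (p x) \<le> B"
    using assms
  proof (induction rule: trig_polys.induct)
    case (monomial c l)
    then show ?case by (auto simp: norm_mult)
  next
    case (add f g)
    then obtain B C where "\<forall>x. norm (f x) \<le> B" "\<forall>x. norm (g x) \<le> C" by blast
    then have "\<forall>x. norm (f x + g x) \<le> B + C"
      by (meson add_mono norm_triangle_le)
    then show ?case by blast
  qed
  then show thesis using that by blast
qed

lemma norm_add_power2_le: "(norm (x + y))\<^sup>2 \<le> 2 * (norm x)\<^sup>2 + 2 * (norm y)\<^sup>2"
  for x y :: "'a::real_normed_vector"
proof -
  have "(norm (x + y))\<^sup>2 \<le> (norm x + norm y)\<^sup>2"
    by (intro power_mono norm_triangle_ineq) auto
  also have "\<dots> \<le> 2 * (norm x)\<^sup>2 + 2 * (norm y)\<^sup>2"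
    using zero_le_power2[of "norm x - norm y"] by (simp add: power2_eq_square algebra_simps)
  finally show ?thesis .
qed

lemma integrable_norm_power2_unit:
  fixes f :: "real \<Rightarrow> complex"
  assumes "f \<in> borel_measurable borel" "\<And>x. x \<in> {0..<1} \<Longrightarrow> norm (f x) \<le> B"
  shows "integrable unit_measure (\<lambda>x. (norm (f x))\<^sup>2)"
  using assms by (intro integrable_unit_measure[where B = "B\<^sup>2"]) (auto intro: power_mono)

text \<open>A measurable function is almost everywhere a limit of continuous functions
  \<open>k n\<close>. Made bounded by \<open>clamp\<close> and equal at both ends by
  \<open>cut\<close>, they converge in mean square by dominated convergence, and one of them is then
  approximated uniformly.\<close>

theorem trig_polys_L2_dense:
  fixes g :: "real \<Rightarrow> complex"
  assumes g[measurable]: "g \<in> borel_measurable borel" and R: "\<And>x. norm (g x) \<le> R" and "\<epsilon> > 0"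
  obtains p where "p \<in> trig_polys" "integral\<^sup>L unit_measure (\<lambda>x. (norm (g x - p x))\<^sup>2) < \<epsilon>"
proof -
  define R' where "R' = R + 1"
  have R': "R' > 0" using order_trans[OF norm_ge_zero R] by (simp add: R'_def add_nonneg_pos)
  have "g measurable_on UNIV"
    by (rule lebesgue_measurable_imp_measurable_on) (auto intro: measurable_completion)
  then obtain N k where N: "negligible N" and k: "\<And>n. continuous_on UNIV (k n)"
    and lim: "\<And>x. x \<notin> N \<Longrightarrow> (\<lambda>n. k n x) \<longlonglongrightarrow> g x"
    unfolding measurable_on_def by auto
  \<comment> \<open>The radial retraction onto the disc of radius \<open>R' = R + 1\<close>. It
    fixes all values of \<open>g\<close>, and the added 1 keeps the radius positive.\<close>
  define clamp where "clamp = (\<lambda>z::complex. (R' / max R' (norm z)) *\<^sub>R z)"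
  \<comment> \<open>It vanishes at 0 and 1, and at each interior point it equals 1 from some
    \<open>n\<close> on.\<close>
  define cut where "cut = (\<lambda>n x::real. min 1 (max 0 (real n * (x * (1 - x)))))"
  define q where "q = (\<lambda>n x. cut n x *\<^sub>R clamp (k n x))"
  have clamp_cont: "continuous_on UNIV clamp"
    unfolding clamp_def using R' by (intro continuous_intros) (auto simp: max_def)
  have clamp_le: "norm (clamp z) \<le> R'" for z
    using R' by (auto simp: clamp_def max_def field_simps)
  have q_cont: "continuous_on UNIV (q n)" for n
    unfolding q_def cut_def using k
    by (intro continuous_intros continuous_on_compose2[OF clamp_cont]) auto
  have q_meas[measurable]: "q n \<in> borel_measurable borel" for n
    by (rule borel_measurable_continuous_onI[OF q_cont])
  have q_le: "norm (q n x) \<le> R'" for n x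
  proof -
    have "norm (q n x) \<le> 1 * R'"
      unfolding q_def norm_scaleR using clamp_le by (intro mult_mono) (auto simp: cut_def)
    then show ?thesis by simp
  qed
  have gq_le: "norm (g x - q n x) \<le> R + R'" for n x
    using R[of x] q_le[of n x] norm_triangle_ineq4[of "g x" "q n x"] by linarith
  have q_ends: "q n 0 = q n 1" for n by (simp add: q_def cut_def)
  have q_lim: "(\<lambda>n. q n x) \<longlonglongrightarrow> g x" if x: "x \<in> {0<..<1}" "x \<notin> N" for x
  proof -
    have "(\<lambda>n. clamp (k n x)) \<longlonglongrightarrow> clamp (g x)"
      using clamp_cont lim[OF x(2)] by (auto intro: continuous_on_tendsto_compose)
    also have "clamp (g x) = g x"
      using R' R[of x] by (simp add: clamp_def R'_def max_def)
    finally have 1: "(\<lambda>n. clamp (k n x)) \<longlonglongrightarrow> g x" .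
    have "x * (1 - x) > 0" using x by simp
    then obtain n0 where n0: "1 < real n0 * (x * (1 - x))" using reals_Archimedean3 by blast
    have "cut n x = 1" if "n \<ge> n0" for n
    proof -
      have "real n0 * (x * (1 - x)) \<le> real n * (x * (1 - x))"
        using that \<open>x * (1 - x) > 0\<close> by (intro mult_right_mono) auto
      then show ?thesis using n0 by (simp add: cut_def)
    qed
    then have 2: "(\<lambda>n. cut n x) \<longlonglongrightarrow> 1"
      by (intro tendsto_eventually eventually_sequentiallyI[of n0])
    from tendsto_scaleR[OF 2 1] show ?thesis by (simp add: q_def)
  qed
  have "(\<lambda>n. integral\<^sup>L unit_measure (\<lambda>x. (norm (g x - q n x))\<^sup>2)) \<longlonglongrightarrow> integral\<^sup>L unit_measure (\<lambda>x. 0)"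
  proof (rule integral_dominated_convergence[where w = "\<lambda>_. (R + R')\<^sup>2"])
    show "(\<lambda>x. (norm (g x - q n x))\<^sup>2) \<in> borel_measurable unit_measure" for n
      by (intro measurable_restrict_space1) measurable
    show "integrable unit_measure (\<lambda>_. (R + R')\<^sup>2)" by simp
    have "AE x in lborel. x \<notin> N"
    proof -
      have "AE x in lebesgue. x \<notin> N" using N by (intro AE_not_in) (simp add: negligible_iff_null_sets)
      then show ?thesis by (simp add: AE_completion_iff)
    qed
    then have "AE x in lborel. x \<in> {0..<1} \<longrightarrow> (\<lambda>n. (norm (g x - q n x))\<^sup>2) \<longlonglongrightarrow> 0"
      using AE_lborel_singleton[of 0]
    proof eventually_elim
      case (elim x)
      show ?case
      proof
        assume "x \<in> {0..<1}"
        then have "(\<lambda>n. (norm (g x - q n x))\<^sup>2) \<longlonglongrightarrow> (norm (g x - g x))\<^sup>2"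
          using elim by (intro tendsto_intros q_lim) auto
        then show "(\<lambda>n. (norm (g x - q n x))\<^sup>2) \<longlonglongrightarrow> 0" by simp
      qed
    qed
    then show "AE x in unit_measure. (\<lambda>n. (norm (g x - q n x))\<^sup>2) \<longlonglongrightarrow> 0"
      by (subst AE_restrict_space_iff) auto
    show "AE x in unit_measure. norm ((norm (g x - q n x))\<^sup>2) \<le> (R + R')\<^sup>2" for n
    proof (rule AE_I2)
      fix x
      show "norm ((norm (g x - q n x))\<^sup>2) \<le> (R + R')\<^sup>2" using gq_le by (simp add: power_mono)
    qed
  qed auto
  then have "(\<lambda>n. integral\<^sup>L unit_measure (\<lambda>x. (norm (g x - q n x))\<^sup>2)) \<longlonglongrightarrow> 0" by simp
  then have "eventually (\<lambda>n. integral\<^sup>L unit_measure (\<lambda>x. (norm (g x - q n x))\<^sup>2) < \<epsilon> / 4) sequentially"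
    using assms(3) by (intro order_tendstoD) auto
  then obtain n where n: "integral\<^sup>L unit_measure (\<lambda>x. (norm (g x - q n x))\<^sup>2) < \<epsilon> / 4"
    by (auto simp: eventually_sequentially)
  \<comment> \<open>Each of the two squared errors is allowed \<open>\<epsilon> / 4\<close>; the
    factor 2 of \<open>norm_add_power2_le\<close> brings the total to
    \<open>\<epsilon>\<close>.\<close>
  define \<delta> where "\<delta> = sqrt (\<epsilon> / 4)"
  have \<delta>: "\<delta> > 0" "\<delta>\<^sup>2 = \<epsilon> / 4" using assms(3) by (auto simp: \<delta>_def)
  obtain p where p: "p \<in> trig_polys" "\<And>x. x \<in> {0..<1} \<Longrightarrow> norm (q n x - p x) < \<delta>"
    using trig_poly_uniform_approx[of "q n" \<delta>] q_ends \<delta>(1) continuous_on_subset[OF q_cont] by (metis subset_UNIV)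
  obtain B where B: "\<And>x. norm (p x) \<le> B" using trig_polys_bounded[OF p(1)] by blast
  have [measurable]: "p \<in> borel_measurable borel" by (rule trig_polys_borel[OF p(1)])
  have "integral\<^sup>L unit_measure (\<lambda>x. (norm (g x - p x))\<^sup>2) \<le>
      integral\<^sup>L unit_measure (\<lambda>x. 2 * (norm (g x - q n x))\<^sup>2 + 2 * \<delta>\<^sup>2)"
  proof (rule integral_mono_AE)
    show "integrable unit_measure (\<lambda>x. (norm (g x - p x))\<^sup>2)"
    proof (rule integrable_norm_power2_unit[where B = "R + B"])
      show "norm (g x - p x) \<le> R + B" for x
        using R[of x] B[of x] norm_triangle_ineq4[of "g x" "p x"] by linarith
    qed measurable
    show "integrable unit_measure (\<lambda>x. 2 * (norm (g x - q n x))\<^sup>2 + 2 * \<delta>\<^sup>2)"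
      by (intro Bochner_Integration.integrable_add integrable_mult_right integrable_norm_power2_unit[where B = "R + R'"])
         (use gq_le in auto)
    show "AE x in unit_measure. (norm (g x - p x))\<^sup>2 \<le> 2 * (norm (g x - q n x))\<^sup>2 + 2 * \<delta>\<^sup>2"
    proof (rule AE_I2)
      fix x assume "x \<in> space unit_measure"
      then have "norm (q n x - p x) < \<delta>" using p(2) by simp
      then have "(norm (q n x - p x))\<^sup>2 \<le> \<delta>\<^sup>2" by (intro power_mono) auto
      then show "(norm (g x - p x))\<^sup>2 \<le> 2 * (norm (g x - q n x))\<^sup>2 + 2 * \<delta>\<^sup>2"
        using norm_add_power2_le[of "g x - q n x" "q n x - p x"] by simp
    qed
  qed
  also have "\<dots> = 2 * integral\<^sup>L unit_measure (\<lambda>x. (norm (g x - q n x))\<^sup>2) + 2 * \<delta>\<^sup>2"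
    by (subst Bochner_Integration.integral_add)
       (use gq_le in \<open>auto intro!: integrable_mult_right integrable_norm_power2_unit[where B = "R + R'"]\<close>)
  also have "\<dots> < \<epsilon>" using n \<delta>(2) by simp
  finally show thesis using that p(1) by blast
qed

section \<open>Orthogonality and the Parseval identity\<close>

lemma borel_measurable_cnj_raw [measurable (raw)]:
  "f \<in> borel_measurable M \<Longrightarrow> (\<lambda>x. cnj (f x)) \<in> borel_measurable M"
  by (rule measurable_compose[OF _ borel_measurable_continuous_onI]) (auto intro!: continuous_intros)

lemma trig_poly_borel [measurable]: "trig_poly c S \<in> borel_measurable borel"
  unfolding trig_poly_def[abs_def] by measurable

lemma norm_trig_poly_le: "norm (trig_poly c S x) \<le> (\<Sum>m\<in>S. norm (c m))"
  unfolding trig_poly_def by (rule order_trans[OF norm_sum]) (simp add: norm_mult)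

lemma integral_mult_cnj_trig_poly:
  assumes [measurable]: "g \<in> borel_measurable borel" and R: "\<And>x. norm (g x) \<le> R"
  shows "integral\<^sup>L unit_measure (\<lambda>x. g x * cnj (trig_poly c S x)) = (\<Sum>m\<in>S. cnj (c m) * fourier_coeff g m)"
proof -
  have "integral\<^sup>L unit_measure (\<lambda>x. g x * cnj (trig_poly c S x)) =
      integral\<^sup>L unit_measure (\<lambda>x. \<Sum>m\<in>S. cnj (c m) * (g x * unit_char (- of_int m * x)))"
    by (intro Bochner_Integration.integral_cong)
       (auto simp: trig_poly_def cnj_unit_char sum_distrib_left mult_ac)
  also have "\<dots> = (\<Sum>m\<in>S. cnj (c m) * fourier_coeff g m)"
    unfolding fourier_coeff_def using R
    by (subst Bochner_Integration.integral_sum)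
       (auto intro!: integrable_mult_right integrable_unit_measure[where B = R] simp: norm_mult)
  finally show ?thesis .
qed

lemma fourier_coeff_trig_poly:
  assumes "finite S"
  shows "fourier_coeff (trig_poly c S) m = (if m \<in> S then c m else 0)"
proof -
  have "fourier_coeff (trig_poly c S) m = integral\<^sup>L unit_measure (\<lambda>x. \<Sum>k\<in>S. c k * unit_char (of_int (k - m) * x))"
    unfolding fourier_coeff_def
    unfolding trig_poly_def sum_distrib_right
    by (intro Bochner_Integration.integral_cong refl sum.cong)
       (simp add: mult.assoc left_diff_distrib flip: unit_char_add)
  also have "\<dots> = (\<Sum>k\<in>S. c k * integral\<^sup>L unit_measure (\<lambda>x. unit_char (of_int (k - m) * x)))"
    by (subst Bochner_Integration.integral_sum)
       (auto intro!: integrable_mult_right integrable_unit_measure[where B = 1])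
  also have "\<dots> = (\<Sum>k\<in>S. if k = m then c k else 0)"
    by (intro sum.cong) (auto simp only: integral_unit_char, auto)
  finally show ?thesis using assms by simp
qed

lemma integral_norm_trig_poly:
  assumes "finite S"
  shows "integral\<^sup>L unit_measure (\<lambda>x. (norm (trig_poly c S x))\<^sup>2) = (\<Sum>m\<in>S. (norm (c m))\<^sup>2)"
proof -
  have "complex_of_real (integral\<^sup>L unit_measure (\<lambda>x. (norm (trig_poly c S x))\<^sup>2)) =
      integral\<^sup>L unit_measure (\<lambda>x. complex_of_real ((norm (trig_poly c S x))\<^sup>2))"
    by (rule integral_complex_of_real[symmetric])
  also have "\<dots> = integral\<^sup>L unit_measure (\<lambda>x. trig_poly c S x * cnj (trig_poly c S x))"
    by (simp only: complex_norm_square)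
  also have "\<dots> = (\<Sum>m\<in>S. cnj (c m) * fourier_coeff (trig_poly c S) m)"
    by (rule integral_mult_cnj_trig_poly[OF trig_poly_borel norm_trig_poly_le])
  also have "\<dots> = (\<Sum>m\<in>S. complex_of_real ((norm (c m))\<^sup>2))"
    using assms by (intro sum.cong) (auto simp: fourier_coeff_trig_poly complex_norm_square mult.commute simp del: of_real_power)
  finally have "complex_of_real (integral\<^sup>L unit_measure (\<lambda>x. (norm (trig_poly c S x))\<^sup>2)) =
      complex_of_real (\<Sum>m\<in>S. (norm (c m))\<^sup>2)" by simp
  then show ?thesis by (simp only: of_real_eq_iff)
qed

text \<open>The square is completed in the coefficients. Taking the Fourier coefficients for
  \<open>c\<close> gives Bessel's inequality, and general \<open>c\<close> show that the Fourier
  partial sum is the best approximation over \<open>S\<close>.\<close>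

lemma integral_norm_diff_trig_poly:
  assumes [measurable]: "g \<in> borel_measurable borel" and R: "\<And>x. norm (g x) \<le> R" and S: "finite S"
  shows "integral\<^sup>L unit_measure (\<lambda>x. (norm (g x - trig_poly c S x))\<^sup>2) =
    integral\<^sup>L unit_measure (\<lambda>x. (norm (g x))\<^sup>2) - (\<Sum>m\<in>S. (norm (fourier_coeff g m))\<^sup>2)
    + (\<Sum>m\<in>S. (norm (fourier_coeff g m - c m))\<^sup>2)"
proof -
  define B where "B = (\<Sum>m\<in>S. norm (c m))"
  note P_le = norm_trig_poly_le[of c S, folded B_def]
  have R0: "0 \<le> R" using order_trans[OF norm_ge_zero R] .
  have int1: "integrable unit_measure (\<lambda>x. (norm (g x))\<^sup>2)"
    using R by (intro integrable_norm_power2_unit) auto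
  have int2: "integrable unit_measure (\<lambda>x. (norm (trig_poly c S x))\<^sup>2)"
    using P_le by (intro integrable_norm_power2_unit) auto
  have int3: "integrable unit_measure (\<lambda>x. g x * cnj (trig_poly c S x))"
    using R P_le R0 by (intro integrable_unit_measure[where B = "R * B"]) (auto simp: norm_mult intro!: mult_mono)
  define r where "r = (\<lambda>x. Re (g x * cnj (trig_poly c S x)))"
  have int4: "integrable unit_measure r"
    unfolding r_def using int3 by (rule integrable_Re)
  have nd: "(norm (z - w))\<^sup>2 = (norm z)\<^sup>2 + (norm w)\<^sup>2 - 2 * Re (z * cnj w)" for z w :: complex
    unfolding cmod_power2 by (simp add: power2_eq_square algebra_simps)
  have "integral\<^sup>L unit_measure (\<lambda>x. (norm (g x - trig_poly c S x))\<^sup>2) =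
      integral\<^sup>L unit_measure (\<lambda>x. (norm (g x))\<^sup>2 + (norm (trig_poly c S x))\<^sup>2 - 2 * r x)"
    by (simp only: nd r_def)
  also have "\<dots> = integral\<^sup>L unit_measure (\<lambda>x. (norm (g x))\<^sup>2) + integral\<^sup>L unit_measure (\<lambda>x. (norm (trig_poly c S x))\<^sup>2)
      - 2 * integral\<^sup>L unit_measure r"
    using int1 int2 int4 by simp
  also have "integral\<^sup>L unit_measure r = Re (\<Sum>m\<in>S. cnj (c m) * fourier_coeff g m)"
    unfolding r_def integral_Re[OF int3] integral_mult_cnj_trig_poly[OF assms(1) R] ..
  also have "Re (\<Sum>m\<in>S. cnj (c m) * fourier_coeff g m) = (\<Sum>m\<in>S. Re (fourier_coeff g m * cnj (c m)))"
    by (simp add: mult.commute)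
  finally show ?thesis
    using S by (simp add: integral_norm_trig_poly nd sum.distrib sum_subtractf sum_distrib_left)
qed

text \<open>Bessel's inequality bounds the sum from above. Conversely, an approximant with index set
  \<open>S\<close> is no better than the Fourier partial sum over \<open>S\<close>, so density makes
  the defect smaller than any \<open>\<epsilon>\<close>.\<close>

theorem parseval:
  assumes g: "g \<in> borel_measurable borel" and R: "\<And>x. norm (g x) \<le> R"
  shows "((\<lambda>l. (norm (fourier_coeff g l))\<^sup>2) has_sum integral\<^sup>L unit_measure (\<lambda>x. (norm (g x))\<^sup>2)) UNIV"
proof -
  define I where "I = integral\<^sup>L unit_measure (\<lambda>x. (norm (g x))\<^sup>2)"
  have le: "(\<Sum>m\<in>S. (norm (fourier_coeff g m))\<^sup>2) \<le> I" if "finite S" for S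
  proof -
    have "0 \<le> integral\<^sup>L unit_measure (\<lambda>x. (norm (g x - trig_poly (fourier_coeff g) S x))\<^sup>2)"
      by (intro integral_nonneg_AE) auto
    then show ?thesis
      using integral_norm_diff_trig_poly[OF g R that, of "fourier_coeff g"] by (simp add: I_def)
  qed
  then have summable: "(\<lambda>l. (norm (fourier_coeff g l))\<^sup>2) summable_on UNIV"
    by (intro nonneg_bdd_above_summable_on) (auto intro!: bdd_aboveI2[where M = I])
  have "infsum (\<lambda>l. (norm (fourier_coeff g l))\<^sup>2) UNIV = I"
  proof (rule antisym)
    show "infsum (\<lambda>l. (norm (fourier_coeff g l))\<^sup>2) UNIV \<le> I"
      using le by (intro infsum_le_finite_sums summable) auto
    show "I \<le> infsum (\<lambda>l. (norm (fourier_coeff g l))\<^sup>2) UNIV"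
    proof (rule field_le_epsilon)
      fix \<epsilon> :: real assume "\<epsilon> > 0"
      then obtain p where p: "p \<in> trig_polys" "integral\<^sup>L unit_measure (\<lambda>x. (norm (g x - p x))\<^sup>2) < \<epsilon>"
        using trig_polys_L2_dense[OF g R] by blast
      obtain c S where S: "finite S" "p = trig_poly c S"
        using trig_polys_imp_trig_poly[OF p(1)] by blast
      have "I - (\<Sum>m\<in>S. (norm (fourier_coeff g m))\<^sup>2) \<le> integral\<^sup>L unit_measure (\<lambda>x. (norm (g x - p x))\<^sup>2)"
        unfolding S(2) integral_norm_diff_trig_poly[OF g R S(1)] I_def by (simp add: sum_nonneg)
      moreover have "(\<Sum>m\<in>S. (norm (fourier_coeff g m))\<^sup>2) \<le> infsum (\<lambda>l. (norm (fourier_coeff g l))\<^sup>2) UNIV"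
        using S(1) by (intro finite_sum_le_infsum summable) auto
      ultimately show "I \<le> infsum (\<lambda>l. (norm (fourier_coeff g l))\<^sup>2) UNIV + \<epsilon>"
        using p(2) by linarith
    qed
  qed
  then show ?thesis
    using has_sum_infsum[OF summable] by (simp add: I_def)
qed

section \<open>Zak transforms\<close>

text \<open>Rescaling time by \<open>sqrt N\<close> turns the lattice into \<open>(1/N) \<int> \<times> \<int>\<close>; \<open>h\<close> is the rescaled window.\<close>
locale zak_window =
  fixes h :: "real \<Rightarrow> real" and K :: real and N :: nat
  assumes h_cont: "continuous_on UNIV h"
    and h_decay: "\<And>x. \<bar>h x\<bar> \<le> K * exp (- \<bar>x\<bar>)"
    and N_pos: "N \<ge> 1"
begin

definition zak :: "real \<Rightarrow> real \<Rightarrow> complex" where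
  "zak v \<xi> = (\<Sum>\<^sub>\<infinity>m::int. unit_char (of_int m * \<xi>) * of_real (h (v + of_int m)))"

text \<open>The time shifts have step \<open>1/N\<close> but the Zak transform sums over integers,
  so each class of shifts modulo 1 contributes one summand. This function will be the density that
  weights the squared Fourier data of \<open>g\<close> in \<open>fibre\<close>.\<close>

definition zak_sq :: "real \<Rightarrow> real \<Rightarrow> real" where
  "zak_sq y \<xi> = (\<Sum>j<N. (norm (zak (y + real j / real N) \<xi>))\<^sup>2)"

definition exp_sum :: real where
  "exp_sum = (\<Sum>\<^sub>\<infinity>m::int. exp (- 1 * \<bar>of_int m\<bar>))"

lemma K_nonneg: "0 \<le> K"
  using order_trans[OF abs_ge_zero h_decay[of 0]] by simp

lemma h_borel [measurable]: "h \<in> borel_measurable borel"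
  by (rule borel_measurable_continuous_onI[OF h_cont])

lemma h_le: "\<bar>h x\<bar> \<le> K"
proof -
  have "K * exp (- \<bar>x\<bar>) \<le> K * 1" using K_nonneg by (intro mult_left_mono) auto
  then show ?thesis using h_decay[of x] by simp
qed

lemma h_shift_le:
  assumes "\<bar>v\<bar> \<le> r"
  shows "\<bar>h (v + of_int m)\<bar> \<le> K * exp r * exp (- 1 * \<bar>of_int m\<bar>)"
proof -
  have "\<bar>h (v + of_int m)\<bar> \<le> K * exp (- \<bar>v + of_int m\<bar>)" by (rule h_decay)
  also have "\<dots> \<le> K * exp (r + - 1 * \<bar>of_int m\<bar>)"
    using K_nonneg assms by (intro mult_left_mono) auto
  finally show ?thesis by (simp only: exp_add mult.assoc)
qed

lemma zak_term_le:
  assumes "\<bar>v\<bar> \<le> r"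
  shows "norm (unit_char (of_int m * \<xi>) * of_real (h (v + of_int m))) \<le> K * exp r * exp (- 1 * \<bar>of_int m\<bar>)"
  using h_shift_le[OF assms] by (simp add: norm_mult)

lemma zak_bound_summable: "(\<lambda>m::int. K * exp r * exp (- 1 * \<bar>of_int m\<bar>)) summable_on UNIV"
  by (rule summable_on_cmult_right[OF summable_exp_abs_int]) simp

lemma zak_has_sum:
  "((\<lambda>m. unit_char (of_int m * \<xi>) * of_real (h (v + of_int m))) has_sum zak v \<xi>) UNIV"
proof -
  have "(\<lambda>m. norm (unit_char (of_int m * \<xi>) * complex_of_real (h (v + of_int m)))) summable_on UNIV"
    by (rule summable_on_comparison_test[OF zak_bound_summable[of "\<bar>v\<bar>"]])
       (use zak_term_le[of v "\<bar>v\<bar>"] in auto)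
  then show ?thesis
    unfolding zak_def by (rule has_sum_infsum[OF abs_summable_summable])
qed

lemma norm_zak_le:
  assumes "\<bar>v\<bar> \<le> r"
  shows "norm (zak v \<xi>) \<le> K * exp r * exp_sum"
proof -
  have "norm (zak v \<xi>) \<le> (\<Sum>\<^sub>\<infinity>m::int. K * exp r * exp (- 1 * \<bar>of_int m\<bar>))"
    unfolding zak_def using zak_term_le[OF assms] zak_bound_summable
    by (intro norm_infsum_le[OF zak_has_sum[unfolded has_sum_iff, THEN conjunct1, THEN has_sum_infsum] has_sum_infsum]) auto
  then show ?thesis by (simp add: exp_sum_def infsum_cmult_right')
qed

lemma continuous_on_zak:
  "continuous_on ({- r..r} \<times> UNIV) (\<lambda>(v, \<xi>). zak v \<xi>)"
proof (rule uniform_limit_theorem)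
  show "uniform_limit ({- r..r} \<times> UNIV) (\<lambda>X p. \<Sum>m\<in>X. unit_char (of_int m * snd p) * of_real (h (fst p + of_int m)))
      (\<lambda>(v, \<xi>). zak v \<xi>) (finite_subsets_at_top UNIV)"
    unfolding zak_def case_prod_unfold
  proof (rule Weierstrass_m_test_general[OF _ zak_bound_summable[of r]])
    fix m :: int and p :: "real \<times> real" assume "p \<in> {- r..r} \<times> UNIV"
    then have "\<bar>fst p\<bar> \<le> r" by auto
    then show "norm (unit_char (of_int m * snd p) * of_real (h (fst p + of_int m))) \<le> K * exp r * exp (- 1 * \<bar>of_int m\<bar>)"
      by (rule zak_term_le)
  qed
  have "continuous_on A (\<lambda>p. h (fst p + of_int m))" for A :: "(real \<times> real) set" and m
    by (rule continuous_on_compose2[OF h_cont]) (auto intro!: continuous_intros)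
  then show "\<forall>\<^sub>F X in finite_subsets_at_top UNIV. continuous_on ({- r..r} \<times> UNIV)
      (\<lambda>p. \<Sum>m\<in>X. unit_char (of_int m * snd p) * of_real (h (fst p + of_int m)))"
    by (intro always_eventually allI continuous_intros)
qed simp

lemma continuous_on_zak_xi: "continuous_on UNIV (zak v)"
proof -
  have "continuous_on UNIV (\<lambda>\<xi>. (\<lambda>(v, \<xi>). zak v \<xi>) (v, \<xi>))"
    by (rule continuous_on_compose2[OF continuous_on_zak[of "\<bar>v\<bar>"]]) (auto intro!: continuous_intros)
  then show ?thesis by simp
qed

lemma zak_borel [measurable]: "zak v \<in> borel_measurable borel"
  by (rule borel_measurable_continuous_onI[OF continuous_on_zak_xi])

text \<open>Every finite partial sum containing the relevant index already has this coefficient. A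
  partial sum uniformly closer than the supposed discrepancy would force the discrepancy to be
  smaller than itself.\<close>

lemma fourier_coeff_zak: "fourier_coeff (\<lambda>\<xi>. zak v (- \<xi>)) r = of_real (h (v - of_int r))"
proof (rule ccontr)
  define F where "F = (\<lambda>X \<xi>. \<Sum>m\<in>X. unit_char (of_int m * \<xi>) * complex_of_real (h (v + of_int m)))"
  define \<epsilon> where "\<epsilon> = norm (fourier_coeff (\<lambda>\<xi>. zak v (- \<xi>)) r - of_real (h (v - of_int r)))"
  assume "\<not> ?thesis"
  then have \<epsilon>: "\<epsilon> > 0" by (simp add: \<epsilon>_def)
  have "uniform_limit UNIV F (zak v) (finite_subsets_at_top UNIV)"
    unfolding F_def zak_def
    by (rule Weierstrass_m_test_general[OF zak_term_le[OF order_refl] zak_bound_summable])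
  then have "eventually (\<lambda>X. \<forall>\<xi>\<in>UNIV. dist (F X \<xi>) (zak v \<xi>) < \<epsilon>) (finite_subsets_at_top UNIV)"
    using \<epsilon> by (rule uniform_limitD)
  then obtain X0 where X0: "finite X0" "\<And>X. finite X \<Longrightarrow> X0 \<subseteq> X \<Longrightarrow> \<forall>\<xi>. dist (F X \<xi>) (zak v \<xi>) < \<epsilon>"
    unfolding eventually_finite_subsets_at_top by auto
  \<comment> \<open>The relevant index is \<open>- r\<close> because the frequency enters as
    \<open>- \<xi>\<close>.\<close>
  define X where "X = insert (- r) X0"
  have X: "finite X" "- r \<in> X" using X0(1) by (simp_all add: X_def)
  have X3: "dist (F X \<xi>) (zak v \<xi>) < \<epsilon>" for \<xi>
    using X0(2)[OF X(1)] by (simp add: X_def subset_insertI)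
  have FX: "(\<lambda>\<xi>. F X (- \<xi>)) = trig_poly (\<lambda>m. of_real (h (v - of_int m))) (uminus ` X)"
    by (auto simp: fun_eq_iff F_def trig_poly_def sum.reindex inj_on_def mult.commute)
  then have coeff: "fourier_coeff (\<lambda>\<xi>. F X (- \<xi>)) r = of_real (h (v - of_int r))"
    using X(1,2) by (auto simp: fourier_coeff_trig_poly image_iff intro: bexI[of _ "- r"])
  have [measurable]: "(\<lambda>\<xi>. F X (- \<xi>)) \<in> borel_measurable borel" unfolding FX by measurable
  have bd: "norm (zak v \<xi>) \<le> K * exp \<bar>v\<bar> * exp_sum" for \<xi> by (rule norm_zak_le) simp
  have bdF: "norm (F X \<xi>) \<le> \<epsilon> + K * exp \<bar>v\<bar> * exp_sum" for \<xi>
    using X3[of \<xi>] bd[of \<xi>] norm_triangle_sub[of "F X \<xi>" "zak v \<xi>"] by (simp add: dist_norm)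
  have int1: "integrable unit_measure (\<lambda>\<xi>. zak v (- \<xi>) * unit_char (- of_int r * \<xi>))"
    using bd by (intro integrable_unit_measure) (measurable, auto simp: norm_mult)
  have int2: "integrable unit_measure (\<lambda>\<xi>. F X (- \<xi>) * unit_char (- of_int r * \<xi>))"
    using bdF by (intro integrable_unit_measure) (measurable, auto simp: norm_mult)
  have "fourier_coeff (\<lambda>\<xi>. zak v (- \<xi>)) r - of_real (h (v - of_int r)) =
      integral\<^sup>L unit_measure (\<lambda>\<xi>. (zak v (- \<xi>) - F X (- \<xi>)) * unit_char (- of_int r * \<xi>))"
    unfolding coeff[symmetric] fourier_coeff_def using int1 int2 by (simp add: left_diff_distrib)
  also have "norm \<dots> \<le> integral\<^sup>L unit_measure (\<lambda>\<xi>. norm (zak v (- \<xi>) - F X (- \<xi>)))"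
    by (rule order_trans[OF integral_norm_bound]) (simp add: norm_mult)
  also have "\<dots> < integral\<^sup>L unit_measure (\<lambda>\<xi>. \<epsilon>)"
  proof (rule unit_measure.integral_less_AE_space)
    show "integrable unit_measure (\<lambda>\<xi>. norm (zak v (- \<xi>) - F X (- \<xi>)))"
      using X3 by (intro integrable_norm integrable_unit_measure[where B = \<epsilon>])
        (measurable, auto simp: dist_norm norm_minus_commute less_imp_le)
    show "AE x in unit_measure. norm (zak v (- x) - F X (- x)) < \<epsilon>"
      using X3 by (auto simp: dist_norm norm_minus_commute)
  qed (simp_all add: emeasure_unit_measure)
  finally show False by (simp add: \<epsilon>_def)
qed

text \<open>Multiplication by the Zak transform convolves the coefficients \<open>c\<close> with
  samples of \<open>h\<close>. The summands are therefore squared Fourier coefficients of a product,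
  and the identity is \<open>parseval\<close>.\<close>

lemma window_shifts_has_sum:
  assumes "finite S"
  shows "((\<lambda>q. (norm (\<Sum>m\<in>S. c m * of_real (h (v + of_int m - of_int q))))\<^sup>2) has_sum
     integral\<^sup>L unit_measure (\<lambda>\<xi>. (norm (trig_poly c S \<xi>))\<^sup>2 * (norm (zak v (- \<xi>)))\<^sup>2)) UNIV"
proof -
  define g where "g = (\<lambda>\<xi>. trig_poly c S \<xi> * zak v (- \<xi>))"
  have bd: "norm (zak v \<xi>) \<le> K * exp \<bar>v\<bar> * exp_sum" for \<xi> by (rule norm_zak_le) simp
  have [measurable]: "g \<in> borel_measurable borel" unfolding g_def by measurable
  have "norm (g \<xi>) \<le> (\<Sum>m\<in>S. norm (c m)) * (K * exp \<bar>v\<bar> * exp_sum)" for \<xi>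
    unfolding g_def norm_mult by (intro mult_mono norm_trig_poly_le bd sum_nonneg) auto
  then have "((\<lambda>l. (norm (fourier_coeff g l))\<^sup>2) has_sum integral\<^sup>L unit_measure (\<lambda>x. (norm (g x))\<^sup>2)) UNIV"
    by (intro parseval) auto
  moreover have "fourier_coeff g q = (\<Sum>m\<in>S. c m * of_real (h (v + of_int m - of_int q)))" for q
  proof -
    have "fourier_coeff g q = integral\<^sup>L unit_measure (\<lambda>\<xi>. \<Sum>m\<in>S. c m * (zak v (- \<xi>) * unit_char (- of_int (q - m) * \<xi>)))"
      unfolding fourier_coeff_def g_def trig_poly_def sum_distrib_right
      by (intro Bochner_Integration.integral_cong refl sum.cong)
         (simp add: left_diff_distrib unit_char_add unit_char_diff unit_char_minus field_simps)
    also have "\<dots> = (\<Sum>m\<in>S. c m * fourier_coeff (\<lambda>\<xi>. zak v (- \<xi>)) (q - m))"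
      unfolding fourier_coeff_def using bd
      by (subst Bochner_Integration.integral_sum)
         (auto intro!: integrable_mult_right integrable_unit_measure[where B = "K * exp \<bar>v\<bar> * exp_sum"] simp: norm_mult)
    finally show ?thesis by (simp add: fourier_coeff_zak algebra_simps)
  qed
  ultimately show ?thesis by (simp add: g_def norm_mult power_mult_distrib)
qed

lemma zak_sq_borel [measurable]: "zak_sq y \<in> borel_measurable borel"
  unfolding zak_sq_def[abs_def] by measurable

text \<open>The shifts by \<open>k / N\<close> are sorted into classes modulo 1 by
  \<open>k = N * q - j\<close> with \<open>j < N\<close>. Class \<open>j\<close> consists of the
  integer shifts of the window at time \<open>y + j / N\<close>, the case of
  \<open>window_shifts_has_sum\<close>.\<close>

theorem fine_window_shifts_has_sum:
  assumes "finite S"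
  shows "((\<lambda>k::int. (norm (\<Sum>m\<in>S. c m * of_real (h (y + of_int m - of_int k / real N))))\<^sup>2) has_sum
     integral\<^sup>L unit_measure (\<lambda>\<xi>. (norm (trig_poly c S \<xi>))\<^sup>2 * zak_sq y (- \<xi>))) UNIV"
proof -
  define f where "f = (\<lambda>k::int. (norm (\<Sum>m\<in>S. c m * of_real (h (y + of_int m - of_int k / real N))))\<^sup>2)"
  define G where "G = (\<lambda>j::nat. integral\<^sup>L unit_measure (\<lambda>\<xi>. (norm (trig_poly c S \<xi>))\<^sup>2 * (norm (zak (y + real j / real N) (- \<xi>)))\<^sup>2))"
  have inner: "((\<lambda>q. f (int N * q - int j)) has_sum G j) UNIV" for j
  proof -
    have "y + real j / real N + of_int m - of_int q = y + of_int m - of_int (int N * q - int j) / real N" for m q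
      using N_pos by (simp add: field_simps)
    then show ?thesis
      using window_shifts_has_sum[OF assms, of c "y + real j / real N"] by (simp only: f_def G_def)
  qed
  have "((\<lambda>(j, q). f (int N * q - int j)) has_sum (\<Sum>j<N. G j)) ({..<N} \<times> UNIV)"
  proof (rule has_sum_SigmaI)
    show "((\<lambda>q. case (j, q) of (j, q) \<Rightarrow> f (int N * q - int j)) has_sum G j) UNIV" for j
      using inner by simp
    show "(G has_sum (\<Sum>j<N. G j)) {..<N}" by (rule has_sum_finite) simp
    show "(\<lambda>(j, q). f (int N * q - int j)) summable_on {..<N} \<times> UNIV"
      by (rule summable_on_SigmaI[where g = G]) (use inner in \<open>auto simp: f_def\<close>)
  qed
  also have "?this \<longleftrightarrow> (f has_sum (\<Sum>j<N. G j)) UNIV"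
  proof (rule has_sum_reindex_bij_witness[of _ "\<lambda>k. (nat ((- k) mod int N), - ((- k) div int N))" "\<lambda>(j, q). int N * q - int j"])
    fix k :: int
    have "(- k) mod int N = - k - int N * ((- k) div int N)"
      by (simp add: minus_mult_div_eq_mod)
    moreover have "0 \<le> (- k) mod int N" "(- k) mod int N < int N" using N_pos by auto
    ultimately show "(\<lambda>(j, q). int N * q - int j) (nat ((- k) mod int N), - ((- k) div int N)) = k"
      "(nat ((- k) mod int N), - ((- k) div int N)) \<in> {..<N} \<times> UNIV"
      by (auto simp: nat_less_iff)
  next
    fix p :: "nat \<times> int" assume "p \<in> {..<N} \<times> UNIV"
    then obtain j q where p: "p = (j, q)" "j < N" by auto
    have e: "- (int N * q - int j) = int j + (- q) * int N" by (simp add: algebra_simps)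
    have "(- (int N * q - int j)) mod int N = int j"
      unfolding e mod_mult_self1 using p(2) by (simp add: mod_pos_pos_trivial)
    moreover have "(- (int N * q - int j)) div int N = - q"
      unfolding e using p(2) by (subst div_mult_self1) auto
    ultimately show "(\<lambda>k. (nat ((- k) mod int N), - ((- k) div int N))) ((\<lambda>(j, q). int N * q - int j) p) = p"
      by (simp add: p)
  qed (auto simp: case_prod_unfold)
  finally have "(f has_sum (\<Sum>j<N. G j)) UNIV" .
  moreover have "(\<Sum>j<N. G j) = integral\<^sup>L unit_measure (\<lambda>\<xi>. (norm (trig_poly c S \<xi>))\<^sup>2 * zak_sq y (- \<xi>))"
  proof -
    have int: "integrable unit_measure (\<lambda>\<xi>. (norm (trig_poly c S \<xi>))\<^sup>2 * (norm (zak v (- \<xi>)))\<^sup>2)" for v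
    proof (rule integrable_unit_measure[where B = "(\<Sum>m\<in>S. norm (c m))\<^sup>2 * (K * exp \<bar>v\<bar> * exp_sum)\<^sup>2"])
      show "norm ((norm (trig_poly c S \<xi>))\<^sup>2 * (norm (zak v (- \<xi>)))\<^sup>2) \<le> (\<Sum>m\<in>S. norm (c m))\<^sup>2 * (K * exp \<bar>v\<bar> * exp_sum)\<^sup>2" for \<xi>
        using norm_trig_poly_le[of c S \<xi>] norm_zak_le[of v "\<bar>v\<bar>" "- \<xi>"]
        by (auto simp: norm_mult intro!: mult_mono power_mono)
    qed measurable
    show ?thesis
      unfolding G_def zak_sq_def sum_distrib_left using int by (subst Bochner_Integration.integral_sum) auto
  qed
  ultimately show ?thesis by (simp add: f_def)
qed

end

section \<open>Gabor coefficients\<close>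

text \<open>Bounded support makes the periodization a finite sum, so integral and sum commute by
  linearity alone.\<close>

lemma integral_lborel_tile:
  fixes f :: "real \<Rightarrow> 'b::{banach,second_countable_topology}"
  assumes f: "integrable lborel f" and supp: "\<And>y. y \<notin> {- real M..<real M} \<Longrightarrow> f y = 0"
  shows "integral\<^sup>L lborel f = integral\<^sup>L unit_measure (\<lambda>y. \<Sum>m\<in>{- int M..<int M}. f (y + of_int m))"
    and "\<And>m. integrable unit_measure (\<lambda>y. f (y + of_int m))"
proof -
  have shift: "integrable lborel (\<lambda>y. f (y + of_int m))" for m
    using lborel_integrable_real_affine[OF f, of 1 "of_int m"] by (simp add: add.commute)
  show int: "integrable unit_measure (\<lambda>y. f (y + of_int m))" for m
    using integrable_mult_indicator[OF _ shift, of "{0..<1}"] by (simp add: integrable_restrict_space)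
  have "f y = (\<Sum>m\<in>{- int M..<int M}. indicator {of_int m..<of_int m + 1} y *\<^sub>R f y)" for y
  proof (cases "y \<in> {- real M..<real M}")
    case True
    have "\<lfloor>y\<rfloor> \<in> {- int M..<int M}" using True by (auto simp: le_floor_iff floor_less_iff)
    moreover have "indicator {of_int m..<of_int m + 1} y *\<^sub>R f y = (if m = \<lfloor>y\<rfloor> then f y else 0)" for m :: int
      by (auto simp: indicator_def) linarith+
    ultimately show ?thesis by simp
  qed (simp add: supp)
  then have "integral\<^sup>L lborel f = integral\<^sup>L lborel (\<lambda>y. \<Sum>m\<in>{- int M..<int M}. indicator {of_int m..<of_int m + 1} y *\<^sub>R f y)"
    by simp
  also have "\<dots> = (\<Sum>m\<in>{- int M..<int M}. integral\<^sup>L lborel (\<lambda>y. indicator {of_int m..<of_int m + 1} y *\<^sub>R f y))"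
    by (intro Bochner_Integration.integral_sum integrable_mult_indicator f) auto
  also have "\<dots> = (\<Sum>m\<in>{- int M..<int M}. integral\<^sup>L unit_measure (\<lambda>y. f (y + of_int m)))"
  proof (rule sum.cong)
    fix m :: int
    have "integral\<^sup>L lborel (\<lambda>y. indicator {of_int m..<of_int m + 1} y *\<^sub>R f y) =
       integral\<^sup>L lborel (\<lambda>y. indicator {of_int m..<of_int m + 1} (of_int m + y) *\<^sub>R f (of_int m + y))"
      by (subst lborel_integral_real_affine[of 1 _ "of_int m"]) auto
    also have "\<dots> = integral\<^sup>L lborel (\<lambda>y. indicator {0..<1} y *\<^sub>R f (y + of_int m))"
      by (intro Bochner_Integration.integral_cong) (auto simp: indicator_def add.commute)
    also have "\<dots> = integral\<^sup>L unit_measure (\<lambda>y. f (y + of_int m))"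
      by (rule integral_restrict_space[symmetric]) auto
    finally show "integral\<^sup>L lborel (\<lambda>y. indicator {of_int m..<of_int m + 1} y *\<^sub>R f y) = integral\<^sup>L unit_measure (\<lambda>y. f (y + of_int m))" .
  qed simp
  also have "\<dots> = integral\<^sup>L unit_measure (\<lambda>y. \<Sum>m\<in>{- int M..<int M}. f (y + of_int m))"
    using int by (simp add: Bochner_Integration.integral_sum)
  finally show "integral\<^sup>L lborel f = integral\<^sup>L unit_measure (\<lambda>y. \<Sum>m\<in>{- int M..<int M}. f (y + of_int m))" .
qed

section \<open>Sums over the integers as limits over symmetric intervals\<close>

lemma finite_int_subset_interval:
  assumes "finite X"
  obtains n where "X \<subseteq> {- int n..int n}"
proof
  show "X \<subseteq> {- int (nat (Max (insert 0 (abs ` X))))..int (nat (Max (insert 0 (abs ` X))))}"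
  proof
    fix x assume "x \<in> X"
    then have "\<bar>x\<bar> \<le> Max (insert 0 (abs ` X))" using assms by (intro Max_ge) auto
    then show "x \<in> {- int (nat (Max (insert 0 (abs ` X))))..int (nat (Max (insert 0 (abs ` X))))}" by auto
  qed
qed

text \<open>Dominated convergence is about sequences, whereas sums over \<open>int\<close> are
  limits along finite subsets. The symmetric intervals form a cofinal sequence; for nonnegative
  terms the next lemma leads back.\<close>

lemma has_sum_int_imp_tendsto:
  fixes f :: "int \<Rightarrow> 'b::{comm_monoid_add,topological_space}"
  assumes "(f has_sum s) UNIV"
  shows "(\<lambda>n. \<Sum>k\<in>{- int n..int n}. f k) \<longlonglongrightarrow> s"
proof -
  have "filterlim (\<lambda>n. {- int n..int n}) (finite_subsets_at_top UNIV) sequentially"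
    unfolding filterlim_def le_filter_def eventually_filtermap
  proof (intro allI impI)
    fix P :: "int set \<Rightarrow> bool" assume "eventually P (finite_subsets_at_top UNIV)"
    then obtain X where X: "finite X" "\<And>Y. finite Y \<Longrightarrow> X \<subseteq> Y \<Longrightarrow> P Y"
      unfolding eventually_finite_subsets_at_top by auto
    obtain n0 where "X \<subseteq> {- int n0..int n0}" using finite_int_subset_interval[OF X(1)] .
    then have "X \<subseteq> {- int n..int n}" if "n \<ge> n0" for n
      using that by fastforce
    then show "eventually (\<lambda>n. P {- int n..int n}) sequentially"
      by (intro eventually_sequentiallyI[of n0] X(2)) auto
  qed
  then show ?thesis
    using assms filterlim_compose unfolding has_sum_def by blast
qed

lemma nonneg_tendsto_imp_has_sum_int:
  fixes f :: "int \<Rightarrow> real"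
  assumes nonneg: "\<And>k. 0 \<le> f k" and lim: "(\<lambda>n. \<Sum>k\<in>{- int n..int n}. f k) \<longlonglongrightarrow> s"
  shows "(f has_sum s) UNIV"
proof -
  have mono: "incseq (\<lambda>n. \<Sum>k\<in>{- int n..int n}. f k)"
    by (intro incseq_SucI sum_mono2) (auto intro: nonneg)
  have "(\<Sum>k\<in>X. f k) \<le> s" if X: "finite X" for X
  proof -
    obtain n where "X \<subseteq> {- int n..int n}" using finite_int_subset_interval[OF X] .
    then have "(\<Sum>k\<in>X. f k) \<le> (\<Sum>k\<in>{- int n..int n}. f k)"
      by (intro sum_mono2) (auto intro: nonneg)
    also have "\<dots> \<le> s" by (rule incseq_le[OF mono lim])
    finally show ?thesis .
  qed
  then have "f summable_on UNIV"
    by (intro nonneg_bdd_above_summable_on) (auto intro!: bdd_aboveI2[where M = s] nonneg)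
  then have hs: "(f has_sum infsum f UNIV) UNIV" by (rule has_sum_infsum)
  then have "infsum f UNIV = s"
    using has_sum_int_imp_tendsto lim LIMSEQ_unique by blast
  with hs show ?thesis by simp
qed

lemma integrable_exp_minus_abs: "integrable lborel (\<lambda>x::real. exp (- \<bar>x\<bar>))"
proof -
  have half: "(\<integral>\<^sup>+x. ennreal (exp (- x)) * indicator {0..} x \<partial>lborel) = ennreal (0 - - exp (- 0))"
  proof (rule nn_integral_FTC_atLeast)
    show "((\<lambda>x. - exp (- x)) \<longlongrightarrow> 0) (at_top :: real filter)"
      using tendsto_minus[OF filterlim_compose[OF exp_at_bot filterlim_uminus_at_bot_at_top]] by simp
  qed (auto intro!: derivative_eq_intros)
  have "integrable lborel (\<lambda>x::real. exp (- x) * indicator {0..} x)"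
  proof (rule integrableI_nonneg)
    have "(\<integral>\<^sup>+x. ennreal (exp (- x) * indicator {0..} x) \<partial>lborel) = (\<integral>\<^sup>+x. ennreal (exp (- x)) * indicator {0..} x \<partial>lborel)"
      by (intro nn_integral_cong) (auto simp: indicator_def)
    then show "(\<integral>\<^sup>+x. ennreal (exp (- x) * indicator {0..} x) \<partial>lborel) < \<infinity>"
      by (simp add: half)
  qed auto
  note int = this
  have "integrable lborel (\<lambda>x::real. exp (- (0 + (- 1) * x)) * indicator {0..} (0 + (- 1) * x))"
    by (rule lborel_integrable_real_affine[OF int]) simp
  then have "integrable lborel (\<lambda>x::real. exp (- x) * indicator {0..} x + exp (- (0 + (- 1) * x)) * indicator {0..} (0 + (- 1) * x))"
    using int by (rule Bochner_Integration.integrable_add[rotated])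
  then show ?thesis
    by (rule Bochner_Integration.integrable_bound) (auto simp: indicator_def)
qed

context zak_window
begin

definition gabor_coeff :: "(real \<Rightarrow> complex) \<Rightarrow> int \<Rightarrow> int \<Rightarrow> complex" where
  "gabor_coeff g k l = (LINT y|lborel. g y * of_real (h (y - of_int k / real N)) * unit_char (- of_int l * y))"

text \<open>The contribution of the times in \<open>y + \<int>\<close> to the sum of all squared
  Gabor coefficients, for \<open>g\<close> supported in \<open>[-M, M)\<close>. The minus sign
  before \<open>\<xi>\<close> goes back to \<open>fourier_coeff_zak\<close>.\<close>

definition fibre :: "(real \<Rightarrow> complex) \<Rightarrow> nat \<Rightarrow> real \<Rightarrow> real" where
  "fibre g M y = integral\<^sup>L unit_measure
     (\<lambda>\<xi>. (norm (trig_poly (\<lambda>m. g (y + of_int m)) {- int M..<int M} \<xi>))\<^sup>2 * zak_sq y (- \<xi>))"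

definition zak_bound :: real where
  "zak_bound = real N * (K * exp 2 * exp_sum)\<^sup>2"

lemma zak_sq_nonneg: "0 \<le> zak_sq y \<xi>"
  by (simp add: zak_sq_def sum_nonneg)

lemma zak_sq_le:
  assumes "y \<in> {0..<1}"
  shows "zak_sq y \<xi> \<le> zak_bound"
proof -
  have "(norm (zak (y + real j / real N) \<xi>))\<^sup>2 \<le> (K * exp 2 * exp_sum)\<^sup>2" if "j < N" for j
  proof (intro power_mono norm_zak_le)
    have "real j / real N \<le> 1" using that by simp
    moreover have "0 \<le> real j / real N" by simp
    ultimately show "\<bar>y + real j / real N\<bar> \<le> 2" using assms by auto
  qed simp
  then have "zak_sq y \<xi> \<le> (\<Sum>j<N. (K * exp 2 * exp_sum)\<^sup>2)"
    unfolding zak_sq_def by (intro sum_mono) auto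
  then show ?thesis by (simp add: zak_bound_def)
qed

lemma zak_bound_nonneg: "0 \<le> zak_bound"
  by (simp add: zak_bound_def)

lemma integrable_trig_poly_zak_sq:
  assumes "y \<in> {0..<1}" and [measurable]: "p \<in> borel_measurable borel" and B: "\<And>\<xi>. norm (p \<xi>) \<le> B"
  shows "integrable unit_measure (\<lambda>\<xi>. (norm (p \<xi> :: complex))\<^sup>2 * zak_sq y (- \<xi>))"
proof (rule integrable_unit_measure[where B = "B\<^sup>2 * zak_bound"])
  show "norm ((norm (p \<xi>))\<^sup>2 * zak_sq y (- \<xi>)) \<le> B\<^sup>2 * zak_bound" for \<xi>
    using B zak_sq_le[OF assms(1)] by (auto simp: abs_mult zak_sq_nonneg intro!: mult_mono power_mono)
qed measurable

lemma fibre_bounds: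
  assumes y: "y \<in> {0..<1}" and A: "\<And>\<xi>. A \<le> zak_sq y \<xi>"
  shows "A * (\<Sum>m\<in>{- int M..<int M}. (norm (g (y + of_int m)))\<^sup>2) \<le> fibre g M y"
    and "fibre g M y \<le> zak_bound * (\<Sum>m\<in>{- int M..<int M}. (norm (g (y + of_int m)))\<^sup>2)"
proof -
  define p where "p = trig_poly (\<lambda>m. g (y + of_int m)) {- int M..<int M}"
  define B where "B = (\<Sum>m\<in>{- int M..<int M}. norm (g (y + of_int m)))"
  have pB: "norm (p \<xi>) \<le> B" for \<xi> unfolding p_def B_def by (rule norm_trig_poly_le)
  have [measurable]: "p \<in> borel_measurable borel" unfolding p_def by measurable
  have int: "integrable unit_measure (\<lambda>\<xi>. (norm (p \<xi>))\<^sup>2 * zak_sq y (- \<xi>))"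
    by (rule integrable_trig_poly_zak_sq[OF y]) (use pB in auto)
  have int': "integrable unit_measure (\<lambda>\<xi>. C * (norm (p \<xi>))\<^sup>2)" for C
    by (intro integrable_mult_right integrable_norm_power2_unit[where B = B]) (use pB in auto)
  have eq: "integral\<^sup>L unit_measure (\<lambda>\<xi>. (norm (p \<xi>))\<^sup>2) = (\<Sum>m\<in>{- int M..<int M}. (norm (g (y + of_int m)))\<^sup>2)"
    unfolding p_def by (rule integral_norm_trig_poly) simp
  have "integral\<^sup>L unit_measure (\<lambda>\<xi>. A * (norm (p \<xi>))\<^sup>2) \<le> fibre g M y"
    unfolding fibre_def p_def[symmetric]
    by (rule integral_mono[OF int' int]) (simp add: mult.commute[of A] A mult_left_mono)
  then show "A * (\<Sum>m\<in>{- int M..<int M}. (norm (g (y + of_int m)))\<^sup>2) \<le> fibre g M y"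
    by (simp add: eq)
  have "fibre g M y \<le> integral\<^sup>L unit_measure (\<lambda>\<xi>. zak_bound * (norm (p \<xi>))\<^sup>2)"
    unfolding fibre_def p_def[symmetric]
    by (rule integral_mono[OF int int']) (simp add: mult.commute[of zak_bound] zak_sq_le[OF y] mult_left_mono)
  then show "fibre g M y \<le> zak_bound * (\<Sum>m\<in>{- int M..<int M}. (norm (g (y + of_int m)))\<^sup>2)"
    by (simp add: eq)
qed

section \<open>Bounded functions with bounded support\<close>

context
  fixes g :: "real \<Rightarrow> complex" and R :: real and M :: nat
  assumes g_borel [measurable]: "g \<in> borel_measurable borel"
    and g_le: "\<And>y. norm (g y) \<le> R"
    and g_supp: "\<And>y. y \<notin> {- real M..<real M} \<Longrightarrow> g y = 0"
begin

lemma integrable_bounded_support: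
  fixes f :: "real \<Rightarrow> 'b::{banach,second_countable_topology}"
  assumes "f \<in> borel_measurable borel" "\<And>y. norm (f y) \<le> B" "\<And>y. g y = 0 \<Longrightarrow> f y = 0"
  shows "integrable lborel f"
  using assms g_supp by (intro integrableI_bounded_set[where A = "{- real M..<real M}" and B = B]) auto

lemma R_nonneg: "0 \<le> R"
  using order_trans[OF norm_ge_zero g_le] .

lemma integral_norm_eq_tile:
  "(LINT y|lborel. (norm (g y))\<^sup>2) =
     integral\<^sup>L unit_measure (\<lambda>y. \<Sum>m\<in>{- int M..<int M}. (norm (g (y + of_int m)))\<^sup>2)"
  "integrable unit_measure (\<lambda>y. \<Sum>m\<in>{- int M..<int M}. (norm (g (y + of_int m)))\<^sup>2)"
proof -
  have 1: "integrable lborel (\<lambda>y. (norm (g y))\<^sup>2)"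
    by (rule integrable_bounded_support[where B = "R\<^sup>2"]) (auto intro!: power_mono g_le)
  have 2: "\<And>y. y \<notin> {- real M..<real M} \<Longrightarrow> (norm (g y))\<^sup>2 = 0" using g_supp by auto
  show "(LINT y|lborel. (norm (g y))\<^sup>2) =
     integral\<^sup>L unit_measure (\<lambda>y. \<Sum>m\<in>{- int M..<int M}. (norm (g (y + of_int m)))\<^sup>2)"
    by (rule integral_lborel_tile(1)[OF 1 2])
  show "integrable unit_measure (\<lambda>y. \<Sum>m\<in>{- int M..<int M}. (norm (g (y + of_int m)))\<^sup>2)"
    by (intro Bochner_Integration.integrable_sum integral_lborel_tile(2)[OF 1 2])
qed

definition slice :: "int \<Rightarrow> real \<Rightarrow> complex" where
  "slice k y = (\<Sum>m\<in>{- int M..<int M}. g (y + of_int m) * of_real (h (y + of_int m - of_int k / real N)))"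

lemma slice_borel [measurable]: "slice k \<in> borel_measurable borel"
  unfolding slice_def[abs_def] by measurable

lemma norm_slice_le: "norm (slice k y) \<le> real (2 * M) * (R * K)"
proof -
  have "norm (slice k y) \<le> (\<Sum>m\<in>{- int M..<int M}. R * K)"
    unfolding slice_def using g_le h_le R_nonneg
    by (intro sum_norm_le) (auto simp: norm_mult intro!: mult_mono)
  then show ?thesis by simp
qed

text \<open>Modulations by integers have period 1, so the integral over the line folds into a
  Fourier coefficient of the periodized product \<open>slice k\<close>.\<close>

lemma gabor_coeff_eq_fourier_coeff: "gabor_coeff g k l = fourier_coeff (slice k) l"
proof -
  define f where "f = (\<lambda>y. g y * of_real (h (y - of_int k / real N)) * unit_char (- of_int l * y))"
  have [measurable]: "f \<in> borel_measurable borel" unfolding f_def by measurable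
  have "integrable lborel f"
    by (rule integrable_bounded_support[where B = "R * K"])
       (use g_le h_le R_nonneg in \<open>auto simp: f_def norm_mult intro!: mult_mono\<close>)
  then have "gabor_coeff g k l = integral\<^sup>L unit_measure (\<lambda>y. \<Sum>m\<in>{- int M..<int M}. f (y + of_int m))"
    unfolding gabor_coeff_def f_def[symmetric] using g_supp by (intro integral_lborel_tile) (auto simp: f_def)
  also have "\<dots> = fourier_coeff (slice k) l"
    unfolding fourier_coeff_def slice_def sum_distrib_right
  proof (intro Bochner_Integration.integral_cong refl sum.cong)
    fix y :: real and m :: int
    have "unit_char (- of_int l * (y + of_int m)) = unit_char (- of_int l * y) * unit_char (of_int (- l * m))"
      by (simp only: unit_char_add[symmetric] of_int_mult of_int_minus distrib_left)
    also have "\<dots> = unit_char (- of_int l * y)" by (simp only: unit_char_of_int mult_1_right)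
    finally show "f (y + of_int m) = g (y + of_int m) * of_real (h (y + of_int m - of_int k / real N)) * unit_char (- of_int l * y)"
      by (simp only: f_def)
  qed
  finally show ?thesis .
qed

lemma slice_has_sum: "((\<lambda>k. (norm (slice k y))\<^sup>2) has_sum fibre g M y) UNIV"
  unfolding slice_def fibre_def by (rule fine_window_shifts_has_sum) simp

text \<open>Parseval in the time variable sums over \<open>l\<close> for fixed \<open>k\<close>;
  summing over \<open>k\<close> under the integral gives \<open>fibre\<close> pointwise. The partial
  sums over \<open>k\<close> are bounded by the constant \<open>C\<close>, so dominated convergence
  exchanges that sum with the integral.\<close>

lemma gabor_coeff_has_sum:
  "((\<lambda>(k, l). (norm (gabor_coeff g k l))\<^sup>2) has_sum integral\<^sup>L unit_measure (fibre g M)) (UNIV \<times> UNIV)"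
  and integrable_fibre: "integrable unit_measure (fibre g M)"
proof -
  define s where "s = (\<lambda>k. integral\<^sup>L unit_measure (\<lambda>y. (norm (slice k y))\<^sup>2))"
  have inner: "((\<lambda>l. (norm (gabor_coeff g k l))\<^sup>2) has_sum s k) UNIV" for k
    unfolding gabor_coeff_eq_fourier_coeff s_def by (rule parseval[OF slice_borel norm_slice_le])
  have s_nonneg: "0 \<le> s k" for k using has_sum_nonneg[OF inner] by simp
  define C where "C = zak_bound * (real (2 * M) * R\<^sup>2)"
  have fibre_le: "fibre g M y \<le> C" if y: "y \<in> {0..<1}" for y
  proof -
    have "fibre g M y \<le> zak_bound * (\<Sum>m\<in>{- int M..<int M}. (norm (g (y + of_int m)))\<^sup>2)"
      by (rule fibre_bounds(2)[OF y zak_sq_nonneg])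
    also have "(\<Sum>m\<in>{- int M..<int M}. (norm (g (y + of_int m)))\<^sup>2) \<le> (\<Sum>m\<in>{- int M..<int M}. R\<^sup>2)"
      using g_le by (intro sum_mono power_mono) auto
    then have "zak_bound * (\<Sum>m\<in>{- int M..<int M}. (norm (g (y + of_int m)))\<^sup>2) \<le> C"
      unfolding C_def using zak_bound_nonneg by (intro mult_left_mono) auto
    finally show ?thesis .
  qed
  have lim: "(\<lambda>n. \<Sum>k\<in>{- int n..int n}. (norm (slice k y))\<^sup>2) \<longlonglongrightarrow> fibre g M y" for y
    by (rule has_sum_int_imp_tendsto[OF slice_has_sum])
  have part_le: "(\<Sum>k\<in>{- int n..int n}. (norm (slice k y))\<^sup>2) \<le> fibre g M y" for n y
    using slice_has_sum by (rule finite_sum_le_has_sum) auto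
  have meas: "(\<lambda>y. \<Sum>k\<in>{- int n..int n}. (norm (slice k y))\<^sup>2) \<in> borel_measurable unit_measure" for n
    by (intro measurable_restrict_space1) measurable
  have bound: "AE y in unit_measure. norm (\<Sum>k\<in>{- int n..int n}. (norm (slice k y))\<^sup>2) \<le> C" for n
    using order_trans[OF part_le fibre_le] by (intro AE_I2) (simp add: sum_nonneg)
  have fibre_meas: "fibre g M \<in> borel_measurable unit_measure"
    by (rule borel_measurable_LIMSEQ_real[OF lim meas])
  show "integrable unit_measure (fibre g M)"
    by (rule integrable_dominated_convergence[where w = "\<lambda>_. C" and s = "\<lambda>n y. \<Sum>k\<in>{- int n..int n}. (norm (slice k y))\<^sup>2"])
       (use lim bound fibre_meas meas in auto)
  have "(\<lambda>n. integral\<^sup>L unit_measure (\<lambda>y. \<Sum>k\<in>{- int n..int n}. (norm (slice k y))\<^sup>2)) \<longlonglongrightarrow> integral\<^sup>L unit_measure (fibre g M)"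
    by (rule integral_dominated_convergence[where w = "\<lambda>_. C" and s = "\<lambda>n y. \<Sum>k\<in>{- int n..int n}. (norm (slice k y))\<^sup>2"])
       (use lim bound fibre_meas meas in auto)
  moreover have "integral\<^sup>L unit_measure (\<lambda>y. \<Sum>k\<in>{- int n..int n}. (norm (slice k y))\<^sup>2) = (\<Sum>k\<in>{- int n..int n}. s k)" for n
    unfolding s_def
    by (intro Bochner_Integration.integral_sum integrable_norm_power2_unit[OF slice_borel norm_slice_le])
  ultimately have S: "(s has_sum integral\<^sup>L unit_measure (fibre g M)) UNIV"
    by (intro nonneg_tendsto_imp_has_sum_int s_nonneg) simp
  show "((\<lambda>(k, l). (norm (gabor_coeff g k l))\<^sup>2) has_sum integral\<^sup>L unit_measure (fibre g M)) (UNIV \<times> UNIV)"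
  proof (rule has_sum_SigmaI[OF _ S])
    show "((\<lambda>l. case (k, l) of (k, l) \<Rightarrow> (norm (gabor_coeff g k l))\<^sup>2) has_sum s k) UNIV" for k
      using inner by simp
    show "(\<lambda>(k, l). (norm (gabor_coeff g k l))\<^sup>2) summable_on UNIV \<times> UNIV"
      by (rule summable_on_SigmaI[where g = s]) (use inner has_sum_imp_summable[OF S] in auto)
  qed
qed

end

end

section \<open>Frame bounds\<close>

lemma L2_iff: "f \<in> L2 \<longleftrightarrow> f \<in> borel_measurable borel \<and> integrable lborel (\<lambda>t. (cmod (f t))\<^sup>2)"
  by (simp add: L2_def)

text \<open>Both the support and the range are cut off, as the folding argument needs both bounds;
  the result is dominated by \<open>g\<close> and converges to it pointwise.\<close>

definition trunc :: "nat \<Rightarrow> (real \<Rightarrow> complex) \<Rightarrow> real \<Rightarrow> complex" where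
  "trunc n g y = (if y \<in> {- real n..<real n} \<and> norm (g y) \<le> real n then g y else 0)"

lemma trunc_borel [measurable]:
  assumes [measurable]: "g \<in> borel_measurable borel"
  shows "trunc n g \<in> borel_measurable borel"
  unfolding trunc_def[abs_def] by measurable

lemma norm_trunc_le: "norm (trunc n g y) \<le> real n" "norm (trunc n g y) \<le> norm (g y)"
  "norm (trunc n g y - g y) \<le> norm (g y)"
  by (auto simp: trunc_def)

lemma trunc_supp: "y \<notin> {- real n..<real n} \<Longrightarrow> trunc n g y = 0"
  by (auto simp: trunc_def)

lemma trunc_tendsto: "(\<lambda>n. trunc n g y) \<longlonglongrightarrow> g y"
proof -
  define n0 where "n0 = nat \<lceil>max (\<bar>y\<bar> + 1) (norm (g y))\<rceil>"
  have "trunc n g y = g y" if "n \<ge> n0" for n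
  proof -
    have "max (\<bar>y\<bar> + 1) (norm (g y)) \<le> real n0"
      unfolding n0_def by (rule real_nat_ceiling_ge)
    also have "\<dots> \<le> real n" using that by simp
    finally have "\<bar>y\<bar> + 1 \<le> real n" "norm (g y) \<le> real n" by auto
    then show ?thesis by (auto simp: trunc_def)
  qed
  then show ?thesis by (intro tendsto_eventually eventually_sequentiallyI[of n0])
qed

lemma integral_norm_trunc_tendsto:
  assumes "g \<in> L2"
  shows "(\<lambda>n. LINT y|lborel. (norm (trunc n g y))\<^sup>2) \<longlonglongrightarrow> (LINT y|lborel. (norm (g y))\<^sup>2)"
    and "(\<lambda>n. LINT y|lborel. (norm (trunc n g y - g y))\<^sup>2) \<longlonglongrightarrow> 0"
    and "\<And>n. (LINT y|lborel. (norm (trunc n g y))\<^sup>2) \<le> (LINT y|lborel. (norm (g y))\<^sup>2)"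
    and "\<And>n. (\<lambda>y. trunc n g y - g y) \<in> L2"
proof -
  have g[measurable]: "g \<in> borel_measurable borel" and int: "integrable lborel (\<lambda>t. (norm (g t))\<^sup>2)"
    using assms by (auto simp: L2_iff)
  show "(\<lambda>n. LINT y|lborel. (norm (trunc n g y))\<^sup>2) \<longlonglongrightarrow> (LINT y|lborel. (norm (g y))\<^sup>2)"
  proof (rule integral_dominated_convergence[OF _ _ int])
    show "AE y in lborel. (\<lambda>n. (norm (trunc n g y))\<^sup>2) \<longlonglongrightarrow> (norm (g y))\<^sup>2"
      by (intro AE_I2 tendsto_intros trunc_tendsto)
    show "AE y in lborel. norm ((norm (trunc n g y))\<^sup>2) \<le> (norm (g y))\<^sup>2" for n
      by (intro AE_I2) (simp add: norm_trunc_le power_mono)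
  qed measurable
  have "(\<lambda>n. LINT y|lborel. (norm (trunc n g y - g y))\<^sup>2) \<longlonglongrightarrow> (LINT y|lborel. (norm (g y - g y))\<^sup>2)"
  proof (rule integral_dominated_convergence[OF _ _ int])
    show "AE y in lborel. (\<lambda>n. (norm (trunc n g y - g y))\<^sup>2) \<longlonglongrightarrow> (norm (g y - g y))\<^sup>2"
      by (intro AE_I2 tendsto_intros trunc_tendsto)
    show "AE y in lborel. norm ((norm (trunc n g y - g y))\<^sup>2) \<le> (norm (g y))\<^sup>2" for n
      by (intro AE_I2) (simp add: norm_trunc_le power_mono)
  qed measurable
  then show "(\<lambda>n. LINT y|lborel. (norm (trunc n g y - g y))\<^sup>2) \<longlonglongrightarrow> 0" by simp
  show "(LINT y|lborel. (norm (trunc n g y))\<^sup>2) \<le> (LINT y|lborel. (norm (g y))\<^sup>2)" for n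
  proof (rule integral_mono[OF _ int])
    show "integrable lborel (\<lambda>y. (norm (trunc n g y))\<^sup>2)"
      by (rule Bochner_Integration.integrable_bound[OF int]) (measurable, auto simp: norm_trunc_le power_mono)
  qed (simp add: norm_trunc_le power_mono)
  show "(\<lambda>y. trunc n g y - g y) \<in> L2" for n
    unfolding L2_iff
  proof
    show "integrable lborel (\<lambda>y. (norm (trunc n g y - g y))\<^sup>2)"
      by (rule Bochner_Integration.integrable_bound[OF int]) (measurable, auto simp: norm_trunc_le power_mono)
  qed measurable
qed

context zak_window
begin

lemma integrable_h_square: "integrable lborel (\<lambda>y. (h (y - c))\<^sup>2)"
proof -
  have "integrable lborel (\<lambda>y. exp (- \<bar>- c + 1 * y\<bar>))"
    by (rule lborel_integrable_real_affine[OF integrable_exp_minus_abs]) simp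
  then have "integrable lborel (\<lambda>y. K * (K * exp (- \<bar>- c + 1 * y\<bar>)))"
    by (intro integrable_mult_right)
  then show ?thesis
  proof (rule Bochner_Integration.integrable_bound)
    show "AE y in lborel. norm ((h (y - c))\<^sup>2) \<le> norm (K * (K * exp (- \<bar>- c + 1 * y\<bar>)))"
    proof (rule AE_I2)
      fix y
      have "norm ((h (y - c))\<^sup>2) = \<bar>h (y - c)\<bar> * \<bar>h (y - c)\<bar>" by (simp add: power2_eq_square abs_mult)
      also have "\<dots> \<le> K * (K * exp (- \<bar>y - c\<bar>))"
        using h_le h_decay K_nonneg by (intro mult_mono) auto
      finally show "norm ((h (y - c))\<^sup>2) \<le> norm (K * (K * exp (- \<bar>- c + 1 * y\<bar>)))"
        using K_nonneg by (simp add: abs_mult)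
    qed
  qed measurable
qed

text \<open>The inequality \<open>a * b \<le> a^2 + b^2\<close> gives an integrable majorant that
  serves all truncations of \<open>g\<close> at once.\<close>

lemma gabor_coeff_dominated:
  assumes "g \<in> L2"
  shows "integrable lborel (\<lambda>y. (norm (g y))\<^sup>2 + (h (y - c))\<^sup>2)"
    and "norm z \<le> norm (g y) \<Longrightarrow> norm (z * of_real (h (y - c)) * unit_char x) \<le> (norm (g y))\<^sup>2 + (h (y - c))\<^sup>2"
proof -
  show "integrable lborel (\<lambda>y. (norm (g y))\<^sup>2 + (h (y - c))\<^sup>2)"
    using assms by (intro Bochner_Integration.integrable_add integrable_h_square) (simp add: L2_iff)
  assume "norm z \<le> norm (g y)"
  then have "norm (z * of_real (h (y - c)) * unit_char x) \<le> norm (g y) * \<bar>h (y - c)\<bar>"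
    by (simp add: norm_mult mult_right_mono)
  also have "\<dots> \<le> (norm (g y))\<^sup>2 + (h (y - c))\<^sup>2"
  proof -
    have "0 \<le> (norm (g y) - \<bar>h (y - c)\<bar>)\<^sup>2 + (norm (g y) * norm (g y) + h (y - c) * h (y - c))"
      by (intro add_nonneg_nonneg) auto
    then have "2 * (norm (g y) * \<bar>h (y - c)\<bar>) \<le> 2 * ((norm (g y))\<^sup>2 + (h (y - c))\<^sup>2)"
      by (simp add: power2_eq_square algebra_simps)
    then show ?thesis by simp
  qed
  finally show "norm (z * of_real (h (y - c)) * unit_char x) \<le> (norm (g y))\<^sup>2 + (h (y - c))\<^sup>2" .
qed

lemma gabor_coeff_integrable:
  assumes "g \<in> L2"
  shows "integrable lborel (\<lambda>y. g y * of_real (h (y - c)) * unit_char (x * y))"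
proof (rule Bochner_Integration.integrable_bound[OF gabor_coeff_dominated(1)[OF assms, of c]])
  have [measurable]: "g \<in> borel_measurable borel" using assms by (simp add: L2_iff)
  show "(\<lambda>y. g y * of_real (h (y - c)) * unit_char (x * y)) \<in> borel_measurable lborel" by measurable
  show "AE y in lborel. norm (g y * of_real (h (y - c)) * unit_char (x * y)) \<le> norm ((norm (g y))\<^sup>2 + (h (y - c))\<^sup>2)"
    using gabor_coeff_dominated(2)[OF assms] by (intro AE_I2) simp
qed

lemma gabor_coeff_trunc_tendsto:
  assumes "g \<in> L2"
  shows "(\<lambda>n. gabor_coeff (trunc n g) k l) \<longlonglongrightarrow> gabor_coeff g k l"
  unfolding gabor_coeff_def
proof (rule integral_dominated_convergence[OF _ _ gabor_coeff_dominated(1)[OF assms, of "of_int k / real N"]])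
  have [measurable]: "g \<in> borel_measurable borel" using assms by (simp add: L2_iff)
  show "(\<lambda>y. g y * of_real (h (y - of_int k / real N)) * unit_char (- of_int l * y)) \<in> borel_measurable lborel"
    by measurable
  show "(\<lambda>y. trunc n g y * of_real (h (y - of_int k / real N)) * unit_char (- of_int l * y)) \<in> borel_measurable lborel" for n
    by measurable
  show "AE y in lborel. (\<lambda>n. trunc n g y * of_real (h (y - of_int k / real N)) * unit_char (- of_int l * y)) \<longlonglongrightarrow>
      g y * of_real (h (y - of_int k / real N)) * unit_char (- of_int l * y)"
    by (intro AE_I2 tendsto_intros trunc_tendsto)
  show "AE y in lborel. norm (trunc n g y * of_real (h (y - of_int k / real N)) * unit_char (- of_int l * y)) \<le>
      (norm (g y))\<^sup>2 + (h (y - of_int k / real N))\<^sup>2" for n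
    by (intro AE_I2 gabor_coeff_dominated(2)[OF assms] norm_trunc_le)
qed

lemma gabor_coeff_add:
  assumes "f \<in> L2" "g \<in> L2"
  shows "gabor_coeff (\<lambda>y. f y + g y) k l = gabor_coeff f k l + gabor_coeff g k l"
  unfolding gabor_coeff_def distrib_right
  using assms by (intro Bochner_Integration.integral_add gabor_coeff_integrable)

lemma integral_fibre_bounds:
  assumes g: "g \<in> borel_measurable borel" "\<And>y. norm (g y) \<le> R" "\<And>y. y \<notin> {- real M..<real M} \<Longrightarrow> g y = 0"
    and A: "\<And>y \<xi>. y \<in> {0..<1} \<Longrightarrow> A \<le> zak_sq y \<xi>"
  shows "A * (LINT y|lborel. (norm (g y))\<^sup>2) \<le> integral\<^sup>L unit_measure (fibre g M)"
    and "integral\<^sup>L unit_measure (fibre g M) \<le> zak_bound * (LINT y|lborel. (norm (g y))\<^sup>2)"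
proof -
  note tile = integral_norm_eq_tile[OF g]
  have "integral\<^sup>L unit_measure (\<lambda>y. A * (\<Sum>m\<in>{- int M..<int M}. (norm (g (y + of_int m)))\<^sup>2)) \<le> integral\<^sup>L unit_measure (fibre g M)"
  proof (rule integral_mono[OF integrable_mult_right[OF tile(2)] integrable_fibre[OF g]])
    fix y assume "y \<in> space unit_measure"
    then have y: "y \<in> {0..<1}" by simp
    show "A * (\<Sum>m\<in>{- int M..<int M}. (norm (g (y + of_int m)))\<^sup>2) \<le> fibre g M y"
      by (rule fibre_bounds(1)[OF y A[OF y]])
  qed
  then show "A * (LINT y|lborel. (norm (g y))\<^sup>2) \<le> integral\<^sup>L unit_measure (fibre g M)"
    by (simp only: tile(1) integral_mult_right_zero)
  have "integral\<^sup>L unit_measure (fibre g M) \<le> integral\<^sup>L unit_measure (\<lambda>y. zak_bound * (\<Sum>m\<in>{- int M..<int M}. (norm (g (y + of_int m)))\<^sup>2))"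
  proof (rule integral_mono[OF integrable_fibre[OF g] integrable_mult_right[OF tile(2)]])
    fix y assume "y \<in> space unit_measure"
    then have y: "y \<in> {0..<1}" by simp
    show "fibre g M y \<le> zak_bound * (\<Sum>m\<in>{- int M..<int M}. (norm (g (y + of_int m)))\<^sup>2)"
      by (rule fibre_bounds(2)[OF y zak_sq_nonneg])
  qed
  then show "integral\<^sup>L unit_measure (fibre g M) \<le> zak_bound * (LINT y|lborel. (norm (g y))\<^sup>2)"
    by (simp only: tile(1) integral_mult_right_zero)
qed

abbreviation coeff_sq :: "(real \<Rightarrow> complex) \<Rightarrow> int \<times> int \<Rightarrow> real" where
  "coeff_sq g \<equiv> \<lambda>(k, l). (norm (gabor_coeff g k l))\<^sup>2"

lemma trunc_coeff_has_sum:
  assumes "g \<in> L2"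
  shows "(coeff_sq (trunc n g) has_sum integral\<^sup>L unit_measure (fibre (trunc n g) n)) (UNIV \<times> UNIV)"
  using assms by (intro gabor_coeff_has_sum[where R = n]) (auto simp: L2_iff norm_trunc_le trunc_supp)

text \<open>For a finite set of indices the bound passes from the truncations to \<open>g\<close>,
  since each coefficient converges; the bound over all finite sets then gives summability.\<close>

lemma bessel:
  assumes g: "g \<in> L2"
  shows "coeff_sq g summable_on UNIV \<times> UNIV"
    and "infsum (coeff_sq g) (UNIV \<times> UNIV) \<le> zak_bound * (LINT y|lborel. (norm (g y))\<^sup>2)"
proof -
  have gb: "g \<in> borel_measurable borel" using g by (simp add: L2_iff)
  have fin: "sum (coeff_sq g) F \<le> zak_bound * (LINT y|lborel. (norm (g y))\<^sup>2)" if F: "finite F" for F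
  proof (rule LIMSEQ_le_const2)
    show "(\<lambda>n. sum (coeff_sq (trunc n g)) F) \<longlonglongrightarrow> sum (coeff_sq g) F"
      unfolding case_prod_unfold by (intro tendsto_intros gabor_coeff_trunc_tendsto g)
    have "sum (coeff_sq (trunc n g)) F \<le> zak_bound * (LINT y|lborel. (norm (g y))\<^sup>2)" for n
    proof -
      have "sum (coeff_sq (trunc n g)) F \<le> integral\<^sup>L unit_measure (fibre (trunc n g) n)"
        using F by (intro finite_sum_le_has_sum[OF trunc_coeff_has_sum[OF g]]) auto
      also have "\<dots> \<le> zak_bound * (LINT y|lborel. (norm (trunc n g y))\<^sup>2)"
        by (rule integral_fibre_bounds(2)[where R = n and A = 0])
           (auto simp: gb trunc_borel norm_trunc_le trunc_supp zak_sq_nonneg)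
      also have "\<dots> \<le> zak_bound * (LINT y|lborel. (norm (g y))\<^sup>2)"
        by (intro mult_left_mono integral_norm_trunc_tendsto(3)[OF g] zak_bound_nonneg)
      finally show ?thesis .
    qed
    then show "\<exists>N. \<forall>n\<ge>N. sum (coeff_sq (trunc n g)) F \<le> zak_bound * (LINT y|lborel. (norm (g y))\<^sup>2)" by blast
  qed
  then show summ: "coeff_sq g summable_on UNIV \<times> UNIV"
    by (intro nonneg_bdd_above_summable_on)
       (auto intro!: bdd_aboveI2[where M = "zak_bound * (LINT y|lborel. (norm (g y))\<^sup>2)"])
  show "infsum (coeff_sq g) (UNIV \<times> UNIV) \<le> zak_bound * (LINT y|lborel. (norm (g y))\<^sup>2)"
    using fin by (intro infsum_le_finite_sums summ) auto
qed

text \<open>Convergence of each coefficient does not carry a lower bound to the limit, as mass could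
  escape in the indices. The error \<open>d n\<close> is instead controlled for all indices together
  by \<open>bessel\<close>, and splitting the squares costs the factor 2.\<close>

lemma frame_lower_bound:
  assumes g: "g \<in> L2" and A: "\<And>y \<xi>. y \<in> {0..<1} \<Longrightarrow> A \<le> zak_sq y \<xi>"
  shows "A / 2 * (LINT y|lborel. (norm (g y))\<^sup>2) \<le> infsum (coeff_sq g) (UNIV \<times> UNIV)"
proof -
  have gb: "g \<in> borel_measurable borel" using g by (simp add: L2_iff)
  define S where "S = infsum (coeff_sq g) (UNIV \<times> UNIV)"
  define d where "d = (\<lambda>n y. trunc n g y - g y)"
  have d: "d n \<in> L2" for n unfolding d_def by (rule integral_norm_trunc_tendsto(4)[OF g])
  have "A * (LINT y|lborel. (norm (trunc n g y))\<^sup>2) \<le> 2 * S + 2 * (zak_bound * (LINT y|lborel. (norm (d n y))\<^sup>2))" for n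
  proof -
    have "A * (LINT y|lborel. (norm (trunc n g y))\<^sup>2) \<le> integral\<^sup>L unit_measure (fibre (trunc n g) n)"
      by (rule integral_fibre_bounds(1)[where R = n]) (auto simp: gb trunc_borel norm_trunc_le trunc_supp A)
    also have "\<dots> \<le> 2 * S + 2 * infsum (coeff_sq (d n)) (UNIV \<times> UNIV)"
    proof (rule has_sum_mono[OF trunc_coeff_has_sum[OF g]])
      show "((\<lambda>x. 2 * coeff_sq g x + 2 * coeff_sq (d n) x) has_sum 2 * S + 2 * infsum (coeff_sq (d n)) (UNIV \<times> UNIV)) (UNIV \<times> UNIV)"
        unfolding S_def using bessel(1)[OF g] bessel(1)[OF d]
        by (intro has_sum_add has_sum_cmult_right has_sum_infsum)
      have "gabor_coeff (trunc n g) k l = gabor_coeff g k l + gabor_coeff (d n) k l" for k l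
        using gabor_coeff_add[OF g d, of n k l] by (simp add: d_def)
      then show "coeff_sq (trunc n g) x \<le> 2 * coeff_sq g x + 2 * coeff_sq (d n) x" for x
        by (simp add: case_prod_unfold norm_add_power2_le)
    qed
    also have "\<dots> \<le> 2 * S + 2 * (zak_bound * (LINT y|lborel. (norm (d n y))\<^sup>2))"
      using bessel(2)[OF d, of n] by simp
    finally show ?thesis .
  qed
  moreover have "(\<lambda>n. A * (LINT y|lborel. (norm (trunc n g y))\<^sup>2)) \<longlonglongrightarrow> A * (LINT y|lborel. (norm (g y))\<^sup>2)"
    by (intro tendsto_intros integral_norm_trunc_tendsto(1)[OF g])
  moreover have "(\<lambda>n. 2 * S + 2 * (zak_bound * (LINT y|lborel. (norm (d n y))\<^sup>2))) \<longlonglongrightarrow> 2 * S + 2 * (zak_bound * 0)"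
    unfolding d_def by (intro tendsto_intros integral_norm_trunc_tendsto(2)[OF g])
  ultimately have "A * (LINT y|lborel. (norm (g y))\<^sup>2) \<le> 2 * S + 2 * (zak_bound * 0)"
    by (intro LIMSEQ_le) auto
  then show ?thesis by (simp add: S_def)
qed

section \<open>Positivity and zeros of \<open>zak_sq\<close>\<close>

lemma zak_sq_xi_add_of_int: "zak_sq y (\<xi> + of_int k) = zak_sq y \<xi>"
  by (simp add: zak_sq_def zak_def distrib_left unit_char_add flip: of_int_mult)

lemma continuous_on_zak_sq: "continuous_on ({0..1} \<times> UNIV) (\<lambda>(y, \<xi>). zak_sq y \<xi>)"
proof -
  have "continuous_on ({0..1} \<times> UNIV) (\<lambda>p. (norm (zak (fst p + real j / real N) (snd p)))\<^sup>2)" if "j < N" for j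
  proof -
    have "continuous_on ({0..1} \<times> UNIV) (\<lambda>p. (\<lambda>(v, \<xi>). zak v \<xi>) (fst p + real j / real N, snd p))"
    proof (rule continuous_on_compose2[OF continuous_on_zak[of 2]])
      define c where "c = real j / real N"
      have "0 \<le> c" "c \<le> 1" using that by (auto simp: c_def)
      then show "(\<lambda>p. (fst p + real j / real N, snd p)) ` ({0..1} \<times> UNIV) \<subseteq> {- 2..2} \<times> UNIV"
        unfolding c_def[symmetric] by auto
    qed (auto intro!: continuous_intros)
    then show ?thesis by (intro continuous_intros) simp
  qed
  then show ?thesis
    unfolding zak_sq_def case_prod_unfold by (intro continuous_on_sum) auto
qed

text \<open>Periodicity in \<open>\<xi>\<close> reduces the claim to a compact square, where a
  continuous positive function has a positive minimum.\<close>

lemma zak_sq_lower_bound: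
  assumes "\<And>y \<xi>. zak_sq y \<xi> \<noteq> 0"
  obtains A where "A > 0" "\<And>y \<xi>. y \<in> {0..<1} \<Longrightarrow> A \<le> zak_sq y \<xi>"
proof -
  have "continuous_on ({0..1} \<times> {0..1}) (\<lambda>(y, \<xi>). zak_sq y \<xi>)"
    by (rule continuous_on_subset[OF continuous_on_zak_sq]) auto
  moreover have "compact ({0..1} \<times> {0..1} :: (real \<times> real) set)" "{0..1} \<times> {0..1} \<noteq> ({} :: (real \<times> real) set)"
    by (auto intro: compact_Times)
  ultimately obtain p where p: "\<And>q. q \<in> {0..1} \<times> {0..1} \<Longrightarrow> (\<lambda>(y, \<xi>). zak_sq y \<xi>) p \<le> (\<lambda>(y, \<xi>). zak_sq y \<xi>) q"
    using continuous_attains_inf by metis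
  define A where "A = (\<lambda>(y, \<xi>). zak_sq y \<xi>) p"
  have "A > 0"
    using assms zak_sq_nonneg unfolding A_def by (simp add: case_prod_unfold less_le)
  moreover have "A \<le> zak_sq y \<xi>" if "y \<in> {0..<1}" for y \<xi>
  proof -
    have "\<xi> = frac \<xi> + of_int \<lfloor>\<xi>\<rfloor>" by (simp add: frac_def)
    then have "zak_sq y \<xi> = zak_sq y (frac \<xi>)" using zak_sq_xi_add_of_int by metis
    moreover have "A \<le> zak_sq y (frac \<xi>)"
      using p[of "(y, frac \<xi>)"] that frac_lt_1[of \<xi>] by (auto simp: A_def less_imp_le)
    ultimately show ?thesis by simp
  qed
  ultimately show thesis by (rule that)
qed

end

context zak_window
begin

text \<open>Near a common zero of the Zak transforms a trigonometric polynomial \<open>p\<close> is concentrated on a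
  short interval of frequencies; its coefficients are spread over the integer translates of a short
  interval of times.\<close>
lemma zak_sq_zero_imp_no_lower_bound:
  assumes zero: "zak_sq (1/2) \<xi>0 = 0" and A: "A > 0"
  obtains g where "g \<in> L2" "infsum (coeff_sq g) (UNIV \<times> UNIV) < A * (LINT y|lborel. (norm (g y))\<^sup>2)"
proof -
  \<comment> \<open>The sign is reversed because \<open>fibre\<close> evaluates
    \<open>zak_sq\<close> at \<open>- \<xi>\<close>.\<close>
  define s where "s = frac (- \<xi>0)"
  have s: "0 \<le> s" "s < 1" by (auto simp: s_def frac_lt_1)
  have "zak_sq (1/2) (- s) = 0"
  proof -
    have "- s = \<xi>0 + of_int \<lfloor>- \<xi>0\<rfloor>" by (simp add: s_def frac_def)
    then show ?thesis using zak_sq_xi_add_of_int zero by metis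
  qed
  note zero' = this
  have "((\<lambda>(y, \<xi>). zak_sq y \<xi>) \<longlongrightarrow> zak_sq (1/2) (- s)) (at (1/2, - s) within {0..1} \<times> UNIV)"
    using continuous_on_zak_sq[unfolded continuous_on_def, rule_format, of "(1/2, - s)"] by simp
  then have "eventually (\<lambda>p. (\<lambda>(y, \<xi>). zak_sq y \<xi>) p < A / 8) (at (1/2, - s) within {0..1} \<times> UNIV)"
    by (rule order_tendstoD) (use A zero' in simp)
  then obtain d where d: "d > 0" "\<And>p. p \<in> {0..1} \<times> UNIV \<Longrightarrow> p \<noteq> (1/2, - s) \<Longrightarrow> dist p (1/2, - s) \<le> d \<Longrightarrow>
      (\<lambda>(y, \<xi>). zak_sq y \<xi>) p < A / 8"
    unfolding eventually_at_le by blast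
  \<comment> \<open>Both intervals of length \<open>\<delta>\<close>, in time from
    \<open>1/2\<close> and in frequency from \<open>s\<close>, stay inside \<open>[0, 1)\<close>;
    the bound \<open>d / 2\<close> keeps their product within distance \<open>d\<close> of the
    zero.\<close>
  define \<delta> where "\<delta> = min (min (1/2) (1 - s)) (d / 2)"
  have \<delta>: "\<delta> > 0" "\<delta> \<le> 1/2" "s + \<delta> \<le> 1" "2 * \<delta> \<le> d"
    using s d(1) by (auto simp: \<delta>_def min_def)
  have small: "zak_sq y (- \<xi>) \<le> A / 8" if y: "y \<in> {1/2..<1/2 + \<delta>}" and \<xi>: "\<xi> \<in> {s..<s + \<delta>}" for y \<xi>
  proof (cases "(y, - \<xi>) = (1/2, - s)")
    case True
    then have eq: "y = 1/2" "- \<xi> = - s" by (simp_all only: prod.inject)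
    show ?thesis unfolding eq zero' using A by simp
  next
    case False
    have "dist (y, - \<xi>) (1/2, - s) \<le> \<bar>y - 1/2\<bar> + \<bar>- \<xi> - - s\<bar>"
      unfolding dist_prod_def dist_real_def fst_conv snd_conv by (rule sqrt_sum_squares_le_sum) auto
    also have "\<dots> \<le> d" using y \<xi> \<delta>(4) by auto
    finally show ?thesis using d(2)[of "(y, - \<xi>)"] False y \<delta>(2) by auto
  qed
  \<comment> \<open>Chosen so that the approximation errors \<open>A * \<epsilon>\<close> and
    \<open>2 * zak_bound * \<epsilon>\<close> add up to \<open>A * \<delta> / 8\<close>; the proof
    ends with \<open>A * \<delta> / 4 + A * \<delta> / 8 < A * \<delta> / 2\<close>.\<close>
  define \<epsilon> where "\<epsilon> = A * \<delta> / (8 * (A + 2 * zak_bound))"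
  have den: "A + 2 * zak_bound > 0" using A zak_bound_nonneg by linarith
  have \<epsilon>: "\<epsilon> > 0" using A \<delta>(1) den by (simp add: \<epsilon>_def)
  define \<phi> where "\<phi> = (\<lambda>x. indicator {s..<s + \<delta>} x :: complex)"
  have [measurable]: "\<phi> \<in> borel_measurable borel" unfolding \<phi>_def by measurable
  have \<phi>_le: "norm (\<phi> x) \<le> 1" for x by (simp add: \<phi>_def indicator_def)
  obtain p where p: "p \<in> trig_polys" "integral\<^sup>L unit_measure (\<lambda>x. (norm (\<phi> x - p x))\<^sup>2) < \<epsilon>"
    using trig_polys_L2_dense[of \<phi> 1 \<epsilon>] \<phi>_le \<epsilon> by auto
  obtain c S where S: "finite S" "p = trig_poly c S" by (rule trig_polys_imp_trig_poly[OF p(1)])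
  obtain n where "S \<subseteq> {- int n..int n}" using finite_int_subset_interval[OF S(1)] .
  moreover define M where "M = n + 1"
  ultimately have SM: "S \<subseteq> {- int M..<int M}" by fastforce
  define c' where "c' = (\<lambda>m. if m \<in> S then c m else 0)"
  have p_eq: "p = trig_poly c' {- int M..<int M}"
    unfolding S(2) trig_poly_def[abs_def] using SM by (intro ext sum.mono_neutral_cong_left) (auto simp: c'_def)
  have [measurable]: "p \<in> borel_measurable borel" unfolding p_eq by measurable
  define B where "B = (\<Sum>m\<in>{- int M..<int M}. norm (c' m))"
  have p_le: "norm (p x) \<le> B" for x unfolding p_eq B_def by (rule norm_trig_poly_le)
  have \<phi>p_le: "norm (\<phi> x - p x) \<le> 1 + B" "norm (p x - \<phi> x) \<le> 1 + B" for x
    using \<phi>_le[of x] p_le[of x] norm_triangle_ineq4[of "\<phi> x" "p x"] norm_minus_commute[of "\<phi> x" "p x"] by linarith+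
  have p_norm: "integral\<^sup>L unit_measure (\<lambda>x. (norm (p x))\<^sup>2) = (\<Sum>m\<in>{- int M..<int M}. (norm (c' m))\<^sup>2)"
    unfolding p_eq by (rule integral_norm_trig_poly) simp
  have int_ind: "integral\<^sup>L unit_measure (indicator {a..<a + \<delta>}) = \<delta>" if "0 \<le> a" "a + \<delta> \<le> 1" for a
  proof -
    have "{a..<a + \<delta>} \<inter> space unit_measure = {a..<a + \<delta>}" using that by auto
    moreover have "measure unit_measure {a..<a + \<delta>} = \<delta>"
      using that \<delta>(1) by (subst measure_restrict_space) auto
    ultimately show ?thesis by simp
  qed
  have \<phi>_norm: "integral\<^sup>L unit_measure (\<lambda>x. (norm (\<phi> x))\<^sup>2) = \<delta>"
  proof -
    have "(\<lambda>x. (norm (\<phi> x))\<^sup>2) = indicator {s..<s + \<delta>}" by (auto simp: \<phi>_def indicator_def)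
    then show ?thesis using int_ind s(1) \<delta>(3) by simp
  qed
  have int_\<phi>p: "integrable unit_measure (\<lambda>x. (norm (\<phi> x - p x))\<^sup>2)" "integrable unit_measure (\<lambda>x. (norm (p x))\<^sup>2)"
    "integrable unit_measure (\<lambda>x. (norm (\<phi> x))\<^sup>2)"
    using \<phi>p_le p_le \<phi>_le by (auto intro!: integrable_norm_power2_unit)
  have "\<delta> \<le> integral\<^sup>L unit_measure (\<lambda>x. 2 * (norm (\<phi> x - p x))\<^sup>2 + 2 * (norm (p x))\<^sup>2)"
    unfolding \<phi>_norm[symmetric]
  proof (rule integral_mono)
    show "(norm (\<phi> x))\<^sup>2 \<le> 2 * (norm (\<phi> x - p x))\<^sup>2 + 2 * (norm (p x))\<^sup>2" for x
      using norm_add_power2_le[of "\<phi> x - p x" "p x"] by simp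
  qed (use int_\<phi>p in auto)
  also have "\<dots> = 2 * integral\<^sup>L unit_measure (\<lambda>x. (norm (\<phi> x - p x))\<^sup>2) + 2 * integral\<^sup>L unit_measure (\<lambda>x. (norm (p x))\<^sup>2)"
    using int_\<phi>p by simp
  finally have p_ge: "\<delta> / 2 - \<epsilon> < integral\<^sup>L unit_measure (\<lambda>x. (norm (p x))\<^sup>2)"
    using p(2) by linarith
  \<comment> \<open>The first summand comes from the short frequency interval, where
    \<open>zak_sq \<le> A / 8\<close>, the second from the error of \<open>p\<close>, where only
    \<open>zak_bound\<close> is available; \<open>norm_add_power2_le\<close> doubles both.\<close>
  define E where "E = \<delta> * (A / 4) + 2 * zak_bound * \<epsilon>"
  have E_le: "integral\<^sup>L unit_measure (\<lambda>\<xi>. (norm (p \<xi>))\<^sup>2 * zak_sq y (- \<xi>)) \<le> E" if y: "y \<in> {1/2..<1/2 + \<delta>}" for y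
  proof -
    have y1: "y \<in> {0..<1}" using y \<delta>(2) by auto
    have "integral\<^sup>L unit_measure (\<lambda>\<xi>. (norm (p \<xi>))\<^sup>2 * zak_sq y (- \<xi>)) \<le>
        integral\<^sup>L unit_measure (\<lambda>\<xi>. (A / 4) * (norm (\<phi> \<xi>))\<^sup>2 + 2 * zak_bound * (norm (\<phi> \<xi> - p \<xi>))\<^sup>2)"
    proof (rule integral_mono)
      show "integrable unit_measure (\<lambda>\<xi>. (norm (p \<xi>))\<^sup>2 * zak_sq y (- \<xi>))"
        by (rule integrable_trig_poly_zak_sq[OF y1 _ p_le]) measurable
      show "integrable unit_measure (\<lambda>\<xi>. (A / 4) * (norm (\<phi> \<xi>))\<^sup>2 + 2 * zak_bound * (norm (\<phi> \<xi> - p \<xi>))\<^sup>2)"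
        using int_\<phi>p by (intro Bochner_Integration.integrable_add integrable_mult_right)
      fix \<xi>
      have "(norm (p \<xi>))\<^sup>2 * zak_sq y (- \<xi>) \<le> (2 * (norm (\<phi> \<xi>))\<^sup>2 + 2 * (norm (\<phi> \<xi> - p \<xi>))\<^sup>2) * zak_sq y (- \<xi>)"
        using norm_add_power2_le[of "\<phi> \<xi>" "p \<xi> - \<phi> \<xi>"] norm_minus_commute[of "\<phi> \<xi>" "p \<xi>"]
        by (intro mult_right_mono zak_sq_nonneg) simp
      also have "\<dots> = 2 * ((norm (\<phi> \<xi>))\<^sup>2 * zak_sq y (- \<xi>)) + 2 * ((norm (\<phi> \<xi> - p \<xi>))\<^sup>2 * zak_sq y (- \<xi>))"
        by (simp add: algebra_simps)
      also have "\<dots> \<le> 2 * ((norm (\<phi> \<xi>))\<^sup>2 * (A / 8)) + 2 * ((norm (\<phi> \<xi> - p \<xi>))\<^sup>2 * zak_bound)"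
      proof (intro add_mono mult_left_mono[of _ _ 2])
        show "(norm (\<phi> \<xi>))\<^sup>2 * zak_sq y (- \<xi>) \<le> (norm (\<phi> \<xi>))\<^sup>2 * (A / 8)"
          using small[OF y] by (auto simp: \<phi>_def indicator_def)
        show "(norm (\<phi> \<xi> - p \<xi>))\<^sup>2 * zak_sq y (- \<xi>) \<le> (norm (\<phi> \<xi> - p \<xi>))\<^sup>2 * zak_bound"
          by (intro mult_left_mono zak_sq_le[OF y1]) auto
      qed auto
      finally show "(norm (p \<xi>))\<^sup>2 * zak_sq y (- \<xi>) \<le> (A / 4) * (norm (\<phi> \<xi>))\<^sup>2 + 2 * zak_bound * (norm (\<phi> \<xi> - p \<xi>))\<^sup>2"
        by (simp add: algebra_simps)
    qed
    also have "\<dots> = (A / 4) * \<delta> + 2 * zak_bound * integral\<^sup>L unit_measure (\<lambda>x. (norm (\<phi> x - p x))\<^sup>2)"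
      using int_\<phi>p by (simp add: \<phi>_norm)
    also have "\<dots> \<le> E"
      unfolding E_def using mult_left_mono[OF less_imp_le[OF p(2)] zak_bound_nonneg] by (simp add: mult.commute)
    finally show ?thesis .
  qed
  \<comment> \<open>For a time \<open>y\<close> in the short interval the values
    \<open>g (y + m)\<close> are the coefficients of \<open>p\<close>, and for other
    \<open>y\<close> they vanish, so the trigonometric polynomial inside \<open>fibre\<close> is
    either \<open>p\<close> or 0.\<close>
  define g where "g = (\<lambda>y. if frac y \<in> {1/2..<1/2 + \<delta>} \<and> \<lfloor>y\<rfloor> \<in> {- int M..<int M} then c' \<lfloor>y\<rfloor> else 0)"
  have [measurable]: "(\<lambda>y::real. c' \<lfloor>y\<rfloor>) \<in> borel_measurable borel"
    by (rule measurable_compose[OF measurable_real_floor]) simp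
  have g_borel[measurable]: "g \<in> borel_measurable borel" 
  proof -
    have "g = (\<lambda>y. if y - of_int \<lfloor>y\<rfloor> \<in> {1/2..<1/2 + \<delta>} \<and> y \<in> {- real M..<real M} then c' \<lfloor>y\<rfloor> else 0)"
      by (auto simp: g_def frac_def fun_eq_iff le_floor_iff floor_less_iff)
    also have "\<dots> \<in> borel_measurable borel" by measurable
    finally show ?thesis .
  qed
  have g_eq: "g (y + of_int m) = indicator {1/2..<1/2 + \<delta>} y *\<^sub>R c' m" if "y \<in> {0..<1}" "m \<in> {- int M..<int M}" for y m
  proof -
    have "\<lfloor>y + of_int m\<rfloor> = m" using that(1) by (simp add: floor_eq_iff)
    moreover from this have "frac (y + of_int m) = y" by (simp add: frac_def)
    ultimately show ?thesis using that(2) by (simp add: g_def indicator_def)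
  qed
  have g_le: "norm (g y) \<le> B" for y
    unfolding B_def g_def by (auto intro!: member_le_sum[of _ _ "\<lambda>m. norm (c' m)"] sum_nonneg)
  have g_supp: "g y = 0" if "y \<notin> {- real M..<real M}" for y
    using that by (auto simp: g_def le_floor_iff floor_less_iff)
  note tile = integral_norm_eq_tile[OF g_borel g_le g_supp]
  have "(LINT y|lborel. (norm (g y))\<^sup>2) = integral\<^sup>L unit_measure (\<lambda>y. \<Sum>m\<in>{- int M..<int M}. (norm (g (y + of_int m)))\<^sup>2)"
    by (rule tile(1))
  also have "\<dots> = integral\<^sup>L unit_measure (\<lambda>y. indicator {1/2..<1/2 + \<delta>} y * (\<Sum>m\<in>{- int M..<int M}. (norm (c' m))\<^sup>2))"
    by (intro Bochner_Integration.integral_cong refl) (auto simp: g_eq sum_distrib_left indicator_def intro!: sum.cong)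
  also have "\<dots> = \<delta> * integral\<^sup>L unit_measure (\<lambda>x. (norm (p x))\<^sup>2)"
    using int_ind[of "1/2"] \<delta>(2) by (simp add: p_norm)
  finally have g_norm: "(LINT y|lborel. (norm (g y))\<^sup>2) = \<delta> * integral\<^sup>L unit_measure (\<lambda>x. (norm (p x))\<^sup>2)" .
  have fibre_le: "fibre g M y \<le> E * indicator {1/2..<1/2 + \<delta>} y" if y: "y \<in> {0..<1}" for y
  proof (cases "y \<in> {1/2..<1/2 + \<delta>}")
    case True
    have "trig_poly (\<lambda>m. g (y + of_int m)) {- int M..<int M} = p"
      unfolding p_eq trig_poly_def[abs_def] using True y by (intro ext sum.cong) (simp_all add: g_eq)
    then show ?thesis using E_le[OF True] True by (simp add: fibre_def)
  next
    case False
    have "trig_poly (\<lambda>m. g (y + of_int m)) {- int M..<int M} = (\<lambda>_. 0)"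
      unfolding trig_poly_def[abs_def] using False y by (intro ext sum.neutral) (simp add: g_eq)
    then show ?thesis using False by (simp add: fibre_def)
  qed
  have "integral\<^sup>L unit_measure (fibre g M) \<le> integral\<^sup>L unit_measure (\<lambda>y. E * indicator {1/2..<1/2 + \<delta>} y)"
  proof (rule integral_mono[OF integrable_fibre[OF g_borel g_le g_supp]])
    show "integrable unit_measure (\<lambda>y. E * indicator {1/2..<1/2 + \<delta>} y)"
      by (intro integrable_mult_right integrable_unit_measure[where B = 1]) auto
  qed (use fibre_le in auto)
  also have "\<dots> = E * \<delta>"
    using int_ind[of "1/2"] \<delta>(2) by simp
  also have "integral\<^sup>L unit_measure (fibre g M) = infsum (coeff_sq g) (UNIV \<times> UNIV)"
    by (rule infsumI[OF gabor_coeff_has_sum, symmetric]) (use g_borel g_le g_supp in auto)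
  finally have "infsum (coeff_sq g) (UNIV \<times> UNIV) \<le> E * \<delta>" .
  also have "E < A * integral\<^sup>L unit_measure (\<lambda>x. (norm (p x))\<^sup>2)"
  proof -
    have "(A + 2 * zak_bound) * \<epsilon> = A * \<delta> / 8"
    proof -
      have "D * (X / (8 * D)) = X / 8" if "D > 0" for D X :: real
        using that by simp
      then show ?thesis unfolding \<epsilon>_def using den by blast
    qed
    then have "E + A * \<epsilon> = \<delta> * (A / 4) + A * \<delta> / 8"
      by (simp add: E_def algebra_simps)
    also have "\<dots> < A * (\<delta> / 2)" using A \<delta>(1) by (simp add: field_simps)
    finally have "E < A * (\<delta> / 2 - \<epsilon>)" by (simp add: algebra_simps)
    also have "\<dots> < A * integral\<^sup>L unit_measure (\<lambda>x. (norm (p x))\<^sup>2)"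
      using p_ge A by (intro mult_strict_left_mono)
    finally show ?thesis .
  qed
  then have "E * \<delta> < A * (LINT y|lborel. (norm (g y))\<^sup>2)"
    unfolding g_norm using \<delta>(1) by (simp add: mult.left_commute mult.commute)
  finally have "infsum (coeff_sq g) (UNIV \<times> UNIV) < A * (LINT y|lborel. (norm (g y))\<^sup>2)" .
  moreover have "g \<in> L2"
    unfolding L2_iff
  proof
    show "integrable lborel (\<lambda>y. (norm (g y))\<^sup>2)"
      by (rule integrable_bounded_support[where g = g and R = B and M = M and B = "B\<^sup>2"])
         (use g_le g_supp in \<open>auto intro!: power_mono\<close>)
  qed (rule g_borel)
  ultimately show thesis using that by blast
qed

end

section \<open>Hermite functions\<close>

text \<open>Hermite functions are defined by iterated real derivatives, theta functions use complex
  ones. At each stage the restriction to the real line is real-valued, so its derivative has no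
  imaginary part and the induction continues.\<close>

lemma of_real_higher_deriv:
  fixes f :: "real \<Rightarrow> real"
  assumes "F holomorphic_on UNIV" "\<And>s. F (of_real s) = of_real (f s)"
  shows "complex_of_real ((deriv ^^ n) f t) = (deriv ^^ n) F (of_real t)"
proof (induction n arbitrary: t)
  case (Suc n)
  define G where "G = (deriv ^^ n) F"
  define g where "g = (deriv ^^ n) f"
  have Gg: "G (of_real s) = of_real (g s)" for s using Suc by (simp add: G_def g_def)
  have "G holomorphic_on UNIV" unfolding G_def using assms(1) by (intro holomorphic_higher_deriv) auto
  then have "(G has_field_derivative deriv G (of_real t)) (at (of_real t))"
    by (intro holomorphic_derivI[of _ UNIV]) auto
  then have "((\<lambda>s. G (of_real s)) has_vector_derivative deriv G (of_real t)) (at t)"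
    by (rule has_vector_derivative_real_field)
  then have vd: "((\<lambda>s. complex_of_real (g s)) has_vector_derivative deriv G (of_real t)) (at t)"
    by (simp only: Gg)
  have "((\<lambda>s. Re (complex_of_real (g s))) has_vector_derivative Re (deriv G (of_real t))) (at t)"
    by (rule bounded_linear.has_vector_derivative[OF bounded_linear_Re vd])
  then have "(g has_real_derivative Re (deriv G (of_real t))) (at t)"
    by (simp add: has_real_derivative_iff_has_vector_derivative)
  then have 1: "deriv g t = Re (deriv G (of_real t))" by (rule DERIV_imp_deriv)
  have "((\<lambda>s. Im (complex_of_real (g s))) has_vector_derivative Im (deriv G (of_real t))) (at t)"
    by (rule bounded_linear.has_vector_derivative[OF bounded_linear_Im vd])
  then have "((\<lambda>s. 0) has_real_derivative Im (deriv G (of_real t))) (at t)"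
    by (simp add: has_real_derivative_iff_has_vector_derivative)
  then have 2: "Im (deriv G (of_real t)) = 0"
    using DERIV_unique[OF _ DERIV_const] by blast
  show ?case using 1 2 by (simp add: G_def g_def complex_eq_iff)
qed (simp add: assms(2))

lemma of_real_higher_deriv_gaussian:
  "complex_of_real ((deriv ^^ n) (\<lambda>s. exp (- 2 * pi * s\<^sup>2)) t) =
    (deriv ^^ n) (\<lambda>w. exp (- 2 * of_real pi * w\<^sup>2)) (of_real t)"
  by (rule of_real_higher_deriv) (auto intro!: holomorphic_intros simp flip: exp_of_real)

text \<open>The exponential is the generating function of the Hermite functions.\<close>
lemma hermite_fun_eq_deriv:
  "complex_of_real (hermite_fun n t) = of_real (hermite_const n) *
     (deriv ^^ n) (\<lambda>w. exp (- of_real pi * (of_real t)\<^sup>2 + 4 * of_real pi * of_real t * w - 2 * of_real pi * w\<^sup>2)) 0"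
proof -
  define F where "F = (\<lambda>w::complex. exp (- 2 * of_real pi * w\<^sup>2))"
  have F: "F holomorphic_on UNIV" unfolding F_def by (intro holomorphic_intros)
  have real: "complex_of_real ((deriv ^^ n) (\<lambda>s. exp (- 2 * pi * s\<^sup>2)) t) = (deriv ^^ n) F (of_real t)"
    unfolding F_def by (rule of_real_higher_deriv_gaussian)
  have "(deriv ^^ n) (\<lambda>w. exp (- of_real pi * (of_real t)\<^sup>2 + 4 * of_real pi * of_real t * w - 2 * of_real pi * w\<^sup>2)) 0 =
      (deriv ^^ n) (\<lambda>w. exp (of_real pi * (of_real t)\<^sup>2) * F (- 1 * w + of_real t)) 0"
  proof -
    have "exp (- of_real pi * (of_real t)\<^sup>2 + 4 * of_real pi * of_real t * w - 2 * of_real pi * w\<^sup>2) =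
      exp (of_real pi * (of_real t)\<^sup>2) * F (- 1 * w + of_real t)" for w :: complex
      unfolding F_def mult_exp_exp
      by (rule arg_cong[of _ _ exp]) (simp add: power2_eq_square algebra_simps)
    then show ?thesis by simp
  qed
  also have "\<dots> = exp (of_real pi * (of_real t)\<^sup>2) * (deriv ^^ n) (\<lambda>w. F (- 1 * w + of_real t)) 0"
  proof (rule higher_deriv_cmult[of _ UNIV])
    show "(\<lambda>w. F (- 1 * w + of_real t)) holomorphic_on UNIV" unfolding F_def by (intro holomorphic_intros)
  qed auto
  \<comment> \<open>The reflection in \<open>w \<mapsto> t - w\<close> supplies the sign
    \<open>(-1) ^ n\<close> of the definition.\<close>
  also have "(deriv ^^ n) (\<lambda>w. F (- 1 * w + of_real t)) 0 = (- 1) ^ n * (deriv ^^ n) F (- 1 * 0 + of_real t)"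
    by (rule higher_deriv_compose_linear'[OF F, where S = UNIV]) auto
  finally show ?thesis
    unfolding hermite_fun_def using real by (simp add: exp_of_real[symmetric])
qed

lemma hermite_const_pos: "hermite_const n > 0"
  unfolding hermite_const_def by (intro divide_pos_pos mult_pos_pos real_sqrt_gt_zero zero_less_power) auto

lemma continuous_hermite_fun: "continuous_on UNIV (hermite_fun n)"
proof -
  define F where "F = (\<lambda>w::complex. exp (- 2 * of_real pi * w\<^sup>2))"
  have eq: "(deriv ^^ n) (\<lambda>s. exp (- 2 * pi * s\<^sup>2)) t = Re ((deriv ^^ n) F (of_real t))" for t
    unfolding F_def of_real_higher_deriv_gaussian[symmetric] by simp
  have cont: "continuous_on UNIV ((deriv ^^ n) F)"
    unfolding F_def by (intro holomorphic_on_imp_continuous_on holomorphic_higher_deriv holomorphic_intros) auto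
  have "continuous_on UNIV (\<lambda>t. (deriv ^^ n) F (of_real t))"
    by (rule continuous_on_compose2[OF cont]) (auto intro!: continuous_intros)
  then show ?thesis
    unfolding hermite_fun_def eq by (intro continuous_intros)
qed

text \<open>Cauchy's inequality on the unit circle bounds the derivative of the generating function
  by its maximum there, in which the Gaussian in \<open>t\<close> dominates the linear term.\<close>

lemma hermite_fun_decay:
  obtains C where "\<And>t. \<bar>hermite_fun n t\<bar> \<le> C * exp (- \<bar>t\<bar>)"
proof -
  \<comment> \<open>\<open>2 * pi\<close> bounds the quadratic term in \<open>w\<close>; the square
    absorbs \<open>(4 * pi + 1) * \<bar>t\<bar>\<close> as long as
    \<open>\<bar>t\<bar> \<le> 4 * pi + 1\<close>, beyond which \<open>pi * t^2\<close>
    does.\<close>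
  define D where "D = (4 * pi + 1) ^ 2 + 2 * pi"
  have "\<bar>hermite_fun n t\<bar> \<le> hermite_const n * (fact n * exp D) * exp (- \<bar>t\<bar>)" for t
  proof -
    define f where "f = (\<lambda>w::complex. exp (- of_real pi * (of_real t)\<^sup>2 + 4 * of_real pi * of_real t * w - 2 * of_real pi * w\<^sup>2))"
    have f: "f holomorphic_on A" for A unfolding f_def by (intro holomorphic_intros)
    have "norm ((deriv ^^ n) f 0) \<le> fact n * exp (D - \<bar>t\<bar>) / 1 ^ n"
    proof (rule Cauchy_inequality)
      fix w :: complex assume w: "norm (0 - w) = 1"
      have "Re (- of_real pi * (of_real t)\<^sup>2 + 4 * of_real pi * of_real t * w - 2 * of_real pi * w\<^sup>2) =
          - pi * t\<^sup>2 + 4 * pi * (t * Re w) - 2 * pi * Re (w\<^sup>2)"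
        by (simp add: power2_eq_square algebra_simps)
      also have "\<dots> \<le> - pi * t\<^sup>2 + 4 * pi * \<bar>t\<bar> + 2 * pi"
      proof -
        have "t * Re w \<le> \<bar>t\<bar> * \<bar>Re w\<bar>" by (simp flip: abs_mult)
        also have "\<dots> \<le> \<bar>t\<bar> * 1" using w abs_Re_le_cmod[of w] by (intro mult_left_mono) auto
        finally have "4 * pi * (t * Re w) \<le> 4 * pi * \<bar>t\<bar>" by (intro mult_left_mono) auto
        moreover have "- Re (w\<^sup>2) \<le> 1"
          using w abs_Re_le_cmod[of "w\<^sup>2"] by (simp add: norm_power abs_le_iff)
        then have "2 * pi * (- Re (w\<^sup>2)) \<le> 2 * pi * 1" by (intro mult_left_mono) auto
        then have "- (2 * pi * Re (w\<^sup>2)) \<le> 2 * pi" by (simp only: mult_minus_right mult_1_right)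
        ultimately show ?thesis by linarith
      qed
      also have "\<dots> \<le> D - \<bar>t\<bar>"
      proof -
        have "(4 * pi + 1) * \<bar>t\<bar> \<le> (4 * pi + 1)\<^sup>2 + pi * t\<^sup>2"
        proof (cases "\<bar>t\<bar> \<le> 4 * pi + 1")
          case True
          then have "(4 * pi + 1) * \<bar>t\<bar> \<le> (4 * pi + 1) * (4 * pi + 1)" by (intro mult_left_mono) auto
          then show ?thesis by (simp add: power2_eq_square add_increasing2)
        next
          case False
          then have "(4 * pi + 1) * \<bar>t\<bar> \<le> \<bar>t\<bar> * \<bar>t\<bar>" by (intro mult_right_mono) auto
          also have "\<dots> = 1 * t\<^sup>2" by (simp add: power2_eq_square)
          also have "\<dots> \<le> pi * t\<^sup>2" using pi_ge_two by (intro mult_right_mono) auto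
          finally show ?thesis by (simp add: add_increasing)
        qed
        then show ?thesis by (simp add: D_def algebra_simps)
      qed
      finally show "norm (f w) \<le> exp (D - \<bar>t\<bar>)" by (simp add: f_def)
    qed (auto intro: f holomorphic_on_imp_continuous_on)
    then have "norm (complex_of_real (hermite_fun n t)) \<le> hermite_const n * (fact n * exp (D - \<bar>t\<bar>))"
      unfolding hermite_fun_eq_deriv f_def[symmetric] norm_mult
      using hermite_const_pos[of n] by (intro mult_mono) auto
    then show ?thesis by (simp add: exp_diff exp_minus field_simps)
  qed
  then show thesis by (rule that)
qed

definition hermite_window :: "nat \<Rightarrow> real \<Rightarrow> real" where
  "hermite_window n y = hermite_fun n (sqrt (real (n + 1)) * y)"

text \<open>Substituting \<open>w = sqrt (n + 1) / 2 * z\<close> in the generating function yields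
  the Gaussian-weighted theta term. The power of \<open>2 / sqrt (n + 1)\<close> undoes the factor
  from the chain rule.\<close>

lemma hermite_window_eq_deriv:
  "complex_of_real (hermite_window n (v + of_int m)) * unit_char (of_int m * \<xi>) =
     of_real (hermite_const n * (2 / sqrt (real (n + 1))) ^ n) *
     (deriv ^^ n) (\<lambda>z. exp (of_real pi * of_nat (n + 1) / 2 * z\<^sup>2) * theta_term (n + 1) v \<xi> m z) 0"
proof -
  define \<beta> where "\<beta> = sqrt (real (n + 1))"
  have \<beta>: "\<beta> > 0" "complex_of_real \<beta> * complex_of_real \<beta> = of_nat (n + 1)"
    by (auto simp: \<beta>_def simp flip: of_real_mult)
  define y where "y = v + real_of_int m"
  define f where "f = (\<lambda>w::complex. exp (- of_real pi * (of_real (\<beta> * y))\<^sup>2 + 4 * of_real pi * of_real (\<beta> * y) * w - 2 * of_real pi * w\<^sup>2))"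
  have f: "f holomorphic_on A" for A unfolding f_def by (intro holomorphic_intros)
  have "exp (of_real pi * of_nat (n + 1) / 2 * z\<^sup>2) * theta_term (n + 1) v \<xi> m z =
      unit_char (of_int m * \<xi>) * f (of_real (\<beta> / 2) * z)" for z
  proof -
    have "- of_real pi * (of_real (\<beta> * y))\<^sup>2 + 4 * of_real pi * of_real (\<beta> * y) * (of_real (\<beta> / 2) * z) - 2 * of_real pi * (of_real (\<beta> / 2) * z)\<^sup>2 =
      of_real pi * (complex_of_real \<beta> * complex_of_real \<beta>) * (- (of_real y)\<^sup>2 + 2 * of_real y * z - z\<^sup>2 / 2)"
      by (simp add: power2_eq_square field_simps)
    also have "\<dots> = of_real pi * of_nat (n + 1) / 2 * z\<^sup>2 + - of_real pi * of_nat (n + 1) * (of_real y - z)\<^sup>2"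
      unfolding \<beta>(2) by (simp add: power2_eq_square field_simps)
    finally have "f (of_real (\<beta> / 2) * z) = exp (of_real pi * of_nat (n + 1) / 2 * z\<^sup>2) * exp (- of_real pi * of_nat (n + 1) * (of_real y - z)\<^sup>2)"
      unfolding f_def mult_exp_exp by simp
    then show ?thesis
      unfolding theta_term_def y_def[symmetric] by (simp only: mult_ac)
  qed
  then have "(deriv ^^ n) (\<lambda>z. exp (of_real pi * of_nat (n + 1) / 2 * z\<^sup>2) * theta_term (n + 1) v \<xi> m z) 0 =
      (deriv ^^ n) (\<lambda>z. unit_char (of_int m * \<xi>) * f (of_real (\<beta> / 2) * z)) 0"
    by simp
  also have "\<dots> = unit_char (of_int m * \<xi>) * (deriv ^^ n) (\<lambda>z. f (of_real (\<beta> / 2) * z)) 0"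
  proof (rule higher_deriv_cmult[of _ UNIV])
    show "(\<lambda>z. f (of_real (\<beta> / 2) * z)) holomorphic_on UNIV" unfolding f_def by (intro holomorphic_intros)
  qed auto
  also have "(deriv ^^ n) (\<lambda>z. f (of_real (\<beta> / 2) * z)) 0 = of_real (\<beta> / 2) ^ n * (deriv ^^ n) f (of_real (\<beta> / 2) * 0)"
    by (rule higher_deriv_compose_linear[OF f[of UNIV], where S = UNIV]) auto
  finally have eq: "(deriv ^^ n) (\<lambda>z. exp (of_real pi * of_nat (n + 1) / 2 * z\<^sup>2) * theta_term (n + 1) v \<xi> m z) 0 =
      unit_char (of_int m * \<xi>) * (of_real ((\<beta> / 2) ^ n) * (deriv ^^ n) f 0)"
    by simp
  have "(2 / \<beta>) ^ n * (\<beta> / 2) ^ n = 1"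
    using \<beta>(1) by (simp flip: power_mult_distrib)
  then have c: "complex_of_real ((2 / \<beta>) ^ n) * of_real ((\<beta> / 2) ^ n) = 1"
    by (simp only: of_real_mult[symmetric] of_real_1)
  have "complex_of_real (hermite_window n (v + of_int m)) = of_real (hermite_const n) * (deriv ^^ n) f 0"
    unfolding hermite_window_def \<beta>_def[symmetric] y_def[symmetric] hermite_fun_eq_deriv f_def ..
  also have "\<dots> = of_real (hermite_const n) * ((complex_of_real ((2 / \<beta>) ^ n) * of_real ((\<beta> / 2) ^ n)) * (deriv ^^ n) f 0)"
    unfolding c by simp
  finally show ?thesis
    unfolding eq \<beta>_def[symmetric] by (simp only: of_real_mult mult_ac)
qed

lemma hermite_zak_window:
  obtains K where "zak_window (hermite_window n) K (n + 1)"
proof -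
  obtain C where C: "\<And>t. \<bar>hermite_fun n t\<bar> \<le> C * exp (- \<bar>t\<bar>)"
    using hermite_fun_decay[of n] by blast
  have C0: "0 \<le> C" using order_trans[OF abs_ge_zero C[of 0]] by simp
  have "zak_window (hermite_window n) C (n + 1)"
  proof
    show "continuous_on UNIV (hermite_window n)"
      unfolding hermite_window_def[abs_def]
      by (rule continuous_on_compose2[OF continuous_hermite_fun]) (auto intro!: continuous_intros)
    show "\<bar>hermite_window n y\<bar> \<le> C * exp (- \<bar>y\<bar>)" for y
    proof -
      have "1 * \<bar>y\<bar> \<le> sqrt (real (n + 1)) * \<bar>y\<bar>" by (intro mult_right_mono) auto
      then have "exp (- \<bar>sqrt (real (n + 1)) * y\<bar>) \<le> exp (- \<bar>y\<bar>)" by (simp add: abs_mult)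
      then have "C * exp (- \<bar>sqrt (real (n + 1)) * y\<bar>) \<le> C * exp (- \<bar>y\<bar>)" using C0 by (rule mult_left_mono)
      then show ?thesis unfolding hermite_window_def by (rule order_trans[OF C])
    qed
  qed auto
  then show thesis by (rule that)
qed

lemma zak_hermite_window:
  assumes "zak_window (hermite_window n) K (n + 1)"
  shows "zak_window.zak (hermite_window n) v \<xi> =
    of_real (hermite_const n * (2 / sqrt (real (n + 1))) ^ n) * theta_deriv n (theta (n + 1) v \<xi>)"
proof -
  interpret zak_window "hermite_window n" K "n + 1" by fact
  have "((\<lambda>m. of_real (hermite_const n * (2 / sqrt (real (n + 1))) ^ n) *
     (deriv ^^ n) (\<lambda>z. exp (of_real pi * of_nat (n + 1) / 2 * z\<^sup>2) * theta_term (n + 1) v \<xi> m z) 0) has_sum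
     of_real (hermite_const n * (2 / sqrt (real (n + 1))) ^ n) * theta_deriv n (theta (n + 1) v \<xi>)) UNIV"
    unfolding theta_deriv_def
    by (intro has_sum_cmult_right higher_deriv_theta_has_sum holomorphic_intros) auto
  then have "((\<lambda>m. unit_char (of_int m * \<xi>) * of_real (hermite_window n (v + of_int m))) has_sum
     of_real (hermite_const n * (2 / sqrt (real (n + 1))) ^ n) * theta_deriv n (theta (n + 1) v \<xi>)) UNIV"
    unfolding hermite_window_eq_deriv[symmetric] by (simp only: mult.commute)
  then show ?thesis using zak_has_sum has_sum_unique by blast
qed

section \<open>Return to the original time scale\<close>

definition lattice_point :: "real \<Rightarrow> int \<times> int \<Rightarrow> real^2" where
  "lattice_point a = (\<lambda>(k, l). \<chi> i. if i = 1 then a * of_int k else a * of_int l)"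

lemma lattice_point_nth: "lattice_point a (k, l) $ 1 = a * of_int k" "lattice_point a (k, l) $ 2 = a * of_int l"
  by (simp_all add: lattice_point_def)

lemma square_lattice_eq: "square_lattice a = lattice_point a ` (UNIV \<times> UNIV)"
proof (rule set_eqI)
  fix z :: "real^2"
  show "z \<in> square_lattice a \<longleftrightarrow> z \<in> lattice_point a ` (UNIV \<times> UNIV)"
  proof
    assume "z \<in> square_lattice a"
    then obtain w :: "real^2" where w: "\<forall>i. w $ i \<in> \<int>" "z = a *\<^sub>R w" by (auto simp: square_lattice_def int_lattice_def)
    then obtain k l where "w $ 1 = of_int k" "w $ 2 = of_int l" by (meson Ints_cases)
    then have "z = lattice_point a (k, l)"
      by (simp add: w(2) vec_eq_iff forall_2 lattice_point_nth)
    then show "z \<in> lattice_point a ` (UNIV \<times> UNIV)" by blast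
  next
    assume "z \<in> lattice_point a ` (UNIV \<times> UNIV)"
    then obtain k l where "z = lattice_point a (k, l)" by auto
    then have "z = a *\<^sub>R lattice_point 1 (k, l)" "\<forall>i. lattice_point 1 (k, l) $ i \<in> \<int>"
      by (simp_all add: vec_eq_iff forall_2 lattice_point_nth)
    then show "z \<in> square_lattice a" by (auto simp: square_lattice_def int_lattice_def)
  qed
qed

lemma inj_lattice_point: "a \<noteq> 0 \<Longrightarrow> inj (lattice_point a)"
  by (auto simp: inj_on_def vec_eq_iff forall_2 lattice_point_nth)

context zak_window
begin

definition scaled_window :: "real \<Rightarrow> complex" where
  "scaled_window t = of_real (h (t / sqrt (real N)))"

lemma sqrt_N: "sqrt (real N) > 0" "sqrt (real N) * sqrt (real N) = real N"
  using N_pos by auto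

lemma L2_scale:
  assumes "f \<in> L2" "c \<noteq> 0"
  shows "(\<lambda>y. f (c * y)) \<in> L2"
proof -
  have [measurable]: "f \<in> borel_measurable borel" and int: "integrable lborel (\<lambda>t. (cmod (f t))\<^sup>2)"
    using assms by (auto simp: L2_iff)
  have "integrable lborel (\<lambda>y. (cmod (f (0 + c * y)))\<^sup>2)"
    by (rule lborel_integrable_real_affine[OF int assms(2)])
  then show ?thesis unfolding L2_iff by simp
qed

lemma L2_norm_scale:
  "(L2_norm f)\<^sup>2 = sqrt (real N) * (LINT y|lborel. (norm (f (sqrt (real N) * y)))\<^sup>2)"
proof -
  have "(L2_norm f)\<^sup>2 = (LINT t|lborel. (cmod (f t))\<^sup>2)"
    unfolding L2_norm_def by (intro real_sqrt_pow2 integral_nonneg_AE) auto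
  also have "\<dots> = \<bar>sqrt (real N)\<bar> *\<^sub>R (LINT y|lborel. (cmod (f (0 + sqrt (real N) * y)))\<^sup>2)"
    using sqrt_N by (intro lborel_integral_real_affine) auto
  finally show ?thesis by simp
qed

lemma tf_shift_scaled_window_in_L2: "tf_shift z scaled_window \<in> L2"
proof -
  define \<beta> where "\<beta> = sqrt (real N)"
  have \<beta>: "\<beta> > 0" using sqrt_N by (simp add: \<beta>_def)
  have "integrable lborel (\<lambda>t. (h (0 + 1 / \<beta> * t - z $ 1 / \<beta>))\<^sup>2)"
    using \<beta> by (intro lborel_integrable_real_affine[OF integrable_h_square]) auto
  moreover have "norm (tf_shift z scaled_window t) ^ 2 = (h (0 + 1 / \<beta> * t - z $ 1 / \<beta>))\<^sup>2" for t
    by (simp add: tf_shift_def scaled_window_def norm_mult \<beta>_def[symmetric] diff_divide_distrib)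
  moreover have "tf_shift z scaled_window \<in> borel_measurable borel"
    unfolding tf_shift_def scaled_window_def by measurable
  ultimately show ?thesis by (simp add: L2_iff)
qed

text \<open>The substitution \<open>t = sqrt N * y\<close> turns the time shift
  \<open>k / sqrt N\<close> into \<open>k / N\<close> and the frequency \<open>l / sqrt N\<close>
  into \<open>l\<close>; its Jacobian is the factor in front.\<close>

lemma L2_inner_tf_shift:
  "L2_inner f (tf_shift (lattice_point (1 / sqrt (real N)) (k, l)) scaled_window) =
     of_real (sqrt (real N)) * gabor_coeff (\<lambda>y. f (sqrt (real N) * y)) k l"
proof -
  define \<beta> where "\<beta> = sqrt (real N)"
  have \<beta>: "\<beta> > 0" "\<beta> * \<beta> = real N" using sqrt_N by (auto simp: \<beta>_def)
  have "L2_inner f (tf_shift (lattice_point (1 / \<beta>) (k, l)) scaled_window) =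
      (LINT t|lborel. f t * cnj (unit_char (1 / \<beta> * of_int l * t) * of_real (h ((t - 1 / \<beta> * of_int k) / \<beta>))))"
    unfolding L2_inner_def tf_shift_def lattice_point_nth scaled_window_def unit_char_exp \<beta>_def[symmetric]
    by (simp add: mult_ac)
  also have "\<dots> = \<bar>\<beta>\<bar> *\<^sub>R (LINT y|lborel. f (0 + \<beta> * y) * cnj (unit_char (1 / \<beta> * of_int l * (0 + \<beta> * y)) *
      of_real (h ((0 + \<beta> * y - 1 / \<beta> * of_int k) / \<beta>))))"
    using \<beta> by (intro lborel_integral_real_affine) auto
  also have "(\<lambda>y. f (0 + \<beta> * y) * cnj (unit_char (1 / \<beta> * of_int l * (0 + \<beta> * y)) * of_real (h ((0 + \<beta> * y - 1 / \<beta> * of_int k) / \<beta>)))) =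
      (\<lambda>y. f (\<beta> * y) * of_real (h (y - of_int k / real N)) * unit_char (- of_int l * y))"
  proof
    fix y
    have "(0 + \<beta> * y - 1 / \<beta> * of_int k) / \<beta> = y - of_int k / real N"
      unfolding \<beta>(2)[symmetric] using \<beta>(1) by (simp add: field_simps)
    moreover have "1 / \<beta> * of_int l * (0 + \<beta> * y) = of_int l * y" using \<beta>(1) by simp
    ultimately show "f (0 + \<beta> * y) * cnj (unit_char (1 / \<beta> * of_int l * (0 + \<beta> * y)) * of_real (h ((0 + \<beta> * y - 1 / \<beta> * of_int k) / \<beta>))) =
      f (\<beta> * y) * of_real (h (y - of_int k / real N)) * unit_char (- of_int l * y)"
      by (simp add: cnj_unit_char)
  qed
  finally show ?thesis
    using \<beta>(1) by (simp add: gabor_coeff_def \<beta>_def scaleR_conv_of_real)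
qed

lemma gabor_sum:
  fixes f :: "real \<Rightarrow> complex"
  defines "g \<equiv> \<lambda>y. f (sqrt (real N) * y)"
  assumes f: "f \<in> L2"
  shows "(\<lambda>z. (cmod (L2_inner f (gabor_system scaled_window z)))\<^sup>2) summable_on square_lattice (1 / sqrt (real N))"
    and "(\<Sum>\<^sub>\<infinity>z\<in>square_lattice (1 / sqrt (real N)). (cmod (L2_inner f (gabor_system scaled_window z)))\<^sup>2) =
      real N * infsum (coeff_sq g) (UNIV \<times> UNIV)"
proof -
  have inj: "inj_on (lattice_point (1 / sqrt (real N))) (UNIV \<times> UNIV)"
    using inj_lattice_point[of "1 / sqrt (real N)"] sqrt_N by simp
  have eq: "(cmod (L2_inner f (gabor_system scaled_window (lattice_point (1 / sqrt (real N)) p))))\<^sup>2 = real N * coeff_sq g p" for p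
    by (cases p) (simp add: gabor_system_def L2_inner_tf_shift norm_mult power_mult_distrib g_def)
  have "g \<in> L2" unfolding g_def using f sqrt_N by (intro L2_scale) auto
  then have "(\<lambda>p. real N * coeff_sq g p) summable_on UNIV \<times> UNIV"
    by (intro summable_on_cmult_right bessel)
  then show "(\<lambda>z. (cmod (L2_inner f (gabor_system scaled_window z)))\<^sup>2) summable_on square_lattice (1 / sqrt (real N))"
    unfolding square_lattice_eq by (subst summable_on_reindex[OF inj]) (simp only: o_def eq)
  show "(\<Sum>\<^sub>\<infinity>z\<in>square_lattice (1 / sqrt (real N)). (cmod (L2_inner f (gabor_system scaled_window z)))\<^sup>2) =
      real N * infsum (coeff_sq g) (UNIV \<times> UNIV)"
    unfolding square_lattice_eq by (subst infsum_reindex[OF inj]) (simp only: o_def eq infsum_cmult_right')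
qed

text \<open>The coefficient sum scales by \<open>real N\<close>, the squared norm only by
  \<open>sqrt (real N)\<close>; both bounds therefore acquire the factor
  \<open>\<beta> = sqrt (real N)\<close>.\<close>

theorem gabor_frame_if_zak_sq_nonzero:
  assumes "\<And>y \<xi>. zak_sq y \<xi> \<noteq> 0"
  shows "gabor_frame scaled_window (square_lattice (1 / sqrt (real N)))"
proof -
  obtain A where A: "A > 0" "\<And>y \<xi>. y \<in> {0..<1} \<Longrightarrow> A \<le> zak_sq y \<xi>"
    using zak_sq_lower_bound assms by blast
  define \<beta> where "\<beta> = sqrt (real N)"
  have \<beta>: "\<beta> > 0" "real N = \<beta> * \<beta>" using sqrt_N by (auto simp: \<beta>_def)
  have "A \<le> zak_bound" using A(2)[of 0 0] zak_sq_le[of 0 0] by simp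
  have bounds: "(\<lambda>z. (cmod (L2_inner f (gabor_system scaled_window z)))\<^sup>2) summable_on square_lattice (1 / sqrt (real N)) \<and>
      \<beta> * (A / 2) * (L2_norm f)\<^sup>2 \<le>
        (\<Sum>\<^sub>\<infinity>z\<in>square_lattice (1 / sqrt (real N)). (cmod (L2_inner f (gabor_system scaled_window z)))\<^sup>2) \<and>
      (\<Sum>\<^sub>\<infinity>z\<in>square_lattice (1 / sqrt (real N)). (cmod (L2_inner f (gabor_system scaled_window z)))\<^sup>2) \<le>
        \<beta> * zak_bound * (L2_norm f)\<^sup>2"
    if f: "f \<in> L2" for f
  proof (intro conjI)
    define g where "g = (\<lambda>y. f (\<beta> * y))"
    have g: "g \<in> L2" unfolding g_def using f \<beta> by (intro L2_scale) auto
    note sum = gabor_sum(2)[OF f, folded \<beta>_def, folded g_def]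
    have norm: "(L2_norm f)\<^sup>2 = \<beta> * (LINT y|lborel. (norm (g y))\<^sup>2)"
      unfolding g_def \<beta>_def by (rule L2_norm_scale)
    show "(\<lambda>z. (cmod (L2_inner f (gabor_system scaled_window z)))\<^sup>2) summable_on square_lattice (1 / sqrt (real N))"
      by (rule gabor_sum(1)[OF f])
    have "\<beta> * (A / 2) * (L2_norm f)\<^sup>2 = real N * (A / 2 * (LINT y|lborel. (norm (g y))\<^sup>2))"
      by (simp add: norm \<beta>(2))
    also have "\<dots> \<le> real N * infsum (coeff_sq g) (UNIV \<times> UNIV)"
      by (intro mult_left_mono frame_lower_bound g A(2)) auto
    finally show "\<beta> * (A / 2) * (L2_norm f)\<^sup>2 \<le>
        (\<Sum>\<^sub>\<infinity>z\<in>square_lattice (1 / sqrt (real N)). (cmod (L2_inner f (gabor_system scaled_window z)))\<^sup>2)"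
      unfolding \<beta>_def[symmetric] sum .
    have "real N * infsum (coeff_sq g) (UNIV \<times> UNIV) \<le> real N * (zak_bound * (LINT y|lborel. (norm (g y))\<^sup>2))"
      by (intro mult_left_mono bessel(2) g) auto
    also have "\<dots> = \<beta> * zak_bound * (L2_norm f)\<^sup>2"
      by (simp add: norm \<beta>(2))
    finally show "(\<Sum>\<^sub>\<infinity>z\<in>square_lattice (1 / sqrt (real N)). (cmod (L2_inner f (gabor_system scaled_window z)))\<^sup>2) \<le>
        \<beta> * zak_bound * (L2_norm f)\<^sup>2"
      unfolding \<beta>_def[symmetric] sum .
  qed
  show ?thesis
    unfolding gabor_frame_def L2_frame_def
  proof (rule conjI, simp add: gabor_system_def tf_shift_scaled_window_in_L2,
      rule exI[of _ "\<beta> * (A / 2)"], rule exI[of _ "\<beta> * zak_bound"], intro conjI)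
    show "0 < \<beta> * (A / 2)" using A \<beta> by simp
    show "\<beta> * (A / 2) \<le> \<beta> * zak_bound" using A(1) \<beta> \<open>A \<le> zak_bound\<close> by (intro mult_left_mono) auto
  qed (use bounds in blast)
qed

theorem not_gabor_frame_if_zak_sq_zero:
  assumes "zak_sq (1/2) \<xi> = 0"
  shows "\<not> gabor_frame scaled_window (square_lattice (1 / sqrt (real N)))"
proof
  assume "gabor_frame scaled_window (square_lattice (1 / sqrt (real N)))"
  then obtain A where A: "A > 0" "\<And>f. f \<in> L2 \<Longrightarrow> A * (L2_norm f)\<^sup>2 \<le>
      (\<Sum>\<^sub>\<infinity>z\<in>square_lattice (1 / sqrt (real N)). (cmod (L2_inner f (gabor_system scaled_window z)))\<^sup>2)"
    unfolding gabor_frame_def L2_frame_def by blast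
  define \<beta> where "\<beta> = sqrt (real N)"
  have \<beta>: "\<beta> > 0" "real N = \<beta> * \<beta>" using sqrt_N by (auto simp: \<beta>_def)
  \<comment> \<open>Division by \<open>\<beta>\<close> compensates the net factor of the
    rescaling.\<close>
  obtain g where g: "g \<in> L2" "infsum (coeff_sq g) (UNIV \<times> UNIV) < A / \<beta> * (LINT y|lborel. (norm (g y))\<^sup>2)"
    using zak_sq_zero_imp_no_lower_bound[OF assms, of "A / \<beta>"] A(1) \<beta>(1) by auto
  define f where "f = (\<lambda>t. g (1 / \<beta> * t))"
  have f: "f \<in> L2" unfolding f_def using g(1) \<beta> by (intro L2_scale) auto
  have fg: "(\<lambda>y. f (\<beta> * y)) = g" using \<beta>(1) by (simp add: f_def)
  have "A * (L2_norm f)\<^sup>2 \<le> real N * infsum (coeff_sq g) (UNIV \<times> UNIV)"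
    using A(2)[OF f] gabor_sum(2)[OF f, folded \<beta>_def, unfolded fg] by (simp add: \<beta>_def)
  also have "\<dots> < real N * (A / \<beta> * (LINT y|lborel. (norm (g y))\<^sup>2))"
    using g(2) N_pos by (intro mult_strict_left_mono) auto
  also have "\<dots> = A * (\<beta> * (LINT y|lborel. (norm (g y))\<^sup>2))"
    using \<beta> by simp
  also have "\<beta> * (LINT y|lborel. (norm (g y))\<^sup>2) = (L2_norm f)\<^sup>2"
    unfolding L2_norm_scale \<beta>_def[symmetric] fun_cong[OF fg] ..
  finally show False by simp
qed

end

theorem theorem1p1:
  fixes n :: nat
  shows "gabor_frame (\<lambda>t. complex_of_real (hermite_fun n t)) (square_lattice (1 / sqrt (real n + 1)))
    \<longleftrightarrow> n \<ge> 4"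
proof -
  obtain K where K: "zak_window (hermite_window n) K (n + 1)" by (rule hermite_zak_window)
  interpret zak_window "hermite_window n" K "n + 1" by (rule K)
  define C where "C = complex_of_real (hermite_const n * (2 / sqrt (real (n + 1))) ^ n)"
  have C: "C \<noteq> 0" using hermite_const_pos[of n] by (simp add: C_def)
  have zak: "zak v \<xi> = C * theta_deriv n (theta (n + 1) v \<xi>)" for v \<xi>
    unfolding C_def by (rule zak_hermite_window[OF K])
  have window: "scaled_window = (\<lambda>t. complex_of_real (hermite_fun n t))"
    unfolding fun_eq_iff scaled_window_def hermite_window_def by simp
  have lattice: "square_lattice (1 / sqrt (real n + 1)) = square_lattice (1 / sqrt (real (n + 1)))"
    by (simp add: add.commute)
  show ?thesis
  proof
    assume "n \<ge> 4"
    have "zak_sq y \<xi> \<noteq> 0" for y \<xi>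
    proof -
      \<comment> \<open>With \<open>c = (n + 1) * y\<close> the centres
        \<open>(c + l) / (n + 1)\<close> are the times at which \<open>zak_sq y\<close> samples the
        Zak transform.\<close>
      obtain l where l: "l < n + 1" "theta_deriv n (theta (n + 1) ((real (n + 1) * y + real l) / real (n + 1)) \<xi>) \<noteq> 0"
        by (rule theta_deriv_nonzero[OF \<open>n \<ge> 4\<close>])
      have "(real (n + 1) * y + real l) / real (n + 1) = y + real l / real (n + 1)"
        by (simp add: add_divide_distrib)
      then have "zak (y + real l / real (n + 1)) \<xi> \<noteq> 0" using l(2) C by (simp only: zak) simp
      then have "0 < (norm (zak (y + real l / real (n + 1)) \<xi>))\<^sup>2" by simp
      also have "\<dots> \<le> zak_sq y \<xi>"
        unfolding zak_sq_def using l(1) by (intro member_le_sum) auto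
      finally show ?thesis by simp
    qed
    then show "gabor_frame (\<lambda>t. complex_of_real (hermite_fun n t)) (square_lattice (1 / sqrt (real n + 1)))"
      using gabor_frame_if_zak_sq_nonzero unfolding window lattice by blast
  next
    assume frame: "gabor_frame (\<lambda>t. complex_of_real (hermite_fun n t)) (square_lattice (1 / sqrt (real n + 1)))"
    show "n \<ge> 4"
    proof (rule ccontr)
      assume "\<not> n \<ge> 4"
      then have "n \<le> 3" by simp
      have "zak (1/2 + real j / real (n + 1)) (real (n + 1) / 2) = 0" for j
      proof -
        have "1/2 + x / y = (y / 2 + x) / y" if "y \<noteq> 0" for x y :: real
          using that by (simp add: field_simps)
        then have "1/2 + real j / real (n + 1) = (real (n + 1) / 2 + real j) / real (n + 1)"
          by (simp only: of_nat_eq_0_iff)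
        then show ?thesis using theta_deriv_eq_0[OF \<open>n \<le> 3\<close>, of j] by (simp only: zak) simp
      qed
      then have "zak_sq (1/2) (real (n + 1) / 2) = 0"
        unfolding zak_sq_def by simp
      then show False
        using not_gabor_frame_if_zak_sq_zero frame unfolding window lattice by blast
    qed
  qed
qed

end
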